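(* Let $d \ge 1$, $k \ge 1$ and $m \ge 0$ be integers such that the Stirling number of the second kind $S(d+m+k-1,k)$ is odd. Then for any $d+m+k-1$ mass assignments $\mu_1,\dots,\mu_{d+m+k-1}$ to the $d$-dimensional linear subspaces of $\mathbb{R}^{d+m}$, there exist a $d$-dimensional linear subspace $V$ of $\mathbb{R}^{d+m}$ and a family of $k$ or fewer parallel (affine) hyperplanes in $V$ whose induced chessboard coloring of $V$ bisects each of the measures $\mu_1[V],\dots,\mu_{d+m+k-1}[V]$ assigned to $V$.
   Context: Mass assignments. For a Euclidean vector space $V$, $\mathcal{M}(V)$ denotes the space of finite measures on $V$ that are absolutely continuous with respect to the Lebesgue measure on $V$, equipped with the weak topology. For a Euclidean vector bundle $\xi\colon \mathbb{R}^d \to E \xrightarrow{\pi} B$, let $\mathcal{M}(\xi)$ be the induced bundle with total space $\{(b,\nu) : b\in B,\ \nu\in\mathcal{M}(\pi^{-1}(b))\}$, fiber $\mathcal{M}(\mathbb{R}^d)$ and projection $(b,\nu)\mapsto b$; the total space is topologized using the local trivializations of $\pi$. A mass assignment on $\xi$ is a (continuous) section $\mu$ of $\mathcal{M}(\xi)$; $\mu[b]\in\mathcal{M}(\pi^{-1}(b))$ denotes the measure it gives on the fiber over $b$. A mass assignment to the $d$-dimensional linear subspaces of $\mathbb{R}^{d+m}$ is a mass assignment on the canonical rank $d$ vector bundle $\gamma_d$ over the Grassmann manifold $G_d(\mathbb{R}^{d+m})$ of linear $d$-subspaces of $\mathbb{R}^{d+m}$ (the fiber over $V$ is $V$ itself);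 so it continuously assigns to each such $V$ a finite absolutely continuous measure $\mu[V]$ on $V$. Chessboard coloring. Given a finite family of parallel affine hyperplanes in a Euclidean space $V$, the chessboard coloring it induces is the coloring of $V$ with two colors, white and black, alternating color each time a hyperplane of the family is crossed; the white and black sets are taken closed, with common boundary the union of the hyperplanes. It bisects a measure $\nu$ on $V$ if the white set and the black set have equal $\nu$-measure. *)

theory Defs
  imports "HOL-Analysis.Analysis" "HOL-Combinatorics.Stirling"
begin

text \<open>
  Euclidean vector spaces are linear subspaces \<open>V\<close> of an ambient type of class
  \<^class>\<open>euclidean_space\<close>, with the inherited inner product. A measure on \<open>V\<close> is a
  measure with the Borel sigma-algebra of \<open>V\<close>.
\<close>

subsection \<open>Measures on Euclidean vector spaces\<close>

definition orthonormal_basis_of :: "'a::euclidean_space set \<Rightarrow> 'a set \<Rightarrow> bool" where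
  "orthonormal_basis_of V B \<longleftrightarrow>
     B \<subseteq> V \<and> pairwise orthogonal B \<and> (\<forall>b\<in>B. norm b = 1) \<and> span B = V"

text \<open>
  The image of the product Lebesgue measure under the linear isometry given by orthonormal
  coordinates. By rotation invariance it does not depend on the basis that is chosen.
\<close>

definition lebesgue_subspace :: "'a::euclidean_space set \<Rightarrow> 'a measure" where
  "lebesgue_subspace V =
     (let B = (SOME B. orthonormal_basis_of V B)
      in distr (Pi\<^sub>M B (\<lambda>_. lborel :: real measure)) (restrict_space borel V)
           (\<lambda>x. \<Sum>b\<in>B. x b *\<^sub>R b))"

definition masses :: "'a::euclidean_space set \<Rightarrow> 'a measure set" where
  "masses V =
     {\<nu>. sets \<nu> = sets (restrict_space borel V) \<and> finite_measure \<nu> \<and>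
         absolutely_continuous (lebesgue_subspace V) \<nu>}"

text \<open>
  The coarsest topology on the masses for which integration against every bounded continuous
  real function on \<open>V\<close> is continuous.
\<close>

definition weak_topology :: "'a::euclidean_space set \<Rightarrow> 'a measure topology" where
  "weak_topology V = topology_generated_by
     {{\<nu> \<in> masses V. (\<integral>x. f x \<partial>\<nu>) \<in> S} | (f :: 'a \<Rightarrow> real) S.
        continuous_on V f \<and> bounded (f ` V) \<and> open S}"

subsection \<open>The Grassmann manifold and its canonical bundle\<close>

definition grassmannian :: "nat \<Rightarrow> 'a::euclidean_space set set" where
  "grassmannian d = {V. subspace V \<and> dim V = d}"

definition stiefel_topology :: "nat \<Rightarrow> (nat \<Rightarrow> 'a::euclidean_space) topology" where
  "stiefel_topology d =
     subtopology (product_topology (\<lambda>_. euclidean) {..<d})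
       {e. \<forall>i<d. \<forall>j<d. e i \<bullet> e j = (if i = j then 1 else 0)}"

text \<open>The quotient topology along the map that sends an orthonormal frame to its span.\<close>

definition grassmannian_topology :: "nat \<Rightarrow> 'a::euclidean_space set topology" where
  "grassmannian_topology d = topology (\<lambda>W. W \<subseteq> grassmannian d \<and>
     openin (stiefel_topology d)
       {e \<in> topspace (stiefel_topology d). span (e ` {..<d}) \<in> W})"

lemma openin_grassmannian_topology:
  fixes W :: "'a::euclidean_space set set"
  shows "openin (grassmannian_topology d) W \<longleftrightarrow> W \<subseteq> grassmannian d \<and>
     openin (stiefel_topology d)
       {e \<in> topspace (stiefel_topology d). span (e ` {..<d}) \<in> W}"
proof -
  let ?P = "\<lambda>W :: 'a set set. {e \<in> topspace (stiefel_topology d). span (e ` {..<d}) \<in> W}"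
  have "istopology (\<lambda>W :: 'a set set. W \<subseteq> grassmannian d \<and> openin (stiefel_topology d) (?P W))"
    unfolding istopology_def
  proof (intro conjI allI impI)
    fix S T :: "'a set set"
    assume S: "S \<subseteq> grassmannian d \<and> openin (stiefel_topology d) (?P S)"
      and T: "T \<subseteq> grassmannian d \<and> openin (stiefel_topology d) (?P T)"
    show "S \<inter> T \<subseteq> grassmannian d" using S by auto
    have "?P (S \<inter> T) = ?P S \<inter> ?P T" by auto
    then show "openin (stiefel_topology d) (?P (S \<inter> T))"
      using S T by (metis (no_types, lifting) openin_Int)
  next
    fix K :: "'a set set set"
    assume K: "\<forall>W\<in>K. W \<subseteq> grassmannian d \<and> openin (stiefel_topology d) (?P W)"
    show "\<Union>K \<subseteq> grassmannian d" using K by blast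
    have "?P (\<Union>K) = \<Union>(?P ` K)" by blast
    moreover have "openin (stiefel_topology d) (\<Union>(?P ` K))"
      using K by (intro openin_Union) blast
    ultimately show "openin (stiefel_topology d) (?P (\<Union>K))" by metis
  qed
  from topology_inverse'[OF this] show ?thesis
    by (simp add: grassmannian_topology_def)
qed

definition canonical_bundle :: "nat \<Rightarrow> ('a::euclidean_space set \<times> 'a) topology" where
  "canonical_bundle d =
     subtopology (prod_topology (grassmannian_topology d) euclidean)
       {(V, v). V \<in> grassmannian d \<and> v \<in> V}"

text \<open>
  A local trivialization over \<open>U\<close>. The model fibre \<open>F\<close> may be any \<open>d\<close>-dimensional Euclidean space
  inside the ambient one. The fibrewise map \<open>V \<rightarrow> F\<close> is the restriction of the linear map \<open>\<phi> V\<close> of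
  the ambient space, whose values outside \<open>V\<close> play no role.
\<close>

definition local_trivialization ::
    "nat \<Rightarrow> 'a::euclidean_space set set \<Rightarrow> 'a set \<Rightarrow> ('a set \<Rightarrow> 'a \<Rightarrow> 'a) \<Rightarrow> bool" where
  "local_trivialization d U F \<phi> \<longleftrightarrow>
     openin (grassmannian_topology d) U \<and> F \<in> grassmannian d \<and> (\<forall>V\<in>U. linear (\<phi> V)) \<and>
     homeomorphic_map
       (subtopology (canonical_bundle d) {(V, v). V \<in> U})
       (prod_topology (subtopology (grassmannian_topology d) U) (top_of_set F))
       (\<lambda>(V, v). (V, \<phi> V v))"

subsection \<open>Mass assignments\<close>

text \<open>
  The total space of the induced bundle of masses, with the topology whose charts are the
  fibrewise push-forwards along the local trivializations of the canonical bundle.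
\<close>

definition mass_bundle :: "nat \<Rightarrow> ('a::euclidean_space set \<times> 'a measure) topology" where
  "mass_bundle d = topology_generated_by
     {{(V, \<nu>). V \<in> U \<and> \<nu> \<in> masses V \<and>
               (V, distr \<nu> (restrict_space borel F) (\<phi> V)) \<in> S} | U F \<phi> S.
        local_trivialization d U F \<phi> \<and>
        openin (prod_topology (subtopology (grassmannian_topology d) U) (weak_topology F)) S}"

definition mass_assignment :: "nat \<Rightarrow> ('a::euclidean_space set \<Rightarrow> 'a measure) \<Rightarrow> bool" where
  "mass_assignment d \<mu> \<longleftrightarrow>
     continuous_map (grassmannian_topology d) (mass_bundle d) (\<lambda>V. (V, \<mu> V))"

subsection \<open>Chessboard colorings\<close>

definition hyperplane_in :: "'a::euclidean_space set \<Rightarrow> 'a set \<Rightarrow> bool" where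
  "hyperplane_in V H \<longleftrightarrow> affine H \<and> H \<subseteq> V \<and> H \<noteq> {} \<and> aff_dim H = int (dim V) - 1"

definition parallel_hyperplanes :: "'a::euclidean_space set \<Rightarrow> 'a set set \<Rightarrow> bool" where
  "parallel_hyperplanes V \<H> \<longleftrightarrow>
     finite \<H> \<and> (\<forall>H\<in>\<H>. hyperplane_in V H) \<and> (\<forall>H\<in>\<H>. \<forall>H'\<in>\<H>. affine_parallel H H')"

text \<open>
  Passing from \<open>x\<close> to \<open>y\<close> along a segment crosses exactly the hyperplanes that meet the segment,
  as \<open>x\<close> and \<open>y\<close> lie on none of them; the color changes iff their number is odd. This
  determines the pair \<open>W\<close> (white), \<open>B\<close> (black) up to exchanging the two colors.
\<close>

definition chessboard_coloring ::
    "'a::euclidean_space set \<Rightarrow> 'a set set \<Rightarrow> 'a set \<Rightarrow> 'a set \<Rightarrow> bool" where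
  "chessboard_coloring V \<H> W B \<longleftrightarrow>
     closed W \<and> closed B \<and> W \<union> B = V \<and> W \<inter> B = \<Union>\<H> \<and>
     (\<forall>x \<in> V - \<Union>\<H>. \<forall>y \<in> V - \<Union>\<H>.
        (x \<in> W \<longleftrightarrow> y \<in> W) \<longleftrightarrow> even (card {H \<in> \<H>. closed_segment x y \<inter> H \<noteq> {}}))"

definition bisects :: "'a set \<Rightarrow> 'a set \<Rightarrow> 'a measure \<Rightarrow> bool" where
  "bisects W B \<nu> \<longleftrightarrow> measure \<nu> W = measure \<nu> B"

end

theory Submission
  imports Defs "HOL-Library.Multiset" "HOL-Computational_Algebra.Polynomial" "HOL-Real_Asymp.Real_Asymp"
begin

text \<open>
  Write \<open>N = d + m\<close> and \<open>n = N + k - 1\<close>. A unit vector \<open>v\<close> in a \<open>d\<close>-space \<open>V\<close> and a nonzero real polynomial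
  \<open>p\<close> of degree at most \<open>k\<close> colour \<open>x\<close> in \<open>V\<close> by the sign of \<open>p (x \<bullet> v)\<close>, which is a chessboard coloring
  with at most \<open>k\<close> hyperplanes. The \<open>n\<close> integrals of this sign depend continuously on \<open>(V, v, p)\<close>, change
  sign with \<open>p\<close>, and are invariant under \<open>v \<mapsto> -v\<close>, \<open>p(s) \<mapsto> p(-s)\<close>; a common zero is wanted.

  Fix a \<open>d\<close>-space \<open>F\<close>. The pairs \<open>(V, v)\<close> are restricted to an \<open>(N - 1)\<close>-dimensional family, a blow-up of
  the sphere of all directions: for a unit vector \<open>q\<close> of \<open>F\<close>, let \<open>v\<close> lie in the span of \<open>q\<close> and the
  orthogonal complement of \<open>F\<close>, and let \<open>V\<close> be spanned by \<open>v\<close> and the orthogonal complement of \<open>q\<close> in \<open>F\<close>.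
  In spherical coordinates everything lives on a cube of dimension \<open>n\<close>. On a fine grid, label a point
  by the index and the sign of the largest of the \<open>n\<close> values, and let \<open>u i j\<close> be the number modulo 2 of
  simplices with alternating labels (as in Fan's lemma) in the face where only \<open>i\<close> coordinates of
  \<open>(V, v)\<close> and \<open>j\<close> of \<open>p\<close> vary. If no edge carries opposite labels, counting facets and using the symmetries
  on the faces of the box gives \<open>u i j = j * u (i - 1) j + u i (j - 1)\<close>, the recurrence of the Stirling numbers, so
  \<open>u (N - 1) k\<close> has the parity of \<open>Stirling n k\<close>. But \<open>u (N - 1) k = 0\<close>, since alternation would need \<open>n + 1\<close>
  distinct indices. So there are edges with opposite labels, and they accumulate at a zero.
\<close>

subsection \<open>Alternating labels\<close>

text \<open>The cells that are counted are the hemispheres of the antipodal cell structure of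
  spheres. With all later angles 0, the first \<open>j\<close> angles fill the half of a
  \<open>j\<close>-sphere whose last coordinate is nonnegative. The ends of the last of these angles
  are the two halves of the equator; at an end of an earlier angle the next angle has no effect, and
  such a face contributes nothing.

  The factor \<open>j\<close> comes from the coefficients. Reflections of the \<open>j\<close>
  angles can negate coefficients \<open>0\<close> to \<open>j - 1\<close> but not coefficient
  \<open>j\<close>. So the reversal of \<open>p\<close> is realized by multiplying coefficient
  \<open>l\<close> by \<open>(-1) ^ (l + j)\<close>, and the values pick up the sign
  \<open>(-1) ^ j\<close>. For even \<open>j\<close> the two ends of the last direction angle carry
  equal labels and cancel modulo 2; for odd \<open>j\<close> they carry opposite labels and give
  \<open>u (i - 1) j\<close>.

  The blow-up is needed because \<open>v\<close> alone does not determine \<open>V\<close> when it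
  is orthogonal to \<open>F\<close>. It creates one exceptional pair of faces, where the last angle
  of \<open>q\<close> ends but the first angle of \<open>v\<close> still matters; passing from
  \<open>q\<close> to \<open>-q\<close> matches these faces without changing labels, so they
  cancel.\<close>

fun alternating :: "bool \<Rightarrow> bool list \<Rightarrow> bool" where
  "alternating s [] = True"
| "alternating s (x # xs) = (x = s \<and> alternating (\<not> s) xs)"

text \<open>A label \<open>2 * i\<close> means a positive value at index \<open>i\<close> and
  \<open>2 * i + 1\<close> a value that is not positive. Sorting therefore orders by index,
  \<open>even\<close> reads the sign, and \<open>s\<close> is the sign at the smallest
  index.\<close>

definition alternating_mset :: "bool \<Rightarrow> nat multiset \<Rightarrow> bool" where
  "alternating_mset s M = alternating s (map even (sorted_list_of_multiset M))"

lemma sorted_list_of_multiset_remove1: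
  "sorted_list_of_multiset (M - {#x#}) = remove1 x (sorted_list_of_multiset M)"
proof -
  have "sort (remove1 x (sorted_list_of_multiset M)) = remove1 x (sorted_list_of_multiset M)"
    by (simp add: sorted_remove1 sorted_sort_id)
  then show ?thesis
    by (metis mset_remove1 mset_sorted_list_of_multiset sorted_list_of_multiset_mset)
qed

text \<open>If a nonempty list alternates from \<open>s\<close>, only deleting its last entry leaves
  a list alternating from \<open>s\<close>; if it alternates from \<open>\<not> s\<close>, only
  deleting the first does. Otherwise an admissible deletion must destroy the only pair of adjacent
  equal signs, and either of its two members may go.\<close>

lemma alternating_removals:
  assumes "sorted xs"
  shows "even ((\<Sum>x\<in>#mset xs. of_bool (alternating s (map even (remove1 x xs))))
     + of_bool (alternating s (map even xs)) + of_bool (alternating (\<not> s) (map even xs)) :: nat)"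
  using assms
proof (induction xs arbitrary: s)
  case Nil
  then show ?case by simp
next
  case (Cons a xs)
  \<comment> \<open>This holds also for \<open>x = a\<close>: sortedness then puts another copy of
    \<open>a\<close> at the head of \<open>xs\<close>, and deleting either copy gives the same
    list.\<close>
  have rem: "remove1 x (a # xs) = a # remove1 x xs" if "x \<in># mset xs" for x
    using Cons.prems that by (cases xs) (auto)
  define S where "S = (\<Sum>x\<in>#mset xs. of_bool (alternating s (map even (remove1 x (a # xs)))) :: nat)"
  define T where "T = (\<Sum>x\<in>#mset xs. of_bool (alternating (\<not> s) (map even (remove1 x xs))) :: nat)"
  have "S = (\<Sum>x\<in>#mset xs. of_bool (alternating s (map even (a # remove1 x xs))))"
    unfolding S_def by (intro arg_cong[where f = sum_mset] image_mset_cong) (simp only: rem)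
  then have S: "S = (if even a = s then T else 0)"
    by (auto simp: T_def of_bool_def)
  have tot: "(\<Sum>x\<in>#mset (a # xs). of_bool (alternating s (map even (remove1 x (a # xs)))) :: nat)
      = of_bool (alternating s (map even xs)) + S"
    by (simp add: S_def)
  have "even (T + of_bool (alternating (\<not> s) (map even xs)) + of_bool (alternating s (map even xs)))"
    using Cons.IH[of "\<not> s"] Cons.prems by (simp add: T_def)
  then show ?case
    unfolding tot using S by (cases "even a = s") auto
qed

lemma alternating_mset_removals:
  "even ((\<Sum>x\<in>#M. of_bool (alternating_mset s (M - {#x#})))
     + of_bool (alternating_mset s M) + of_bool (alternating_mset (\<not> s) M) :: nat)"
  using alternating_removals[of "sorted_list_of_multiset M" s]
  by (simp add: alternating_mset_def sorted_list_of_multiset_remove1)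

lemma even_sum_involution:
  fixes h :: "'a \<Rightarrow> nat"
  assumes "finite S"
    and "\<And>x. x \<in> S \<Longrightarrow> f x \<in> S \<and> f (f x) = x \<and> f x \<noteq> x \<and> h (f x) = h x"
  shows "even (sum h S)"
  using assms
proof (induction S rule: finite_psubset_induct)
  case (psubset S)
  show ?case
  proof (cases "S = {}")
    case False
    then obtain x where x: "x \<in> S" by auto
    let ?T = "S - {x, f x}"
    have "even (sum h ?T)"
    proof (rule psubset.IH)
      show "?T \<subset> S" using x by auto
      fix y assume "y \<in> ?T"
      then show "f y \<in> ?T \<and> f (f y) = y \<and> f y \<noteq> y \<and> h (f y) = h y"
        using psubset.prems[of y] psubset.prems[of x] x by (metis DiffD1 DiffD2 DiffI insert_iff singletonD insertCI)
    qed
    moreover have "sum h S = sum h ?T + sum h {x, f x}"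
      using psubset.prems[of x] x psubset.hyps by (intro sum.subset_diff) auto
    moreover have "sum h {x, f x} = 2 * h x" using psubset.prems[of x] x by (simp add: eq_commute[of x])
    ultimately show ?thesis by simp
  qed simp
qed

subsection \<open>Alternating simplices in a triangulated grid\<close>

text \<open>Every face of the cube is again of this form, with a smaller set \<open>D\<close> of
  free coordinates and the others frozen at the values of \<open>x\<close>; so passing to faces
  needs no renumbering.\<close>

definition grid_box :: "int \<Rightarrow> nat set \<Rightarrow> (nat \<Rightarrow> int) \<Rightarrow> (nat \<Rightarrow> int) set" where
  "grid_box K D x = {y. \<forall>i. if i \<in> D then 0 \<le> y i \<and> y i \<le> K else y i = x i}"

definition odd_step :: "nat set \<Rightarrow> (nat \<Rightarrow> int) \<Rightarrow> (nat \<Rightarrow> int) \<Rightarrow> bool" where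
  "odd_step D y z \<longleftrightarrow> (\<exists>c\<in>D. even (y c) \<and> \<bar>z c - y c\<bar> = 1 \<and> (\<forall>i. i \<noteq> c \<longrightarrow> z i = y i))"

text \<open>
  The maximal simplices of the triangulation that cuts every cube of the grid along the diagonal from
  its corner with even coordinates to its corner with odd ones. Unlike the monotone triangulation, it
  is invariant under reflections of single coordinates when \<open>K\<close> is even.
\<close>

definition simplices :: "int \<Rightarrow> nat set \<Rightarrow> (nat \<Rightarrow> int) \<Rightarrow> (nat \<Rightarrow> int) list set" where
  "simplices K D x = {ys. length ys = Suc (card D) \<and> set ys \<subseteq> grid_box K D x \<and>
     (\<forall>c\<in>D. even ((ys ! 0) c)) \<and> (\<forall>t<card D. odd_step D (ys ! t) (ys ! Suc t))}"

lemma grid_boxI: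
  "(\<And>i. i \<in> D \<Longrightarrow> 0 \<le> y i \<and> y i \<le> K) \<Longrightarrow> (\<And>i. i \<notin> D \<Longrightarrow> y i = x i) \<Longrightarrow> y \<in> grid_box K D x"
  by (simp add: grid_box_def)

lemma grid_boxD:
  assumes "y \<in> grid_box K D x"
  shows "i \<in> D \<Longrightarrow> 0 \<le> y i" "i \<in> D \<Longrightarrow> y i \<le> K" "i \<notin> D \<Longrightarrow> y i = x i"
  using assms by (auto simp: grid_box_def dest: spec[of _ i])

lemma finite_grid_box:
  assumes "finite D"
  shows "finite (grid_box K D x)"
proof -
  let ?G = "{f. \<forall>i. (i \<in> D \<longrightarrow> f i \<in> {0..K}) \<and> (i \<notin> D \<longrightarrow> f i = (0::int))}"
  have "finite ?G"
    using assms by (intro finite_set_of_finite_funs) auto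
  moreover have "grid_box K D x \<subseteq> (\<lambda>g i. if i \<in> D then g i else x i) ` ?G"
  proof
    fix y assume y: "y \<in> grid_box K D x"
    have "y = (\<lambda>i. if i \<in> D then (\<lambda>i. if i \<in> D then y i else 0) i else x i)"
      using grid_boxD[OF y] by auto
    moreover have "(\<lambda>i. if i \<in> D then y i else 0) \<in> ?G"
      using grid_boxD[OF y] by auto
    ultimately show "y \<in> (\<lambda>g i. if i \<in> D then g i else x i) ` ?G" by (rule image_eqI)
  qed
  ultimately show ?thesis using finite_surj by blast
qed

lemma finite_simplices: "finite D \<Longrightarrow> finite (simplices K D x)"
  by (rule finite_subset[OF _ finite_lists_length_eq[OF finite_grid_box, of D K x "Suc (card D)"]])
     (auto simp: simplices_def)

text \<open>The first step leaves its coordinate odd and the second starts from an even one, so they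
  move different coordinates and can be made in the other order. The point \<open>a + c - b\<close>
  is the fourth corner of the square.\<close>

lemma odd_step_middle:
  assumes "odd_step D a b" "odd_step D b c"
  shows "odd_step D a (\<lambda>i. a i + c i - b i)" "odd_step D (\<lambda>i. a i + c i - b i) c"
    "(\<lambda>i. a i + c i - b i) \<noteq> b" "a i + c i - b i = a i \<or> a i + c i - b i = c i"
proof -
  from assms obtain u v where u: "u \<in> D" "even (a u)" "\<bar>b u - a u\<bar> = 1" "\<And>i. i \<noteq> u \<Longrightarrow> b i = a i"
    and v: "v \<in> D" "even (b v)" "\<bar>c v - b v\<bar> = 1" "\<And>i. i \<noteq> v \<Longrightarrow> c i = b i"
    by (auto simp: odd_step_def)
  have "b u = a u + 1 \<or> b u = a u - 1" using u(3) by linarith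
  then have "u \<noteq> v" using u(2) v(2) by auto
  show "odd_step D a (\<lambda>i. a i + c i - b i)"
    unfolding odd_step_def using u v \<open>u \<noteq> v\<close> by (intro bexI[of _ v]) auto
  show "odd_step D (\<lambda>i. a i + c i - b i) c"
    unfolding odd_step_def using u v \<open>u \<noteq> v\<close> by (intro bexI[of _ u]) auto
  have "a u + c u - b u \<noteq> b u" using u v \<open>u \<noteq> v\<close> by auto
  then show "(\<lambda>i. a i + c i - b i) \<noteq> b" by metis
  show "a i + c i - b i = a i \<or> a i + c i - b i = c i"
    using u(4)[of i] v(4)[of i] \<open>u \<noteq> v\<close> by (cases "i = u") auto
qed

text \<open>The moved coordinate of \<open>b\<close> is odd and has two even neighbours;
  \<open>2 * b - a\<close> takes the other one. This gives the second simplex at the facet opposite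
  the even corner.\<close>

lemma odd_step_reflect_first:
  assumes "odd_step D a b"
  shows "odd_step D (\<lambda>i. 2 * b i - a i) b" "(\<lambda>i. 2 * b i - a i) \<noteq> a" "even (2 * b i - a i) \<longleftrightarrow> even (a i)"
proof -
  from assms(1) obtain u where u: "u \<in> D" "even (a u)" "\<bar>b u - a u\<bar> = 1" "\<And>i. i \<noteq> u \<Longrightarrow> b i = a i"
    by (auto simp: odd_step_def)
  show "odd_step D (\<lambda>i. 2 * b i - a i) b"
    unfolding odd_step_def using u by (intro bexI[of _ u]) auto
  have "2 * b u - a u \<noteq> a u" using u by auto
  then show "(\<lambda>i. 2 * b i - a i) \<noteq> a" by metis
qed simp

lemma odd_step_reflect_last:
  assumes "odd_step D a b"
  shows "odd_step D a (\<lambda>i. 2 * a i - b i)" "(\<lambda>i. 2 * a i - b i) \<noteq> b"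
proof -
  from assms(1) obtain u where u: "u \<in> D" "even (a u)" "\<bar>b u - a u\<bar> = 1" "\<And>i. i \<noteq> u \<Longrightarrow> b i = a i"
    by (auto simp: odd_step_def)
  show "odd_step D a (\<lambda>i. 2 * a i - b i)"
    unfolding odd_step_def using u by (intro bexI[of _ u]) auto
  have "2 * a u - b u \<noteq> b u" using u by auto
  then show "(\<lambda>i. 2 * a i - b i) \<noteq> b" by metis
qed

lemma grid_box_reflect:
  assumes "a \<in> grid_box K D x" "\<And>i. i \<noteq> u \<Longrightarrow> b i = (a i :: int)" "u \<in> D" "0 \<le> z u" "z u \<le> K" "\<And>i. i \<noteq> u \<Longrightarrow> z i = b i"
  shows "z \<in> grid_box K D x"
proof (rule grid_boxI)
  fix i assume "i \<in> D"
  then show "0 \<le> z i \<and> z i \<le> K" using assms(2-6) grid_boxD(1,2)[OF assms(1)] by (cases "i = u") auto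
next
  fix i assume "i \<notin> D"
  then show "z i = x i" using assms(2,3,6) grid_boxD(3)[OF assms(1)] by (cases "i = u") auto
qed

text \<open>An odd value between 0 and an even \<open>K\<close> is not an end of the range, so both
  of its neighbours are in the range: the facet opposite the even corner is never on the
  boundary.\<close>

lemma grid_box_reflect_first:
  assumes "odd_step D a b" "a \<in> grid_box K D x" "b \<in> grid_box K D x" "even K"
  shows "(\<lambda>i. 2 * b i - a i) \<in> grid_box K D x"
proof -
  from assms(1) obtain u where u: "u \<in> D" "even (a u)" "\<bar>b u - a u\<bar> = 1" "\<And>i. i \<noteq> u \<Longrightarrow> b i = a i"
    by (auto simp: odd_step_def)
  have "b u = a u + 1 \<or> b u = a u - 1" using u(3) by linarith
  then have "odd (b u)" using u(2) by auto
  have "0 \<le> a u" "a u \<le> K" "0 \<le> b u" "b u \<le> K"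
    using u grid_boxD[OF assms(2), of u] grid_boxD[OF assms(3), of u] by auto
  moreover have "b u \<noteq> 0" "b u \<noteq> K" using \<open>odd (b u)\<close> assms(4) by auto
  ultimately have "0 \<le> 2 * b u - a u" "2 * b u - a u \<le> K"
    using u(3) by linarith+
  then show ?thesis
    using u by (intro grid_box_reflect[OF assms(2) u(4) u(1)]) auto
qed

text \<open>Here the reflection is at an even value, which may be 0 or \<open>K\<close>, where one
  neighbour is missing. These are the facets on the boundary of the cube, excluded by the last
  hypothesis.\<close>

lemma grid_box_reflect_last:
  assumes "odd_step D a b" "a \<in> grid_box K D x"
    and "\<And>c. c \<in> D \<Longrightarrow> a c \<noteq> b c \<Longrightarrow> a c \<noteq> 0 \<and> a c \<noteq> K"
  shows "(\<lambda>i. 2 * a i - b i) \<in> grid_box K D x"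
proof -
  from assms(1) obtain u where u: "u \<in> D" "even (a u)" "\<bar>b u - a u\<bar> = 1" "\<And>i. i \<noteq> u \<Longrightarrow> b i = a i"
    by (auto simp: odd_step_def)
  have "a u \<noteq> b u" using u(3) by auto
  then have "a u \<noteq> 0" "a u \<noteq> K" "0 \<le> a u" "a u \<le> K"
    using grid_boxD[OF assms(2), of u] assms(3)[of u] u(1) by auto
  then have "0 \<le> 2 * a u - b u" "2 * a u - b u \<le> K"
    using u(3) by linarith+
  then show ?thesis
    using u by (intro grid_box_reflect[OF assms(2) u(4) u(1)]) auto
qed

lemma simplicesD:
  assumes "ys \<in> simplices K D x"
  shows "length ys = Suc (card D)" "t \<le> card D \<Longrightarrow> ys ! t \<in> grid_box K D x"
    "c \<in> D \<Longrightarrow> even ((ys ! 0) c)" "t < card D \<Longrightarrow> odd_step D (ys ! t) (ys ! Suc t)"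
  using assms by (auto simp: simplices_def subset_iff)

lemma simplicesI:
  assumes "length ys = Suc (card D)" "\<And>t. t \<le> card D \<Longrightarrow> ys ! t \<in> grid_box K D x"
    "\<And>c. c \<in> D \<Longrightarrow> even ((ys ! 0) c)" "\<And>t. t < card D \<Longrightarrow> odd_step D (ys ! t) (ys ! Suc t)"
  shows "ys \<in> simplices K D x"
  using assms by (auto simp: simplices_def in_set_conv_nth less_Suc_eq_le)

lemma simplices_update:
  assumes ys: "ys \<in> simplices K D x" and t: "t \<le> card D"
    and z: "z \<in> grid_box K D x" "t = 0 \<Longrightarrow> \<forall>c\<in>D. even (z c)"
      "t < card D \<Longrightarrow> odd_step D z (ys ! Suc t)" "t > 0 \<Longrightarrow> odd_step D (ys ! (t - 1)) z"
  shows "ys[t := z] \<in> simplices K D x"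
proof (rule simplicesI)
  show "length (ys[t := z]) = Suc (card D)" using simplicesD(1)[OF ys] by simp
next
  fix s assume "s \<le> card D"
  then show "ys[t := z] ! s \<in> grid_box K D x"
    using simplicesD(1,2)[OF ys] z(1) by (cases "s = t") auto
next
  fix c assume "c \<in> D"
  then show "even ((ys[t := z] ! 0) c)"
    using simplicesD(1,3)[OF ys] z(2) by (cases "t = 0") auto
next
  fix s assume "s < card D"
  then show "odd_step D (ys[t := z] ! s) (ys[t := z] ! Suc s)"
    using simplicesD(1,4)[OF ys] z(3,4) t by (cases "s = t"; cases "Suc s = t") auto
qed

section \<open>Facets and the boundary formula modulo 2\<close>

definition facet_label :: "((nat \<Rightarrow> int) \<Rightarrow> nat) \<Rightarrow> bool \<Rightarrow> nat \<Rightarrow> (nat \<Rightarrow> int) list \<Rightarrow> nat" where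
  "facet_label lab s t ys = of_bool (alternating_mset s (mset (map lab ys) - {#lab (ys ! t)#}))"

text \<open>Two simplices that share the facet opposite vertex \<open>t\<close> contribute equally,
  which is what makes them cancel modulo 2.\<close>

lemma facet_label_update:
  assumes "t < length ys"
  shows "facet_label lab s t (ys[t := z]) = facet_label lab s t ys"
proof -
  have "mset (map lab (ys[t := z])) = add_mset (lab z) (mset (map lab ys) - {#lab (ys ! t)#})"
    using assms by (simp add: map_update mset_update)
  then show ?thesis using assms by (simp add: facet_label_def)
qed

lemma sum_facet_label:
  assumes "length ys = Suc r"
  shows "even ((\<Sum>t\<le>r. facet_label lab s t ys) + of_bool (alternating_mset s (mset (map lab ys)))
      + of_bool (alternating_mset (\<not> s) (mset (map lab ys))))"
proof -
  have "(\<Sum>x\<in>#mset (map lab ys). of_bool (alternating_mset s (mset (map lab ys) - {#x#})) :: nat)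
      = (\<Sum>t\<le>r. facet_label lab s t ys)"
    unfolding mset_map[symmetric] sum_mset_sum_list
    by (simp add: sum_list_sum_nth assms facet_label_def atLeast0LessThan lessThan_Suc_atMost del: mset_map)
  then show ?thesis using alternating_mset_removals[of s "mset (map lab ys)"] by simp
qed

lemma even_sum_facet_first:
  assumes "finite D" "D \<noteq> {}" "even K"
  shows "even (\<Sum>ys\<in>simplices K D x. facet_label lab s 0 ys)"
proof (rule even_sum_involution[OF finite_simplices[OF assms(1)],
      where f = "\<lambda>ys. ys[0 := \<lambda>i. 2 * (ys ! 1) i - (ys ! 0) i]"])
  fix ys assume ys: "ys \<in> simplices K D x"
  let ?z = "\<lambda>i. 2 * (ys ! 1) i - (ys ! 0) i"
  have r: "card D > 0" using assms by (simp add: card_gt_0_iff)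
  have st: "odd_step D (ys ! 0) (ys ! 1)" using simplicesD(4)[OF ys r] by simp
  have len: "length ys = Suc (card D)" using simplicesD(1)[OF ys] .
  have "ys[0 := ?z] \<in> simplices K D x"
  proof (rule simplices_update[OF ys])
    show "?z \<in> grid_box K D x"
      using r by (intro grid_box_reflect_first[OF st] simplicesD(2)[OF ys] assms(3)) auto
    show "\<forall>c\<in>D. even (?z c)" using odd_step_reflect_first(3)[OF st] simplicesD(3)[OF ys] by simp
    show "odd_step D ?z (ys ! Suc 0)" using odd_step_reflect_first(1)[OF st] by simp
  qed auto
  moreover have "ys[0 := ?z] \<noteq> ys" using odd_step_reflect_first(2)[OF st] len
    by (metis nth_list_update_eq zero_less_Suc)
  moreover have "(ys[0 := ?z])[0 := \<lambda>i. 2 * (ys[0 := ?z] ! 1) i - (ys[0 := ?z] ! 0) i] = ys"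
    using len by (simp add: list_update_id)
  ultimately show "ys[0 := ?z] \<in> simplices K D x \<and>
         (ys[0 := ?z])[0 := \<lambda>i. 2 * (ys[0 := ?z] ! 1) i - (ys[0 := ?z] ! 0) i] = ys \<and>
         ys[0 := ?z] \<noteq> ys \<and> facet_label lab s 0 (ys[0 := ?z]) = facet_label lab s 0 ys"
    using facet_label_update[of 0 ys] len by simp
qed

text \<open>The partner of a simplex makes the steps into and out of vertex \<open>t\<close> in the
  opposite order. It stays in the box because each coordinate of the new vertex occurs in one of the
  two neighbouring vertices.\<close>

lemma even_sum_facet_middle:
  assumes "finite D" "0 < t" "t < card D"
  shows "even (\<Sum>ys\<in>simplices K D x. facet_label lab s t ys)"
proof (rule even_sum_involution[OF finite_simplices[OF assms(1)],
      where f = "\<lambda>ys. ys[t := \<lambda>i. (ys ! (t - 1)) i + (ys ! Suc t) i - (ys ! t) i]"])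
  fix ys assume ys: "ys \<in> simplices K D x"
  let ?z = "\<lambda>i. (ys ! (t - 1)) i + (ys ! Suc t) i - (ys ! t) i"
  have st: "odd_step D (ys ! (t - 1)) (ys ! t)" "odd_step D (ys ! t) (ys ! Suc t)"
    using simplicesD(4)[OF ys, of "t - 1"] simplicesD(4)[OF ys, of t] assms by auto
  have len: "length ys = Suc (card D)" using simplicesD(1)[OF ys] .
  have "ys[t := ?z] \<in> simplices K D x"
  proof (rule simplices_update[OF ys])
    have "ys ! (t - 1) \<in> grid_box K D x" "ys ! Suc t \<in> grid_box K D x"
      using assms by (auto intro!: simplicesD(2)[OF ys])
    note a = this(1) and b = this(2)
    show "?z \<in> grid_box K D x"
    proof (rule grid_boxI)
      show "0 \<le> ?z i \<and> ?z i \<le> K" if "i \<in> D" for i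
        using odd_step_middle(4)[OF st, of i] grid_boxD(1,2)[OF a that] grid_boxD(1,2)[OF b that] by linarith
      show "?z i = x i" if "i \<notin> D" for i
        using odd_step_middle(4)[OF st, of i] grid_boxD(3)[OF a that] grid_boxD(3)[OF b that] by linarith
    qed
    show "odd_step D ?z (ys ! Suc t)" "odd_step D (ys ! (t - 1)) ?z" using odd_step_middle(2,1)[OF st] .
  qed (use assms in auto)
  moreover have "ys[t := ?z] \<noteq> ys" using odd_step_middle(3)[OF st] len assms
    by (metis nth_list_update_eq less_SucI)
  moreover have "(ys[t := ?z])[t := \<lambda>i. (ys[t := ?z] ! (t - 1)) i + (ys[t := ?z] ! Suc t) i - (ys[t := ?z] ! t) i] = ys"
    using len assms by (simp add: list_update_id)
  ultimately show "ys[t := ?z] \<in> simplices K D x \<and>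
     (ys[t := ?z])[t := \<lambda>i. (ys[t := ?z] ! (t - 1)) i + (ys[t := ?z] ! Suc t) i - (ys[t := ?z] ! t) i] = ys \<and>
     ys[t := ?z] \<noteq> ys \<and> facet_label lab s t (ys[t := ?z]) = facet_label lab s t ys"
    using facet_label_update[of t ys] len assms by simp
qed

text \<open>A coordinate moves only from an even to an odd value, and an odd value is final; hence
  each coordinate moves at most once.\<close>

lemma simplices_coordinate:
  assumes ys: "ys \<in> simplices K D x" and "s \<le> t" "t \<le> card D"
  shows "(ys ! t) i = (ys ! s) i \<or> even ((ys ! s) i) \<and> odd ((ys ! t) i) \<and> \<bar>(ys ! t) i - (ys ! s) i\<bar> = 1"
  using assms(2,3)
proof (induction t rule: dec_induct)
  case (step t)
  from simplicesD(4)[OF ys, of t] step obtain u where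
    u: "u \<in> D" "even ((ys ! t) u)" "\<bar>(ys ! Suc t) u - (ys ! t) u\<bar> = 1" "\<And>i. i \<noteq> u \<Longrightarrow> (ys ! Suc t) i = (ys ! t) i"
    by (auto simp: odd_step_def)
  have "(ys ! Suc t) u = (ys ! t) u + 1 \<or> (ys ! Suc t) u = (ys ! t) u - 1" using u(3) by linarith
  then have "odd ((ys ! Suc t) u)" using u(2) by auto
  then show ?case using step u by (cases "i = u") auto
qed simp

lemma simplices_close:
  assumes "ys \<in> simplices K D x" "a \<in> set ys" "b \<in> set ys"
  shows "\<bar>a i - b i\<bar> \<le> 1"
proof -
  obtain s t where st: "a = ys ! s" "b = ys ! t" "s \<le> card D" "t \<le> card D"
    using assms simplicesD(1)[OF assms(1)] by (metis in_set_conv_nth less_Suc_eq_le)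
  then show ?thesis
    using simplices_coordinate[OF assms(1) _ st(4), of s i] simplices_coordinate[OF assms(1) _ st(3), of t i]
    by (cases "s \<le> t") (auto simp: abs_minus_commute)
qed

text \<open>By parity, a coordinate that is still even at vertex \<open>r\<close> has not moved
  before. So if the last step moves \<open>c\<close>, all earlier vertices lie in the face where
  \<open>c\<close> is frozen, and they form a maximal simplex of it.\<close>

lemma simplices_butlast:
  assumes ys: "ys \<in> simplices K D x" and D: "finite D" "card D = Suc r"
    and c: "c \<in> D" "even ((ys ! r) c)" "ys ! Suc r = (ys ! r)(c := v)"
  shows "butlast ys \<in> simplices K (D - {c}) (x(c := (ys ! r) c))"
proof -
  have len: "length ys = Suc (Suc r)" using simplicesD(1)[OF ys] D by simp
  have cd: "card (D - {c}) = r" using D c by simp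
  have const: "(ys ! t) c = (ys ! r) c" if "t \<le> r" for t
    using simplices_coordinate[OF ys that, of c] D c(2) by auto
  show ?thesis
  proof (rule simplicesI; (unfold cd)?)
    show "length (butlast ys) = Suc r" using len by simp
  next
    fix t assume t: "t \<le> r"
    then have "ys ! t \<in> grid_box K D x" using simplicesD(2)[OF ys] D by simp
    then have "ys ! t \<in> grid_box K (D - {c}) (x(c := (ys ! r) c))"
      using const[OF t] grid_boxD[of "ys ! t" K D x] by (intro grid_boxI) auto
    then show "butlast ys ! t \<in> grid_box K (D - {c}) (x(c := (ys ! r) c))"
      using t len by (simp add: nth_butlast)
  next
    fix i assume "i \<in> D - {c}"
    then show "even ((butlast ys ! 0) i)" using simplicesD(3)[OF ys] len by (simp add: nth_butlast)
  next
    fix t assume t: "t < r"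
    then obtain u where u: "u \<in> D" "even ((ys ! t) u)" "\<bar>(ys ! Suc t) u - (ys ! t) u\<bar> = 1"
      "\<And>i. i \<noteq> u \<Longrightarrow> (ys ! Suc t) i = (ys ! t) i"
      using simplicesD(4)[OF ys, of t] D by (auto simp: odd_step_def)
    moreover have "u \<noteq> c" using u(3) const[of t] const[of "Suc t"] t by auto
    ultimately show "odd_step (D - {c}) (butlast ys ! t) (butlast ys ! Suc t)"
      using t len by (auto simp: nth_butlast odd_step_def)
  qed
qed

lemma simplices_append:
  assumes zs: "zs \<in> simplices K (D - {c}) (x(c := e))" and D: "finite D" "c \<in> D"
    and e: "even e" "0 \<le> e" "e \<le> K" and e': "\<bar>e' - e\<bar> = 1" "0 \<le> e'" "e' \<le> K"
  shows "zs @ [(last zs)(c := e')] \<in> simplices K D x"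
proof -
  define r where "r = card (D - {c})"
  have cd: "card D = Suc r" using D by (simp only: r_def card_Suc_Diff1)
  have len: "length zs = Suc r" using simplicesD(1)[OF zs] by (simp add: r_def)
  have last: "last zs = zs ! r" using len by (subst last_conv_nth) auto
  have zbox: "zs ! t \<in> grid_box K (D - {c}) (x(c := e))" if "t \<le> r" for t
    using simplicesD(2)[OF zs] that by (simp add: r_def)
  then have zc: "(zs ! t) c = e" if "t \<le> r" for t using grid_boxD(3)[OF zbox[OF that], of c] by simp
  have zbox': "zs ! t \<in> grid_box K D x" if "t \<le> r" for t
  proof (rule grid_boxI)
    show "0 \<le> (zs ! t) i \<and> (zs ! t) i \<le> K" if "i \<in> D" for i
      using grid_boxD(1,2)[OF zbox[OF \<open>t \<le> r\<close>], of i] zc[OF \<open>t \<le> r\<close>] e that by (cases "i = c") auto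
    show "(zs ! t) i = x i" if "i \<notin> D" for i
      using grid_boxD(3)[OF zbox[OF \<open>t \<le> r\<close>], of i] D(2) that by (cases "i = c") auto
  qed
  show ?thesis
  proof (rule simplicesI; (unfold cd)?)
    show "length (zs @ [(last zs)(c := e')]) = Suc (Suc r)" using len by simp
  next
    fix t assume t: "t \<le> Suc r"
    show "(zs @ [(last zs)(c := e')]) ! t \<in> grid_box K D x"
    proof (cases "t \<le> r")
      case False
      then have "t = Suc r" using t by simp
      moreover have "(zs ! r)(c := e') \<in> grid_box K D x"
        using grid_boxD[OF zbox'[OF order_refl]] e' D by (intro grid_boxI) auto
      ultimately show ?thesis using len last by (simp add: nth_append)
    qed (use zbox' len in \<open>simp add: nth_append\<close>)
  next
    fix i assume "i \<in> D"
    then show "even (((zs @ [(last zs)(c := e')]) ! 0) i)"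
      using simplicesD(3)[OF zs, of i] zc[of 0] e len by (cases "i = c") (auto simp: nth_append)
  next
    fix t assume t: "t < Suc r"
    show "odd_step D ((zs @ [(last zs)(c := e')]) ! t) ((zs @ [(last zs)(c := e')]) ! Suc t)"
    proof (cases "t < r")
      case True
      then show ?thesis using simplicesD(4)[OF zs, of t] len
        by (auto simp: nth_append r_def[symmetric] odd_step_def)
    next
      case False
      then have "t = r" using t by simp
      then show ?thesis using len last zc[of r] e e' D
        by (auto simp: nth_append odd_step_def intro!: bexI[of _ c])
    qed
  qed
qed

definition alternating_count :: "int \<Rightarrow> ((nat \<Rightarrow> int) \<Rightarrow> nat) \<Rightarrow> bool \<Rightarrow> nat set \<Rightarrow> (nat \<Rightarrow> int) \<Rightarrow> nat" where
  "alternating_count K lab s D x = (\<Sum>ys\<in>simplices K D x. of_bool (alternating_mset s (mset (map lab ys))))"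

text \<open>Simplices whose last step does not leave a boundary face are paired by reflecting the
  last vertex. The others, collected in \<open>R\<close>, correspond to the simplices of the
  boundary faces: deleting the last vertex is inverted by one step inward.\<close>

lemma sum_facet_last:
  assumes D: "finite D" "D \<noteq> {}" and K: "even K" "K > 0"
  shows "even ((\<Sum>ys\<in>simplices K D x. facet_label lab s (card D) ys) +
     (\<Sum>c\<in>D. \<Sum>e\<in>{0, K}. alternating_count K lab s (D - {c}) (x(c := e))))"
proof -
  obtain r where r: "card D = Suc r" using D by (metis card_eq_0_iff not0_implies_Suc)
  \<comment> \<open>So the inward neighbours 1 and \<open>K - 1\<close> of the two ends are not ends
    themselves.\<close>
  have K2: "K \<ge> 2" using K by presburger
  define R where "R = {ys \<in> simplices K D x. \<exists>c\<in>D. (ys ! Suc r) c \<noteq> (ys ! r) c \<and> (ys ! r) c \<in> {0, K}}"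
  let ?f = "\<lambda>((c, e), zs :: (nat \<Rightarrow> int) list). zs @ [(last zs)(c := if e = 0 then 1 else K - 1)]"
  let ?I = "Sigma (D \<times> {0, K}) (\<lambda>(c, e). simplices K (D - {c}) (x(c := e)))"
  have len: "length ys = Suc (Suc r)" if "ys \<in> simplices K D x" for ys
    using simplicesD(1)[OF that] r by simp
  have step: "odd_step D (ys ! r) (ys ! Suc r)" if "ys \<in> simplices K D x" for ys
    using simplicesD(4)[OF that, of r] r by simp
  have "even (sum (facet_label lab s (card D)) (simplices K D x - R))"
  proof (rule even_sum_involution[where f = "\<lambda>ys. ys[Suc r := \<lambda>i. 2 * (ys ! r) i - (ys ! Suc r) i]"])
    fix ys assume ysR: "ys \<in> simplices K D x - R"
    then have ys: "ys \<in> simplices K D x" by simp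
    let ?z = "\<lambda>i. 2 * (ys ! r) i - (ys ! Suc r) i"
    let ?ys = "ys[Suc r := ?z]"
    have S: "?ys \<in> simplices K D x"
    proof (rule simplices_update[OF ys])
      show "?z \<in> grid_box K D x"
        using ysR simplicesD(2)[OF ys, of r] r by (intro grid_box_reflect_last[OF step[OF ys]]) (auto simp: R_def)
      show "odd_step D (ys ! (Suc r - 1)) ?z" using odd_step_reflect_last(1)[OF step[OF ys]] by simp
    qed (use r in auto)
    moreover have "?ys \<notin> R"
      using ysR len[OF ys] by (auto simp: R_def)
    moreover have "?ys \<noteq> ys" using odd_step_reflect_last(2)[OF step[OF ys]] len[OF ys]
      by (metis lessI nth_list_update_eq)
    moreover have "?ys[Suc r := \<lambda>i. 2 * (?ys ! r) i - (?ys ! Suc r) i] = ys"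
      using len[OF ys] by (simp add: list_update_id)
    ultimately show "?ys \<in> simplices K D x - R \<and> ?ys[Suc r := \<lambda>i. 2 * (?ys ! r) i - (?ys ! Suc r) i] = ys \<and>
        ?ys \<noteq> ys \<and> facet_label lab s (card D) ?ys = facet_label lab s (card D) ys"
      using facet_label_update[of "Suc r" ys] len[OF ys] r by simp
  qed (use finite_simplices D in auto)
  moreover have "sum (facet_label lab s (card D)) R
     = (\<Sum>c\<in>D. \<Sum>e\<in>{0, K}. alternating_count K lab s (D - {c}) (x(c := e)))"
  proof -
    have lastc: "last zs c = e" "zs \<noteq> []" "length zs = Suc r"
      if "c \<in> D" "zs \<in> simplices K (D - {c}) (x(c := e))" for c e zs
    proof -
      show l: "length zs = Suc r" using simplicesD(1)[OF that(2)] r D that(1) by simp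
      then show "zs \<noteq> []" by auto
      then have "last zs \<in> grid_box K (D - {c}) (x(c := e))"
        using that(2) last_in_set by (auto simp: simplices_def)
      from grid_boxD(3)[OF this, of c] show "last zs c = e" by simp
    qed
    have inj: "inj_on ?f ?I"
    proof (rule inj_onI)
      fix p p' assume p: "p \<in> ?I" "p' \<in> ?I" "?f p = ?f p'"
      obtain c e zs c' e' zs' where pp: "p = ((c, e), zs)" "p' = ((c', e'), zs')"
        by (metis surj_pair)
      from p have a: "c \<in> D" "c' \<in> D" "e \<in> {0, K}" "e' \<in> {0, K}" "zs \<in> simplices K (D - {c}) (x(c := e))"
         "zs' \<in> simplices K (D - {c'}) (x(c' := e'))"
         "zs @ [(last zs)(c := if e = 0 then 1 else K - 1)] = zs' @ [(last zs')(c' := if e' = 0 then 1 else K - 1)]"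
        unfolding pp by (auto simp del: insert_iff split del: if_split)
      then have eq: "zs = zs'" "(last zs)(c := if e = 0 then 1 else K - 1) = (last zs')(c' := if e' = 0 then 1 else K - 1)"
        by auto
      have "c = c'"
      proof (rule ccontr)
        assume "c \<noteq> c'"
        then have "(if e = 0 then 1 else K - 1) = last zs c"
          using fun_cong[OF eq(2), of c] eq(1) by simp
        then show False using lastc(1)[OF a(1,5)] a(3) K2 by (auto split: if_splits)
      qed
      then show "p = p'" using pp eq(1) lastc(1)[OF a(1,5)] lastc(1)[OF a(2,6)] by simp
    qed
    have img: "?f ` ?I = R"
    proof (intro equalityI subsetI)
      fix ys assume "ys \<in> ?f ` ?I"
      then obtain c e zs where z: "c \<in> D" "e \<in> {0, K}" "zs \<in> simplices K (D - {c}) (x(c := e))"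
        "ys = zs @ [(last zs)(c := if e = 0 then 1 else K - 1)]" by auto
      note l = lastc[OF z(1,3)]
      have "ys \<in> simplices K D x"
        unfolding z(4) using z(1,2) K K2 by (intro simplices_append[OF z(3) D(1)]) auto
      moreover have "ys ! r = last zs" "ys ! Suc r = (last zs)(c := if e = 0 then 1 else K - 1)"
        using l by (auto simp: z(4) nth_append last_conv_nth)
      ultimately show "ys \<in> R" using z(1,2) l(1) K2 by (auto simp: R_def intro!: bexI[of _ c])
    next
      fix ys assume "ys \<in> R"
      then obtain c where ys: "ys \<in> simplices K D x" and c: "c \<in> D" "(ys ! Suc r) c \<noteq> (ys ! r) c" "(ys ! r) c \<in> {0, K}"
        by (auto simp: R_def)
      from step[OF ys] c(2) have c': "even ((ys ! r) c)" "\<bar>(ys ! Suc r) c - (ys ! r) c\<bar> = 1"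
        "\<And>i. i \<noteq> c \<Longrightarrow> (ys ! Suc r) i = (ys ! r) i"
        by (auto simp: odd_step_def) metis+
      have "0 \<le> (ys ! Suc r) c \<and> (ys ! Suc r) c \<le> K"
        using simplicesD(2)[OF ys, of "Suc r"] grid_boxD c(1) r by auto
      then have v: "(ys ! Suc r) c = (if (ys ! r) c = 0 then 1 else K - 1)"
        using c(3) c'(2) by auto
      have upd: "ys ! Suc r = (ys ! r)(c := if (ys ! r) c = 0 then 1 else K - 1)"
        using c'(3) v by auto
      have "butlast ys \<in> simplices K (D - {c}) (x(c := (ys ! r) c))"
        by (rule simplices_butlast[OF ys D(1) r c(1) c'(1) upd])
      moreover have "last (butlast ys) = ys ! r"
      proof -
        have "length (butlast ys) = Suc r" using len[OF ys] by simp
        moreover from this have "butlast ys \<noteq> []" by (metis Zero_not_Suc list.size(3))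
        ultimately show ?thesis by (simp add: last_conv_nth nth_butlast)
      qed
      moreover have "ys = butlast ys @ [ys ! Suc r]" using len[OF ys]
        by (metis append_butlast_last_id diff_Suc_1 last_conv_nth list.size(3) nat.distinct(1))
      ultimately show "ys \<in> ?f ` ?I"
        using c upd by (intro image_eqI[of _ _ "((c, (ys ! r) c), butlast ys)"]) auto
    qed
    have "sum (facet_label lab s (card D)) R = (\<Sum>p\<in>?I. facet_label lab s (card D) (?f p))"
      unfolding img[symmetric] by (rule sum.reindex[OF inj, unfolded o_def])
    also have "\<dots> = (\<Sum>(p, zs)\<in>?I. of_bool (alternating_mset s (mset (map lab zs))))"
      by (rule sum.cong) (auto simp: facet_label_def r nth_append lastc)
    also have "\<dots> = (\<Sum>p\<in>D \<times> {0, K}. \<Sum>zs\<in>(case p of (c, e) \<Rightarrow> simplices K (D - {c}) (x(c := e))).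
        of_bool (alternating_mset s (mset (map lab zs))))"
      using D finite_simplices by (intro sum.Sigma[symmetric]) auto
    also have "\<dots> = (\<Sum>(c, e)\<in>D \<times> {0, K}. alternating_count K lab s (D - {c}) (x(c := e)))"
      by (rule sum.cong) (auto simp: alternating_count_def)
    also have "\<dots> = (\<Sum>c\<in>D. \<Sum>e\<in>{0, K}. alternating_count K lab s (D - {c}) (x(c := e)))"
      by (rule sum.cartesian_product[symmetric])
    finally show ?thesis .
  qed
  moreover have "(\<Sum>ys\<in>simplices K D x. facet_label lab s (card D) ys)
     = sum (facet_label lab s (card D)) (simplices K D x - R) + sum (facet_label lab s (card D)) R"
    by (rule sum.subset_diff) (auto simp: R_def finite_simplices D)
  ultimately show ?thesis by simp
qed

text \<open>Count the pairs of a simplex and a facet alternating from \<open>s\<close> in two ways.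
  Within one simplex their number has the parity given by \<open>sum_facet_label\<close>; over all
  simplices the interior facets occur twice, and what remains are the facets in the
  boundary.\<close>

lemma alternating_count_boundary:
  assumes D: "finite D" "D \<noteq> {}" and K: "even K" "K > 0"
  shows "even (alternating_count K lab s D x + alternating_count K lab (\<not> s) D x +
     (\<Sum>c\<in>D. \<Sum>e\<in>{0, K}. alternating_count K lab s (D - {c}) (x(c := e))))"
proof -
  obtain r where r: "card D = Suc r" using D by (metis card_eq_0_iff not0_implies_Suc)
  let ?S = "simplices K D x"
  have "even (\<Sum>ys\<in>?S. (\<Sum>t\<le>card D. facet_label lab s t ys) + of_bool (alternating_mset s (mset (map lab ys)))
      + of_bool (alternating_mset (\<not> s) (mset (map lab ys))))"
    by (intro dvd_sum sum_facet_label simplicesD(1))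
  also have "(\<Sum>ys\<in>?S. (\<Sum>t\<le>card D. facet_label lab s t ys) + of_bool (alternating_mset s (mset (map lab ys)))
      + of_bool (alternating_mset (\<not> s) (mset (map lab ys))))
    = (\<Sum>t\<le>card D. \<Sum>ys\<in>?S. facet_label lab s t ys) + alternating_count K lab s D x + alternating_count K lab (\<not> s) D x"
    by (simp add: sum.distrib alternating_count_def sum.swap[of _ "{..card D}"])
  also have "(\<Sum>t\<le>card D. \<Sum>ys\<in>?S. facet_label lab s t ys)
    = (\<Sum>t<card D. \<Sum>ys\<in>?S. facet_label lab s t ys) + (\<Sum>ys\<in>?S. facet_label lab s (card D) ys)"
    by (simp add: lessThan_Suc_atMost[symmetric])
  finally have total: "even ((\<Sum>t<card D. \<Sum>ys\<in>?S. facet_label lab s t ys) + (\<Sum>ys\<in>?S. facet_label lab s (card D) ys)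
    + alternating_count K lab s D x + alternating_count K lab (\<not> s) D x)" .
  have inner: "even (\<Sum>t<card D. \<Sum>ys\<in>?S. facet_label lab s t ys)"
  proof (rule dvd_sum)
    fix t assume "t \<in> {..<card D}"
    then show "even (\<Sum>ys\<in>?S. facet_label lab s t ys)"
      using even_sum_facet_first[OF D K(1)] even_sum_facet_middle[OF D(1)] by (cases "t = 0") auto
  qed
  have "even (Z + V + W)" if "even (X + Y + Z + V)" "even X" "even (Y + W)" for X Y Z V W :: nat
    using that by presburger
  from this[OF total inner sum_facet_last[OF D K, of lab s x]] show ?thesis .
qed

lemma alternating_count_cong:
  assumes "\<And>y. y \<in> grid_box K D x \<Longrightarrow> lab y = lab' y"
  shows "alternating_count K lab s D x = alternating_count K lab' s D x"
  unfolding alternating_count_def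
proof (rule sum.cong[OF refl])
  fix ys assume "ys \<in> simplices K D x"
  then have "map lab ys = map lab' ys" using assms by (auto simp: simplices_def)
  then show "(of_bool (alternating_mset s (mset (map lab ys))) :: nat) = of_bool (alternating_mset s (mset (map lab' ys)))"
    by (simp only:)
qed

section \<open>Reflections, opposite labels and degenerate faces\<close>

definition grid_reflect :: "int \<Rightarrow> nat set \<Rightarrow> (nat \<Rightarrow> int) \<Rightarrow> nat \<Rightarrow> int" where
  "grid_reflect K R y = (\<lambda>i. if i \<in> R then K - y i else y i)"

lemma grid_reflect_reflect [simp]: "grid_reflect K R (grid_reflect K R y) = y"
  by (auto simp: grid_reflect_def)

lemma grid_reflect_box: "y \<in> grid_box K D x \<Longrightarrow> grid_reflect K R y \<in> grid_box K D (grid_reflect K R x)"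
  using grid_boxD[of y K D x] by (intro grid_boxI) (auto simp: grid_reflect_def)

lemma simplices_reflect:
  assumes "ys \<in> simplices K D x" "even K"
  shows "map (grid_reflect K R) ys \<in> simplices K D (grid_reflect K R x)"
proof (rule simplicesI)
  have len: "length ys = Suc (card D)" using simplicesD(1)[OF assms(1)] .
  then show "length (map (grid_reflect K R) ys) = Suc (card D)" by simp
  show "map (grid_reflect K R) ys ! t \<in> grid_box K D (grid_reflect K R x)" if "t \<le> card D" for t
    using that len simplicesD(2)[OF assms(1)] by (simp add: grid_reflect_box)
  show "even ((map (grid_reflect K R) ys ! 0) c)" if "c \<in> D" for c
    using that len simplicesD(3)[OF assms(1)] assms(2) by (simp add: grid_reflect_def)
  show "odd_step D (map (grid_reflect K R) ys ! t) (map (grid_reflect K R) ys ! Suc t)" if t: "t < card D" for t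
  proof -
    from simplicesD(4)[OF assms(1) t] obtain u where u: "u \<in> D" "even ((ys ! t) u)"
      "\<bar>(ys ! Suc t) u - (ys ! t) u\<bar> = 1" "\<And>i. i \<noteq> u \<Longrightarrow> (ys ! Suc t) i = (ys ! t) i"
      by (auto simp: odd_step_def)
    then show ?thesis using t len assms(2)
      by (auto simp: odd_step_def grid_reflect_def intro!: bexI[of _ u])
  qed
qed

lemma alternating_count_reflect:
  assumes "even K"
  shows "alternating_count K lab s D (grid_reflect K R x) = alternating_count K (\<lambda>y. lab (grid_reflect K R y)) s D x"
  unfolding alternating_count_def
proof (rule sum.reindex_bij_witness[where i = "map (grid_reflect K R)" and j = "map (grid_reflect K R)"])
  fix ys assume "ys \<in> simplices K D (grid_reflect K R x)"
  then show "map (grid_reflect K R) ys \<in> simplices K D x"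
    using simplices_reflect[OF _ assms, of ys D "grid_reflect K R x" R] by simp
next
  fix ys assume "ys \<in> simplices K D x"
  then show "map (grid_reflect K R) ys \<in> simplices K D (grid_reflect K R x)"
    by (rule simplices_reflect[OF _ assms])
qed (simp_all add: o_def multiset.map_comp)

text \<open>Exchanges the labels of the two signs at the same index.\<close>

definition opposite :: "nat \<Rightarrow> nat" where
  "opposite a = (if even a then a + 1 else a - 1)"

lemma even_opposite [simp]: "even (opposite a) \<longleftrightarrow> odd a"
  by (auto simp: opposite_def)

lemma alternating_opposite:
  "alternating s (map even (map opposite xs)) = alternating (\<not> s) (map even xs)"
  by (induction xs arbitrary: s) auto

text \<open>\<open>opposite\<close> moves a label by one within its pair \<open>2 * i\<close>,
  \<open>2 * i + 1\<close>, so it can reverse the order of two labels only if they form such a pair.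
  Without such pairs it commutes with sorting, and all signs are exchanged.\<close>

lemma alternating_mset_opposite:
  assumes "\<And>a b. a \<in># M \<Longrightarrow> b \<in># M \<Longrightarrow> a \<noteq> opposite b"
  shows "alternating_mset s (image_mset opposite M) = alternating_mset (\<not> s) M"
proof -
  let ?xs = "sorted_list_of_multiset M"
  have "sorted (map opposite ?xs)"
    unfolding sorted_map
  proof (rule sorted_wrt_mono_rel[of _ "(\<le>)"])
    fix a b assume ab: "a \<in> set ?xs" "b \<in> set ?xs" "a \<le> b"
    then have "b \<noteq> opposite a" using assms by simp
    then show "opposite a \<le> opposite b" using ab(3) by (cases "a = b") (auto simp: opposite_def)
  qed simp
  then have "sorted_list_of_multiset (image_mset opposite M) = map opposite ?xs"
    by (metis mset_map mset_sorted_list_of_multiset sorted_list_of_multiset_mset sorted_sort_id)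
  then show ?thesis by (simp only: alternating_mset_def alternating_opposite)
qed

lemma alternating_sorted_distinct:
  "sorted xs \<Longrightarrow> alternating s (map even xs) \<Longrightarrow> distinct (xs :: nat list)"
proof (induction xs arbitrary: s)
  case (Cons a xs)
  then have "distinct xs" by auto
  moreover have "a \<notin> set xs"
  proof
    assume "a \<in> set xs"
    then obtain b ys where "xs = b # ys" by (cases xs) auto
    with \<open>a \<in> set xs\<close> Cons.prems(1) have "b = a" by auto
    then show False using Cons.prems(2) \<open>xs = b # ys\<close> by auto
  qed
  ultimately show ?case by simp
qed simp

lemma alternating_mset_distinct: "alternating_mset s (mset xs) \<Longrightarrow> distinct xs"
  using alternating_sorted_distinct[of "sort xs" s] by (simp add: alternating_mset_def)

lemma alternating_mset_size_le:
  assumes "alternating_mset s (mset xs)" "\<And>a b. a \<in> set xs \<Longrightarrow> b \<in> set xs \<Longrightarrow> a \<noteq> opposite b"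
    and "\<And>a. a \<in> set xs \<Longrightarrow> a div 2 \<in> {1..n}"
  shows "length xs \<le> n"
proof -
  have "inj_on (\<lambda>a. a div 2) (set xs)"
  proof (rule inj_onI)
    fix a b :: nat assume ab: "a \<in> set xs" "b \<in> set xs" "a div 2 = b div 2"
    show "a = b"
    proof (rule ccontr)
      assume "a \<noteq> b"
      moreover obtain q where "a = 2 * q \<or> a = Suc (2 * q)" "b = 2 * q \<or> b = Suc (2 * q)"
      proof -
        have "a = 2 * (b div 2) \<or> a = Suc (2 * (b div 2))" "b = 2 * (b div 2) \<or> b = Suc (2 * (b div 2))"
          using ab(3) by linarith+
        then show ?thesis by (rule that)
      qed
      ultimately have "a = opposite b" by (elim disjE) (simp_all add: opposite_def)
      then show False using assms(2) ab by blast
    qed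
  qed
  then have "card (set xs) \<le> card {1..n}"
    using assms(3) by (intro card_inj_on_le[of "\<lambda>a. a div 2"]) auto
  then show ?thesis using distinct_card[OF alternating_mset_distinct[OF assms(1)]] by simp
qed

text \<open>All pairs of points of a common unit cube are compared, not only edges of the
  triangulation. The condition passes to all faces, and its failure still gives points that merge as
  the grid is refined.\<close>

definition no_opposite_edge :: "int \<Rightarrow> ((nat \<Rightarrow> int) \<Rightarrow> nat) \<Rightarrow> nat set \<Rightarrow> (nat \<Rightarrow> int) \<Rightarrow> bool" where
  "no_opposite_edge K lab D x \<longleftrightarrow> (\<forall>y\<in>grid_box K D x. \<forall>z\<in>grid_box K D x.
     (\<forall>i. \<bar>y i - z i\<bar> \<le> 1) \<longrightarrow> lab y \<noteq> opposite (lab z))"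

lemma no_opposite_edge_simplex:
  assumes "no_opposite_edge K lab D x" "ys \<in> simplices K D x" "a \<in> set (map lab ys)" "b \<in> set (map lab ys)"
  shows "a \<noteq> opposite b"
proof -
  obtain y z where yz: "y \<in> set ys" "z \<in> set ys" "a = lab y" "b = lab z" using assms(3,4) by auto
  then have "y \<in> grid_box K D x" "z \<in> grid_box K D x"
    using assms(2) by (auto simp: simplices_def)
  moreover have "\<forall>i. \<bar>y i - z i\<bar> \<le> 1" using simplices_close[OF assms(2) yz(1,2)] by simp
  ultimately show ?thesis
    using assms(1) yz(3,4) by (simp add: no_opposite_edge_def)
qed

lemma alternating_count_opposite:
  assumes "no_opposite_edge K lab D x" "\<And>y. y \<in> grid_box K D x \<Longrightarrow> lab' y = opposite (lab y)"
  shows "alternating_count K lab' s D x = alternating_count K lab (\<not> s) D x"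
  unfolding alternating_count_def
proof (rule sum.cong[OF refl])
  fix ys assume ys: "ys \<in> simplices K D x"
  then have "map lab' ys = map opposite (map lab ys)" using assms(2) by (auto simp: simplices_def)
  then have "mset (map lab' ys) = image_mset opposite (mset (map lab ys))" by (simp only: mset_map)
  moreover have "alternating_mset s (image_mset opposite (mset (map lab ys))) = alternating_mset (\<not> s) (mset (map lab ys))"
    using no_opposite_edge_simplex[OF assms(1) ys] by (intro alternating_mset_opposite) auto
  ultimately show "(of_bool (alternating_mset s (mset (map lab' ys))) :: nat) = of_bool (alternating_mset (\<not> s) (mset (map lab ys)))"
    by simp
qed

lemma alternating_count_top:
  assumes "no_opposite_edge K lab D x" "\<And>y. y \<in> grid_box K D x \<Longrightarrow> lab y div 2 \<in> {1..n}" "n \<le> card D"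
  shows "alternating_count K lab s D x = 0"
  unfolding alternating_count_def
proof (rule sum.neutral, rule ballI)
  fix ys assume ys: "ys \<in> simplices K D x"
  have "\<not> alternating_mset s (mset (map lab ys))"
  proof
    assume a: "alternating_mset s (mset (map lab ys))"
    have "length (map lab ys) \<le> n"
    proof (rule alternating_mset_size_le[OF a])
      fix a assume "a \<in> set (map lab ys)"
      then obtain y where "y \<in> set ys" "a = lab y" by auto
      moreover from this have "y \<in> grid_box K D x" using ys by (auto simp: simplices_def)
      ultimately show "a div 2 \<in> {1..n}" using assms(2) by blast
    qed (rule no_opposite_edge_simplex[OF assms(1) ys])
    then show False using simplicesD(1)[OF ys] assms(3) by simp
  qed
  then show "(of_bool (alternating_mset s (mset (map lab ys))) :: nat) = 0" by simp
qed

text \<open>There are as many steps as free coordinates, and by parity no coordinate moves twice; so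
  the steps use every free coordinate.\<close>

lemma simplices_step_exists:
  assumes ys: "ys \<in> simplices K D x" and D: "finite D" "c \<in> D"
  shows "\<exists>t<card D. \<forall>i. i \<noteq> c \<longrightarrow> (ys ! Suc t) i = (ys ! t) i"
proof -
  have "\<forall>t. \<exists>u. t < card D \<longrightarrow> u \<in> D \<and> even ((ys ! t) u) \<and> \<bar>(ys ! Suc t) u - (ys ! t) u\<bar> = 1 \<and>
     (\<forall>i. i \<noteq> u \<longrightarrow> (ys ! Suc t) i = (ys ! t) i)"
    using simplicesD(4)[OF ys] by (auto simp: odd_step_def)
  from choice[OF this] obtain u where u: "\<And>t. t < card D \<Longrightarrow> u t \<in> D" "\<And>t. t < card D \<Longrightarrow> even ((ys ! t) (u t))"
     "\<And>t. t < card D \<Longrightarrow> \<bar>(ys ! Suc t) (u t) - (ys ! t) (u t)\<bar> = 1"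
     "\<And>t i. t < card D \<Longrightarrow> i \<noteq> u t \<Longrightarrow> (ys ! Suc t) i = (ys ! t) i"
    by blast
  have "u s \<noteq> u t" if "s < t" "t < card D" for s t
  proof
    assume eq: "u s = u t"
    have "(ys ! Suc s) (u s) = (ys ! s) (u s) + 1 \<or> (ys ! Suc s) (u s) = (ys ! s) (u s) - 1"
      using u(3)[of s] that by linarith
    then have "odd ((ys ! Suc s) (u s))" using u(2)[of s] that by auto
    moreover have "even ((ys ! t) (u s))" using u(2)[of t] that eq by simp
    ultimately show False
      using simplices_coordinate[OF ys, of "Suc s" t "u s"] that by auto
  qed
  then have inj: "inj_on u {..<card D}" by (metis inj_onI lessThan_iff nat_neq_iff)
  have "u ` {..<card D} = D"
    by (rule card_subset_eq) (use D u(1) card_image[OF inj] in auto)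
  then have "c \<in> u ` {..<card D}" using D(2) by simp
  then obtain t where "c = u t" "t \<in> {..<card D}" by (rule imageE)
  then show ?thesis using u(4) by auto
qed

text \<open>Some edge of each simplex moves only \<open>c\<close> and joins equal labels, whereas
  the labels of an alternating simplex are distinct.\<close>

lemma alternating_count_degenerate:
  assumes D: "finite D" "c \<in> D"
    and lab: "\<And>y v. y \<in> grid_box K D x \<Longrightarrow> lab (y(c := v)) = lab y"
  shows "alternating_count K lab s D x = 0"
  unfolding alternating_count_def
proof (rule sum.neutral, rule ballI)
  fix ys assume ys: "ys \<in> simplices K D x"
  obtain t where t: "t < card D" "\<And>i. i \<noteq> c \<Longrightarrow> (ys ! Suc t) i = (ys ! t) i"
    using simplices_step_exists[OF ys D] by auto
  have "ys ! Suc t = (ys ! t)(c := (ys ! Suc t) c)" using t(2) by auto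
  then have "lab (ys ! Suc t) = lab (ys ! t)"
    using lab[OF simplicesD(2)[OF ys, of t], of "(ys ! Suc t) c"] t(1) by simp
  then have "\<not> distinct (map lab ys)"
    using simplicesD(1)[OF ys] t(1) nth_eq_iff_index_eq[of "map lab ys" t "Suc t"] by auto
  then show "(of_bool (alternating_mset s (mset (map lab ys))) :: nat) = 0"
    using alternating_mset_distinct by auto
qed

lemma alternating_count_empty: "alternating_count K lab s {} x = of_bool (even (lab x) = s)"
proof -
  have "simplices K {} x = {[x]}"
    by (auto simp: simplices_def grid_box_def length_Suc_conv fun_eq_iff)
  then show ?thesis
    by (simp add: alternating_count_def alternating_mset_def)
qed

subsection \<open>Zeros of equivariant maps\<close>

lemma alternating_count_base:
  assumes "\<And>i. i \<notin> D \<Longrightarrow> x i = x' i"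
  shows "alternating_count K lab s D x = alternating_count K lab s D x'"
proof -
  have "grid_box K D x = grid_box K D x'"
    unfolding grid_box_def using assms by (intro Collect_cong all_cong1) auto
  then show ?thesis by (simp add: alternating_count_def simplices_def)
qed

lemma no_opposite_edge_subset:
  "no_opposite_edge K lab D x \<Longrightarrow> grid_box K D' x' \<subseteq> grid_box K D x \<Longrightarrow> no_opposite_edge K lab D' x'"
  unfolding no_opposite_edge_def by (meson subsetD)

text \<open>Hyperspherical coordinates. An angle with sine 0 makes all later coordinates vanish, so
  finitely many angles followed by zeros give a point of a finite-dimensional sphere.\<close>

definition spherical :: "(nat \<Rightarrow> real) \<Rightarrow> nat \<Rightarrow> real" where
  "spherical \<tau> i = (\<Prod>l<i. sin (\<tau> l)) * cos (\<tau> i)"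

lemma spherical_zero:
  assumes "sin (\<tau> l) = 0" "l < i"
  shows "spherical \<tau> i = 0"
  using assms by (auto simp: spherical_def prod_zero_iff)

lemma spherical_reflect:
  assumes "\<And>l. \<tau>' l = (if l \<in> R then pi - \<tau> l else \<tau> l)"
  shows "spherical \<tau>' i = (if i \<in> R then - 1 else 1) * spherical \<tau> i"
proof -
  have "sin (\<tau>' l) = sin (\<tau> l)" for l using assms by simp
  moreover have "cos (\<tau>' i) = (if i \<in> R then - 1 else 1) * cos (\<tau> i)" using assms by simp
  ultimately show ?thesis by (simp add: spherical_def)
qed

text \<open>Coordinates after \<open>l\<close> vanish on both sides, and the earlier ones do not
  involve the angle \<open>Suc l\<close>.\<close>

lemma spherical_degenerate:
  assumes "sin (\<tau> l) = 0" "\<And>i. i \<noteq> Suc l \<Longrightarrow> \<tau>' i = \<tau> i"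
  shows "spherical \<tau>' = spherical \<tau>"
proof
  fix i show "spherical \<tau>' i = spherical \<tau> i"
  proof (cases "l < i")
    case True
    moreover have "sin (\<tau>' l) = 0" using assms by simp
    ultimately show ?thesis using assms(1) by (simp add: spherical_zero)
  next
    case False
    then show ?thesis using assms(2) by (auto simp: spherical_def intro!: prod.cong)
  qed
qed

lemma sum_spherical_squares:
  "(\<Sum>i\<le>r. (spherical \<tau> i)\<^sup>2) + (\<Prod>l\<le>r. sin (\<tau> l))\<^sup>2 = 1"
proof (induction r)
  case 0
  show ?case by (simp add: spherical_def)
next
  case (Suc r)
  have "(\<Prod>l\<le>r. sin (\<tau> l))\<^sup>2 = (spherical \<tau> (Suc r))\<^sup>2 + (\<Prod>l\<le>Suc r. sin (\<tau> l))\<^sup>2"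
    by (simp add: spherical_def power_mult_distrib lessThan_Suc_atMost distrib_left[symmetric])
  then show ?case using Suc by simp
qed

text \<open>Padding with the angle 0 stops the point at coordinate \<open>r\<close>, which becomes
  the product of the sines of all \<open>r\<close> angles. So this parametrizes the
  \<open>r\<close>-sphere, and angles between 0 and \<open>pi\<close> give its half with nonnegative
  last coordinate.\<close>

definition block :: "(nat \<Rightarrow> real) \<Rightarrow> nat \<Rightarrow> nat \<Rightarrow> nat \<Rightarrow> real" where
  "block t s r = (\<lambda>l. if l < r then t (s + l) else 0)"

lemma sum_spherical_block: "(\<Sum>i\<le>r. (spherical (block t s r) i)\<^sup>2) = 1"
proof -
  have "(\<Prod>l\<le>r. sin (block t s r l)) = 0"
    by (rule prod_zero) (auto simp: block_def intro!: bexI[of _ r])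
  with sum_spherical_squares[of "block t s r" r] show ?thesis by algebra
qed

definition grid_angle :: "int \<Rightarrow> (nat \<Rightarrow> int) \<Rightarrow> nat \<Rightarrow> real" where
  "grid_angle K y = (\<lambda>i. pi * of_int (y i) / of_int K)"

lemma sin_grid_angle:
  assumes "y i = 0 \<or> y i = K" "K > 0"
  shows "sin (grid_angle K y i) = 0"
  using assms by (auto simp: grid_angle_def)

lemma grid_angle_reflect:
  "K > 0 \<Longrightarrow> grid_angle K (grid_reflect K R y) i = (if i \<in> R then pi - grid_angle K y i else grid_angle K y i)"
  by (simp add: grid_angle_def grid_reflect_def field_simps)

text \<open>The index depends only on absolute values, with ties broken by \<open>LEAST\<close>. So
  negating a \<open>z\<close> that does not vanish identically on \<open>{1..n}\<close> changes the
  sign bit and nothing else.\<close>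

definition max_label :: "nat \<Rightarrow> (nat \<Rightarrow> real) \<Rightarrow> nat" where
  "max_label n z = (let i = LEAST i. i \<in> {1..n} \<and> (\<forall>l\<in>{1..n}. \<bar>z l\<bar> \<le> \<bar>z i\<bar>)
     in 2 * i + (if z i > 0 then 0 else 1))"

lemma max_label_index:
  assumes "n \<ge> 1"
  shows "max_label n z div 2 \<in> {1..n}" "\<forall>l\<in>{1..n}. \<bar>z l\<bar> \<le> \<bar>z (max_label n z div 2)\<bar>"
    "even (max_label n z) \<longleftrightarrow> z (max_label n z div 2) > 0"
proof -
  define P where "P = (\<lambda>i. i \<in> {1..n} \<and> (\<forall>l\<in>{1..n}. \<bar>z l\<bar> \<le> \<bar>z i\<bar>))"
  define i where "i = (LEAST i. P i)"
  have "Max ((\<lambda>l. \<bar>z l\<bar>) ` {1..n}) \<in> (\<lambda>l. \<bar>z l\<bar>) ` {1..n}" using assms by (intro Max_in) auto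
  then obtain j where "j \<in> {1..n}" "Max ((\<lambda>l. \<bar>z l\<bar>) ` {1..n}) = \<bar>z j\<bar>" by auto
  then have "P j" unfolding P_def by (metis Max_ge finite_atLeastAtMost finite_imageI imageI)
  then have P: "P i" unfolding i_def by (rule LeastI)
  have e: "max_label n z = 2 * i + (if z i > 0 then 0 else 1)"
    by (simp add: max_label_def i_def P_def Let_def)
  then have "max_label n z div 2 = i" by simp
  then show "max_label n z div 2 \<in> {1..n}" "\<forall>l\<in>{1..n}. \<bar>z l\<bar> \<le> \<bar>z (max_label n z div 2)\<bar>"
    "even (max_label n z) \<longleftrightarrow> z (max_label n z div 2) > 0"
    using P e by (auto simp: P_def)
qed

lemma max_label_minus:
  assumes "n \<ge> 1" "\<exists>l\<in>{1..n}. z l \<noteq> 0"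
  shows "max_label n (\<lambda>l. - z l) = opposite (max_label n z)"
proof -
  define i where "i = (LEAST i. i \<in> {1..n} \<and> (\<forall>l\<in>{1..n}. \<bar>z l\<bar> \<le> \<bar>z i\<bar>))"
  have e: "max_label n z = 2 * i + (if z i > 0 then 0 else 1)"
    by (simp add: max_label_def i_def Let_def)
  then have "i = max_label n z div 2" by simp
  then have "\<forall>l\<in>{1..n}. \<bar>z l\<bar> \<le> \<bar>z i\<bar>" using max_label_index(2)[OF assms(1)] by metis
  then have "z i \<noteq> 0" using assms(2) by auto
  moreover have "max_label n (\<lambda>l. - z l) = 2 * i + (if - z i > 0 then 0 else 1)"
    by (simp add: max_label_def i_def Let_def)
  ultimately show ?thesis using e by (auto simp: opposite_def)
qed

lemma max_label_opposite:
  assumes "n \<ge> 1" "max_label n z = opposite (max_label n w)" "\<exists>l\<in>{1..n}. z l \<noteq> 0" "\<exists>l\<in>{1..n}. w l \<noteq> 0"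
  shows "\<exists>i\<in>{1..n}. z i * w i \<le> 0 \<and> (\<forall>l\<in>{1..n}. \<bar>z l\<bar> \<le> \<bar>z i\<bar> \<and> \<bar>w l\<bar> \<le> \<bar>w i\<bar>)"
proof -
  let ?i = "max_label n z div 2"
  have "opposite a div 2 = a div 2" for a by (cases "even a") (auto simp: opposite_def elim!: oddE)
  then have e: "max_label n w div 2 = ?i" using assms(2) by simp
  have "even (max_label n z) \<longleftrightarrow> odd (max_label n w)" using assms(2) by simp
  then have "z ?i > 0 \<longleftrightarrow> \<not> w ?i > 0" using max_label_index(3)[OF assms(1)] e by metis
  then have "z ?i * w ?i \<le> 0" by (auto simp: mult_le_0_iff not_less)
  then show ?thesis
    using max_label_index(1,2)[OF assms(1), of z] max_label_index(2)[OF assms(1), of w] unfolding e by blast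
qed

lemma tendsto_coordinatewise:
  fixes f :: "'a \<Rightarrow> 'i \<Rightarrow> 'b::topological_space"
  shows "(f \<longlongrightarrow> l) F \<longleftrightarrow> (\<forall>c. ((\<lambda>r. f r c) \<longlongrightarrow> l c) F)"
  using limitin_componentwise[of "\<lambda>_. euclidean" UNIV f l F]
  by (simp add: euclidean_product_topology)

text \<open>
  The arguments of \<open>G\<close> are the spherical coordinates of \<open>q\<close>, of \<open>v\<close> and the coefficients of \<open>p\<close>.
  \<open>G_flip\<close> holds because \<open>q\<close> and \<open>-q\<close> describe the same flag.
\<close>

locale equivariant_map =
  fixes q m k n :: nat and G :: "(nat \<Rightarrow> real) \<Rightarrow> (nat \<Rightarrow> real) \<Rightarrow> (nat \<Rightarrow> real) \<Rightarrow> nat \<Rightarrow> real"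
  assumes n: "n = q + m + k" "n \<ge> 1"
    and G_flip: "\<And>a b c. G (\<lambda>i. - a i) (b(0 := - b 0)) c = G a b c"
    and G_reverse: "\<And>a b c. G a (\<lambda>i. - b i) (\<lambda>i. (-1) ^ i * c i) = G a b c"
    and G_minus: "\<And>a b c. G a b (\<lambda>i. - c i) = (\<lambda>l. - G a b c l)"
begin

section \<open>Symmetries of the values on the faces of the cube\<close>

definition value_at :: "(nat \<Rightarrow> real) \<Rightarrow> nat \<Rightarrow> real" where
  "value_at t = G (spherical (block t 0 q)) (spherical (block t q m)) (spherical (block t (q + m) k))"

text \<open>Here \<open>q\<close> is a number, the dimension of the unit sphere of \<open>F\<close>.
  The direction angles are freed in a fixed order, first the \<open>q\<close> angles of the unit
  vector in \<open>F\<close> and then the \<open>m\<close> angles of \<open>v\<close>; the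
  polynomial angles are freed independently of them.\<close>

definition cell :: "nat \<Rightarrow> nat \<Rightarrow> nat set" where
  "cell i j = {..<i} \<union> {q + m..<q + m + j}"

text \<open>Without a common zero at the grid points, negating the values always replaces a label by
  its opposite.\<close>

context
  fixes K :: int
  assumes K: "even K" "K > 0"
    and nonzero: "\<And>y. y \<in> grid_box K {..<n} (\<lambda>_. 0) \<Longrightarrow> \<exists>l\<in>{1..n}. value_at (grid_angle K y) l \<noteq> 0"
begin

abbreviation "lab y \<equiv> max_label n (value_at (grid_angle K y))"

abbreviation "cnt s D x \<equiv> alternating_count K lab s D x"

text \<open>The excluded case is \<open>Suc c = s\<close>: then \<open>c\<close> precedes the block
  at \<open>s\<close>, and an end of \<open>c\<close> does not neutralize the first angle of that
  block.\<close>

lemma block_angle_degenerate: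
  assumes "y c = 0 \<or> y c = K" "s \<le> c \<or> Suc c < s" 
  shows "spherical (block (grid_angle K (y(Suc c := v))) s r) = spherical (block (grid_angle K y) s r)"
proof (cases "s \<le> c \<and> c - s < r")
  case True
  then obtain l where "c = s + l" using le_Suc_ex by blast
  then show ?thesis
    using sin_grid_angle[of y c K, OF assms(1) K(2)] True
    by (intro spherical_degenerate[of _ l]) (auto simp: block_def grid_angle_def)
next
  case False
  then have "block (grid_angle K (y(Suc c := v))) s r = block (grid_angle K y) s r"
    using assms(2) by (auto simp: block_def grid_angle_def fun_eq_iff)
  then show ?thesis by simp
qed

lemma value_degenerate:
  assumes "y c = 0 \<or> y c = K" "Suc c \<noteq> q" "Suc c \<noteq> q + m"
  shows "value_at (grid_angle K (y(Suc c := v))) = value_at (grid_angle K y)"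
proof -
  have "spherical (block (grid_angle K (y(Suc c := v))) s r) = spherical (block (grid_angle K y) s r)"
    if "s \<in> {0, q, q + m}" for s r
    using that assms by (intro block_angle_degenerate) auto
  then show ?thesis by (simp add: value_at_def)
qed

lemma block_reflect:
  "spherical (block (grid_angle K (grid_reflect K R y)) s r) i =
     (if i < r \<and> s + i \<in> R then - 1 else 1) * spherical (block (grid_angle K y) s r) i"
proof -
  have "block (grid_angle K (grid_reflect K R y)) s r l
      = (if l \<in> {l. l < r \<and> s + l \<in> R} then pi - block (grid_angle K y) s r l else block (grid_angle K y) s r l)" for l
    by (simp add: block_def grid_angle_reflect[OF K(2)])
  from spherical_reflect[OF this] show ?thesis by simp
qed

lemma block_zero:
  assumes "l < i" "l < r \<Longrightarrow> y (s + l) = 0"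
  shows "spherical (block (grid_angle K y) s r) i = 0"
  using assms by (intro spherical_zero[of _ l]) (auto simp: block_def grid_angle_def)

text \<open>On the equator where polynomial angle \<open>j - 1\<close> is 0, the coefficients from
  \<open>j\<close> on vanish, so reflecting the first \<open>j\<close> angles negates all the
  others: this is the antipodal map.\<close>

lemma value_minus:
  assumes j: "j \<ge> 1" "j \<le> k" and y: "y (q + m + (j - 1)) = 0"
  shows "value_at (grid_angle K (grid_reflect K {q + m..<q + m + j} y)) = (\<lambda>l. - value_at (grid_angle K y) l)"
proof -
  let ?y = "grid_reflect K {q + m..<q + m + j} y"
  have "spherical (block (grid_angle K ?y) 0 q) = spherical (block (grid_angle K y) 0 q)"
    "spherical (block (grid_angle K ?y) q m) = spherical (block (grid_angle K y) q m)"
    by (rule ext; subst block_reflect; simp)+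
  moreover have "spherical (block (grid_angle K ?y) (q + m) k) = (\<lambda>i. - spherical (block (grid_angle K y) (q + m) k) i)"
  proof
    fix i show "spherical (block (grid_angle K ?y) (q + m) k) i = - spherical (block (grid_angle K y) (q + m) k) i"
      using block_reflect[of "{q + m..<q + m + j}" y "q + m" k i] block_zero[of "j - 1" i k y "q + m"] j y
      by (cases "i < j") auto
  qed
  ultimately show ?thesis by (simp add: value_at_def G_minus)
qed

lemma G_reverse_sign:
  "G a (\<lambda>i. - b i) (\<lambda>i. (-1) ^ (i + j) * c i) = (\<lambda>l. (-1) ^ j * G a b c l)"
proof (cases "even j")
  case True
  then show ?thesis using G_reverse[of a b c] by (simp add: power_add)
next
  case False
  then show ?thesis
    using G_minus[of a "\<lambda>i. - b i" "\<lambda>i. (-1) ^ i * c i"] G_reverse[of a b c] by (simp add: power_add)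
qed

text \<open>The reflection \<open>R\<close> realizes the reversal of \<open>v\<close> and
  \<open>p\<close>. For \<open>i > q\<close> it negates the direction vector directly. For
  \<open>i \<le> q\<close> it negates the vector in \<open>F\<close>; there the direction has only
  its component 0, so by \<open>G_flip\<close> this amounts to negating the direction. The chosen
  polynomial angles multiply coefficient \<open>l\<close> by \<open>(-1) ^ (l + j)\<close>, which
  leaves coefficient \<open>j\<close> alone; the surplus sign \<open>(-1) ^ j\<close> appears in the
  values.\<close>

lemma value_reverse:
  assumes i: "i \<ge> 1" "i \<le> q + m" and j: "j \<le> k"
    and y: "\<And>c. c \<notin> cell (i - 1) j \<Longrightarrow> y c = 0"
  defines "R \<equiv> (if i \<le> q then {..<i} else {q..<i}) \<union> {c. q + m \<le> c \<and> c < q + m + j \<and> odd (c - (q + m) + j)}"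
  shows "value_at (grid_angle K (grid_reflect K R y)) = (\<lambda>l. (-1) ^ j * value_at (grid_angle K y) l)"
proof -
  let ?y = "grid_reflect K R y"
  let ?a = "spherical (block (grid_angle K y) 0 q)" and ?b = "spherical (block (grid_angle K y) q m)"
    and ?c = "spherical (block (grid_angle K y) (q + m) k)"
  have c: "spherical (block (grid_angle K ?y) (q + m) k) = (\<lambda>l. (-1) ^ (l + j) * ?c l)"
  proof
    fix l
    have R: "q + m + l \<in> R \<longleftrightarrow> l < j \<and> odd (l + j)"
      unfolding R_def using i by auto
    show "spherical (block (grid_angle K ?y) (q + m) k) l = (-1) ^ (l + j) * ?c l"
    proof (cases "l < j \<or> l = j")
      case True
      then show ?thesis unfolding block_reflect R using j by (auto simp: minus_one_power_iff)
    next
      case False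
      then have "?c l = 0" using y[of "q + m + j"] i by (intro block_zero[of j]) (auto simp: cell_def)
      then show ?thesis unfolding block_reflect by simp
    qed
  qed
  show ?thesis
  proof (cases "i \<le> q")
    case True
    have y0: "y (i - 1) = 0" using y[of "i - 1"] True i by (auto simp: cell_def)
    have "spherical (block (grid_angle K ?y) 0 q) = (\<lambda>l. - ?a l)"
    proof
      fix l
      show "spherical (block (grid_angle K ?y) 0 q) l = - ?a l"
        using block_reflect[of R y 0 q l] block_zero[of "i - 1" l q y 0] True i y0
        by (cases "l < i") (auto simp: R_def)
    qed
    moreover have "spherical (block (grid_angle K ?y) q m) = ?b"
      by (rule ext, subst block_reflect) (use True in \<open>auto simp: R_def\<close>)
    moreover have "?b l = 0" if "l \<ge> 1" for l
      using that y[of q] True i by (intro block_zero[of 0]) (auto simp: cell_def)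
    \<comment> \<open>Since only component 0 can be nonzero, \<open>?b\<close> is also the flip of
      its own negative; in this form \<open>G_flip\<close> trades the negated \<open>?a\<close> for
      a negated direction.\<close>
    then have "?b = (\<lambda>l. - ?b l)(0 := - (- ?b 0))" by (auto simp: fun_eq_iff)
    ultimately have "value_at (grid_angle K ?y) = G (\<lambda>l. - ?a l) ((\<lambda>l. - ?b l)(0 := - (- ?b 0))) (\<lambda>l. (-1) ^ (l + j) * ?c l)"
      unfolding value_at_def c by metis
    also have "\<dots> = G ?a (\<lambda>l. - ?b l) (\<lambda>l. (-1) ^ (l + j) * ?c l)"
      by (rule G_flip)
    finally show ?thesis by (simp add: G_reverse_sign value_at_def)
  next
    case False
    have y0: "y (i - 1) = 0" using y[of "i - 1"] False i by (auto simp: cell_def)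
    have "spherical (block (grid_angle K ?y) q m) = (\<lambda>l. - ?b l)"
    proof
      fix l
      show "spherical (block (grid_angle K ?y) q m) l = - ?b l"
        using block_reflect[of R y q m l] block_zero[of "i - 1 - q" l m y q] False i y0
        by (cases "l < i - q") (auto simp: R_def)
    qed
    moreover have "spherical (block (grid_angle K ?y) 0 q) = ?a"
      by (rule ext, subst block_reflect) (use False in \<open>auto simp: R_def\<close>)
    ultimately show ?thesis by (simp add: G_reverse_sign value_at_def c)
  qed
qed

text \<open>Where the last angle of the vector in \<open>F\<close> is 0, reflecting all its angles
  negates it. Reflecting angle \<open>q\<close>, the first of the direction block, negates component
  0 of the direction. Both changes together describe the same flag.\<close>

lemma value_flip:
  assumes q: "q \<ge> 1" and m: "m \<ge> 1" and y: "y (q - 1) = 0"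
  shows "value_at (grid_angle K (grid_reflect K {..q} y)) = value_at (grid_angle K y)"
proof -
  let ?y = "grid_reflect K {..q} y"
  let ?a = "spherical (block (grid_angle K y) 0 q)" and ?b = "spherical (block (grid_angle K y) q m)"
  have "spherical (block (grid_angle K ?y) 0 q) = (\<lambda>l. - ?a l)"
  proof
    fix l
    show "spherical (block (grid_angle K ?y) 0 q) l = - ?a l"
      using block_reflect[of "{..q}" y 0 q l] block_zero[of "q - 1" l q y 0] q y
      by (cases "l < q") auto
  qed
  moreover have "spherical (block (grid_angle K ?y) q m) = ?b(0 := - ?b 0)"
    by (rule ext, subst block_reflect) (use m in auto)
  moreover have "spherical (block (grid_angle K ?y) (q + m) k) = spherical (block (grid_angle K y) (q + m) k)"
    by (rule ext, subst block_reflect) (use m in auto)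
  ultimately show ?thesis by (simp add: value_at_def G_flip)
qed

text \<open>The end \<open>K\<close> of coordinate \<open>c\<close> is the mirror image of the end 0
  under every reflection that involves \<open>c\<close> and otherwise only free coordinates. The
  freedom in \<open>R\<close> is used to realize a symmetry of the values.\<close>

lemma face_reflect:
  assumes "c \<in> R" "R \<subseteq> D"
  shows "cnt s (D - {c}) ((\<lambda>_. 0)(c := K)) = alternating_count K (\<lambda>y. lab (grid_reflect K R y)) s (D - {c}) (\<lambda>_. 0)"
proof -
  have "cnt s (D - {c}) ((\<lambda>_. 0)(c := K)) = cnt s (D - {c}) (grid_reflect K R (\<lambda>_. 0))"
    by (rule alternating_count_base) (use assms in \<open>auto simp: grid_reflect_def\<close>)
  then show ?thesis by (simp only: alternating_count_reflect[OF K(1)])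
qed

section \<open>The recurrence for the counts modulo 2\<close>

context
  assumes no_edge: "no_opposite_edge K lab {..<n} (\<lambda>_. 0)"
begin

lemma cell_subset: "i \<le> q + m \<Longrightarrow> j \<le> k \<Longrightarrow> cell i j \<subseteq> {..<n}"
  using n by (auto simp: cell_def)

lemma face_box_subset:
  assumes "D \<subseteq> {..<n}"
  shows "grid_box K D (\<lambda>_. 0) \<subseteq> grid_box K {..<n} (\<lambda>_. 0)"
proof
  fix y assume y: "y \<in> grid_box K D (\<lambda>_. 0)"
  show "y \<in> grid_box K {..<n} (\<lambda>_. 0)"
  proof (rule grid_boxI)
    show "0 \<le> y i \<and> y i \<le> K" for i using grid_boxD[OF y, of i] K(2) by (cases "i \<in> D") auto
    show "y i = 0" if "i \<notin> {..<n}" for i using grid_boxD(3)[OF y, of i] assms that by auto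
  qed
qed

lemma reflect_count_opposite:
  assumes "D \<subseteq> {..<n}" "\<And>y. y \<in> grid_box K D (\<lambda>_. 0) \<Longrightarrow>
     value_at (grid_angle K (grid_reflect K R y)) = (\<lambda>l. - value_at (grid_angle K y) l)"
  shows "alternating_count K (\<lambda>y. lab (grid_reflect K R y)) s D (\<lambda>_. 0) = cnt (\<not> s) D (\<lambda>_. 0)"
proof (rule alternating_count_opposite)
  show "no_opposite_edge K lab D (\<lambda>_. 0)"
    by (rule no_opposite_edge_subset[OF no_edge face_box_subset[OF assms(1)]])
  fix y assume "y \<in> grid_box K D (\<lambda>_. 0)"
  then show "lab (grid_reflect K R y) = opposite (lab y)"
    using assms(2) face_box_subset[OF assms(1)] nonzero n(2) by (simp add: max_label_minus subset_iff)
qed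

lemma reflect_count_same:
  assumes "\<And>y. y \<in> grid_box K D (\<lambda>_. 0) \<Longrightarrow>
     value_at (grid_angle K (grid_reflect K R y)) = value_at (grid_angle K y)"
  shows "alternating_count K (\<lambda>y. lab (grid_reflect K R y)) s D (\<lambda>_. 0) = cnt s D (\<lambda>_. 0)"
  by (rule alternating_count_cong) (simp add: assms)

text \<open>This is \<open>u i j\<close>. Both starting signs are included because passing to
  opposite labels exchanges them and the boundary formula contains both.\<close>

definition full_count :: "nat \<Rightarrow> nat \<Rightarrow> nat" where
  "full_count i j = cnt True (cell i j) (\<lambda>_. 0) + cnt False (cell i j) (\<lambda>_. 0)"

abbreviation "faces D c \<equiv> (\<Sum>e\<in>{0, K}. cnt True (D - {c}) ((\<lambda>_. 0)(c := e)))"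

lemma faces_eq: "faces D c = cnt True (D - {c}) (\<lambda>_. 0) + cnt True (D - {c}) ((\<lambda>_. 0)(c := K))"
proof -
  have "(\<lambda>_. 0::int)(c := 0) = (\<lambda>_. 0)" by auto
  then show ?thesis using K(2) by (simp del: fun_upd_apply)
qed

lemma faces_last_coefficient:
  assumes "i \<le> q + m" "1 \<le> j" "j \<le> k"
  shows "faces (cell i j) (q + m + j - 1) = full_count i (j - 1)"
proof -
  let ?R = "{q + m..<q + m + j}" and ?c = "q + m + j - 1"
  have D: "cell i j - {?c} = cell i (j - 1)" using assms by (auto simp: cell_def)
  have "cnt True (cell i j - {?c}) ((\<lambda>_. 0)(?c := K))
      = alternating_count K (\<lambda>y. lab (grid_reflect K ?R y)) True (cell i j - {?c}) (\<lambda>_. 0)"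
    by (rule face_reflect) (use assms in \<open>auto simp: cell_def\<close>)
  also have "\<dots> = cnt (\<not> True) (cell i (j - 1)) (\<lambda>_. 0)"
    unfolding D
  proof (rule reflect_count_opposite)
    show "cell i (j - 1) \<subseteq> {..<n}" using assms by (intro cell_subset) auto
    fix y assume "y \<in> grid_box K (cell i (j - 1)) (\<lambda>_. 0)"
    from grid_boxD(3)[OF this, of "q + m + (j - 1)"] have "y (q + m + (j - 1)) = 0"
      using assms by (auto simp: cell_def)
    then show "value_at (grid_angle K (grid_reflect K ?R y)) = (\<lambda>l. - value_at (grid_angle K y) l)"
      using assms by (intro value_minus) auto
  qed
  finally show ?thesis unfolding faces_eq unfolding D by (simp add: full_count_def)
qed

text \<open>By \<open>value_reverse\<close> the values at the end \<open>K\<close> are those at the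
  end 0 up to the sign \<open>(-1) ^ j\<close>. For even \<open>j\<close> the two ends give the same
  number; for odd \<open>j\<close> they give the counts with both starting signs.\<close>

lemma faces_last_direction:
  assumes "1 \<le> i" "i \<le> q + m" "j \<le> k"
  shows "even (faces (cell i j) (i - 1) + j * full_count (i - 1) j)"
proof -
  let ?R = "(if i \<le> q then {..<i} else {q..<i}) \<union> {c. q + m \<le> c \<and> c < q + m + j \<and> odd (c - (q + m) + j)}"
  let ?c = "i - 1"
  have D: "cell i j - {?c} = cell (i - 1) j" using assms by (auto simp: cell_def)
  have "cnt True (cell i j - {?c}) ((\<lambda>_. 0)(?c := K))
      = alternating_count K (\<lambda>y. lab (grid_reflect K ?R y)) True (cell i j - {?c}) (\<lambda>_. 0)"
    by (rule face_reflect) (use assms in \<open>auto simp: cell_def split: if_splits\<close>)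
  also have "\<dots> = cnt (even j) (cell (i - 1) j) (\<lambda>_. 0)"
  proof -
    have val: "value_at (grid_angle K (grid_reflect K ?R y)) = (\<lambda>l. (-1) ^ j * value_at (grid_angle K y) l)"
      if "y \<in> grid_box K (cell (i - 1) j) (\<lambda>_. 0)" for y
      using assms grid_boxD(3)[OF that] by (intro value_reverse) auto
    show ?thesis
    proof (cases "even j")
      case True
      then show ?thesis unfolding D using val by (subst reflect_count_same) auto
    next
      case False
      then show ?thesis unfolding D using val assms cell_subset[of "i - 1" j]
        by (subst reflect_count_opposite) auto
    qed
  qed
  finally show ?thesis unfolding faces_eq unfolding D by (cases "even j") (auto simp: full_count_def)
qed

text \<open>The angle after \<open>c\<close> is again free. If it belongs to the same sphere, an end
  of \<open>c\<close> makes it ineffective and the face is degenerate. If \<open>c\<close> is the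
  last angle of the vector in \<open>F\<close>, \<open>value_flip\<close> shows that the two ends
  have equal counts.\<close>

lemma faces_other:
  assumes "i \<le> q + m" "j \<le> k" "c \<in> cell i j" "Suc c \<noteq> i" "Suc c \<noteq> q + m + j"
  shows "even (faces (cell i j) c)"
proof (cases "Suc c = q")
  case False
  have zero: "cnt True (cell i j - {c}) ((\<lambda>_. 0)(c := e)) = 0" if "e \<in> {0, K}" for e
  proof (rule alternating_count_degenerate[where c = "Suc c"])
    show "Suc c \<in> cell i j - {c}" using assms by (auto simp: cell_def)
    fix y v assume "y \<in> grid_box K (cell i j - {c}) ((\<lambda>_. 0)(c := e))"
    from grid_boxD(3)[OF this, of c] that have "y c = 0 \<or> y c = K" by auto
    moreover have "Suc c \<noteq> q + m" using assms by (auto simp: cell_def)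
    ultimately show "lab (y(Suc c := v)) = lab y" using False by (subst value_degenerate) auto
  qed (simp add: cell_def)
  then show ?thesis by simp
next
  case True
  then have c: "c = q - 1" "1 \<le> q" "q < i" using assms by (auto simp: cell_def)
  let ?R = "{..q}"
  have "cnt True (cell i j - {c}) ((\<lambda>_. 0)(c := K))
      = alternating_count K (\<lambda>y. lab (grid_reflect K ?R y)) True (cell i j - {c}) (\<lambda>_. 0)"
    by (rule face_reflect) (use c in \<open>auto simp: cell_def\<close>)
  also have "\<dots> = cnt True (cell i j - {c}) (\<lambda>_. 0)"
  proof (rule reflect_count_same)
    fix y assume "y \<in> grid_box K (cell i j - {c}) (\<lambda>_. 0)"
    from grid_boxD(3)[OF this, of c] have "y c = 0" by simp
    then show "value_at (grid_angle K (grid_reflect K ?R y)) = value_at (grid_angle K y)"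
      using c assms by (intro value_flip) auto
  qed
  finally show ?thesis unfolding faces_eq by simp
qed

lemma full_count_recurrence:
  assumes ij: "i \<le> q + m" "j \<le> k" "i + j > 0"
  shows "even (full_count i j + (if i > 0 then j * full_count (i - 1) j else 0)
      + (if j > 0 then full_count i (j - 1) else 0))"
proof -
  let ?D = "cell i j"
  \<comment> \<open>\<open>A\<close> and \<open>B\<close> hold the last free angle of each kind, the
    only coordinates whose faces can survive modulo 2.\<close>
  define A where "A = (if i > 0 then {i - 1} else {})"
  define B where "B = (if j > 0 then {q + m + j - 1} else {})"
  have AB: "A \<subseteq> ?D" "B \<subseteq> ?D" "A \<inter> B = {}" using ij by (auto simp: A_def B_def cell_def)
  have fin: "finite ?D" by (simp add: cell_def)
  have "?D \<noteq> {}" using AB ij(3) by (auto simp: A_def B_def split: if_splits)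
  then have bd: "even (full_count i j + (\<Sum>c\<in>?D. faces ?D c))"
    using alternating_count_boundary[OF fin _ K, of lab True "\<lambda>_. 0"] by (simp add: full_count_def)
  have "(\<Sum>c\<in>?D. faces ?D c) = (\<Sum>c\<in>?D - (A \<union> B). faces ?D c) + (\<Sum>c\<in>A \<union> B. faces ?D c)"
    by (rule sum.subset_diff) (use AB fin in auto)
  also have "(\<Sum>c\<in>A \<union> B. faces ?D c) = (\<Sum>c\<in>A. faces ?D c) + (\<Sum>c\<in>B. faces ?D c)"
    by (rule sum.union_disjoint) (use AB in \<open>auto simp: A_def B_def\<close>)
  finally have split: "(\<Sum>c\<in>?D. faces ?D c)
     = (\<Sum>c\<in>?D - (A \<union> B). faces ?D c) + ((\<Sum>c\<in>A. faces ?D c) + (\<Sum>c\<in>B. faces ?D c))" .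
  have rest: "even (\<Sum>c\<in>?D - (A \<union> B). faces ?D c)"
  proof (rule dvd_sum)
    fix c assume c: "c \<in> ?D - (A \<union> B)"
    then have "c \<in> ?D" "Suc c \<noteq> i" "Suc c \<noteq> q + m + j"
      using ij by (auto simp: A_def B_def cell_def split: if_splits)
    then show "even (faces ?D c)" using ij by (intro faces_other) auto
  qed
  have a: "even ((\<Sum>c\<in>A. faces ?D c) + (if i > 0 then j * full_count (i - 1) j else 0))"
    using faces_last_direction[of i j] ij by (simp add: A_def)
  have b: "(\<Sum>c\<in>B. faces ?D c) = (if j > 0 then full_count i (j - 1) else 0)"
    using faces_last_coefficient[of i j] ij by (simp add: B_def)
  have "even (F + X + Y)" if "even (F + S)" "S = R + (X' + Y)" "even R" "even (X' + X)" for F S R X X' Y :: nat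
    using that by presburger
  from this[OF bd split[unfolded b] rest a] show ?thesis .
qed

lemma full_count_Stirling:
  "i \<le> q + m \<Longrightarrow> j \<le> k \<Longrightarrow> even (full_count i j) \<longleftrightarrow> even (Stirling (i + j) j)"
proof (induction "i + j" arbitrary: i j rule: less_induct)
  case less
  show ?case
  proof (cases "i + j = 0")
    case True
    \<comment> \<open>At a single vertex exactly one of the two starting signs counts, so the number
      is 1.\<close>
    then show ?thesis by (simp add: full_count_def cell_def alternating_count_empty)
  next
    case False
    have rec: "even (full_count i j + (if i > 0 then j * full_count (i - 1) j else 0)
      + (if j > 0 then full_count i (j - 1) else 0))"
      using full_count_recurrence[of i j] less.prems False by simp
    have I: "even (full_count (i - 1) j) \<longleftrightarrow> even (Stirling (i - 1 + j) j)" if "i > 0"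
      using less.hyps[of "i - 1" j] less.prems that by simp
    have J: "even (full_count i (j - 1)) \<longleftrightarrow> even (Stirling (i + (j - 1)) (j - 1))" if "j > 0"
      using less.hyps[of i "j - 1"] less.prems that by simp
    show ?thesis
    proof (cases j)
      case 0
      then obtain i' where "i = Suc i'" using False by (cases i) auto
      then show ?thesis using rec 0 by simp
    next
      case (Suc j')
      then have "Stirling (i + j) j = j * Stirling (i + j') j + Stirling (i + j') j'" by simp
      \<comment> \<open>For \<open>i = 0\<close> the recurrence has no direction term, in agreement
        with this value.\<close>
      moreover have "Stirling j' j = 0" using Suc by simp
      ultimately show ?thesis using rec I J Suc by (cases "i = 0") auto
    qed
  qed
qed

lemma full_count_top: "full_count (q + m) k = 0"
proof -
  have c: "cell (q + m) k = {..<n}" using n by (auto simp: cell_def)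
  have "cnt s {..<n} (\<lambda>_. 0) = 0" for s
    by (rule alternating_count_top[OF no_edge]) (use max_label_index(1)[OF n(2)] in auto)
  then show ?thesis by (simp add: full_count_def c)
qed

lemma even_Stirling: "even (Stirling n k)"
  using full_count_Stirling[of "q + m" k] full_count_top n by simp

end
end

section \<open>From grid edges to a zero\<close>

lemma grid_edge:
  assumes "odd (Stirling n k)" "even K" "K > 0"
  shows "\<exists>y\<in>grid_box K {..<n} (\<lambda>_. 0). \<exists>z\<in>grid_box K {..<n} (\<lambda>_. 0). (\<forall>i. \<bar>y i - z i\<bar> \<le> 1) \<and>
    (\<exists>i\<in>{1..n}. value_at (grid_angle K y) i * value_at (grid_angle K z) i \<le> 0 \<and>
      (\<forall>l\<in>{1..n}. \<bar>value_at (grid_angle K y) l\<bar> \<le> \<bar>value_at (grid_angle K y) i\<bar>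
         \<and> \<bar>value_at (grid_angle K z) l\<bar> \<le> \<bar>value_at (grid_angle K z) i\<bar>))"
proof (cases "\<forall>y\<in>grid_box K {..<n} (\<lambda>_. 0). \<exists>l\<in>{1..n}. value_at (grid_angle K y) l \<noteq> 0")
  case True
  then have "\<not> no_opposite_edge K (\<lambda>y. max_label n (value_at (grid_angle K y))) {..<n} (\<lambda>_. 0)"
    using even_Stirling[OF assms(2,3)] assms(1) by blast
  then obtain y z where yz: "y \<in> grid_box K {..<n} (\<lambda>_. 0)" "z \<in> grid_box K {..<n} (\<lambda>_. 0)" "\<forall>i. \<bar>y i - z i\<bar> \<le> 1"
    "max_label n (value_at (grid_angle K y)) = opposite (max_label n (value_at (grid_angle K z)))"
    unfolding no_opposite_edge_def by blast
  from max_label_opposite[OF n(2) yz(4)] True yz show ?thesis by blast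
next
  case False
  then obtain y where "y \<in> grid_box K {..<n} (\<lambda>_. 0)" "\<And>l. l \<in> {1..n} \<Longrightarrow> value_at (grid_angle K y) l = 0" by blast
  \<comment> \<open>A zero at a grid point serves as a degenerate edge, with
    \<open>z = y\<close>.\<close>
  then show ?thesis using n(2) by (intro bexI[of _ y] conjI bexI[of _ 1]) auto
qed

text \<open>Along a subsequence the index of the largest value is constant and both ends of the
  edges converge to one point. There the square of this value is a limit of nonpositive products, so
  it is 0, and it bounds all the other values.\<close>

lemma common_zero:
  assumes "odd (Stirling n k)"
    and cont: "\<And>l. l \<in> {1..n} \<Longrightarrow> continuous_on UNIV (\<lambda>t. value_at t l)"
  shows "\<exists>t. \<forall>l\<in>{1..n}. value_at t l = 0"
proof -
  define K where "K r = 2 * int (Suc r)" for r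
  have K: "even (K r)" "K r > 0" for r by (auto simp: K_def)
  have "\<forall>r. \<exists>p. fst p \<in> grid_box (K r) {..<n} (\<lambda>_. 0) \<and> fst (snd p) \<in> grid_box (K r) {..<n} (\<lambda>_. 0) \<and>
    (\<forall>i. \<bar>fst p i - fst (snd p) i\<bar> \<le> 1) \<and> snd (snd p) \<in> {1..n} \<and>
    value_at (grid_angle (K r) (fst p)) (snd (snd p)) * value_at (grid_angle (K r) (fst (snd p))) (snd (snd p)) \<le> 0 \<and>
      (\<forall>l\<in>{1..n}. \<bar>value_at (grid_angle (K r) (fst p)) l\<bar> \<le> \<bar>value_at (grid_angle (K r) (fst p)) (snd (snd p))\<bar>)"
  proof
    fix r
    from grid_edge[OF assms(1) K, of r] obtain y z i where
      "y \<in> grid_box (K r) {..<n} (\<lambda>_. 0)" "z \<in> grid_box (K r) {..<n} (\<lambda>_. 0)" "\<forall>i. \<bar>y i - z i\<bar> \<le> 1"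
      "i \<in> {1..n}" "value_at (grid_angle (K r) y) i * value_at (grid_angle (K r) z) i \<le> 0"
      "\<forall>l\<in>{1..n}. \<bar>value_at (grid_angle (K r) y) l\<bar> \<le> \<bar>value_at (grid_angle (K r) y) i\<bar>"
      by blast
    then show "\<exists>p. fst p \<in> grid_box (K r) {..<n} (\<lambda>_. 0) \<and> fst (snd p) \<in> grid_box (K r) {..<n} (\<lambda>_. 0) \<and>
    (\<forall>i. \<bar>fst p i - fst (snd p) i\<bar> \<le> 1) \<and> snd (snd p) \<in> {1..n} \<and>
    value_at (grid_angle (K r) (fst p)) (snd (snd p)) * value_at (grid_angle (K r) (fst (snd p))) (snd (snd p)) \<le> 0 \<and>
      (\<forall>l\<in>{1..n}. \<bar>value_at (grid_angle (K r) (fst p)) l\<bar> \<le> \<bar>value_at (grid_angle (K r) (fst p)) (snd (snd p))\<bar>)"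
      by (intro exI[of _ "(y, z, i)"]) simp
  qed
  from choice[OF this] obtain p where p: "\<forall>r. fst (p r) \<in> grid_box (K r) {..<n} (\<lambda>_. 0) \<and> fst (snd (p r)) \<in> grid_box (K r) {..<n} (\<lambda>_. 0) \<and>
    (\<forall>i. \<bar>fst (p r) i - fst (snd (p r)) i\<bar> \<le> 1) \<and> snd (snd (p r)) \<in> {1..n} \<and>
    value_at (grid_angle (K r) (fst (p r))) (snd (snd (p r))) * value_at (grid_angle (K r) (fst (snd (p r)))) (snd (snd (p r))) \<le> 0 \<and>
      (\<forall>l\<in>{1..n}. \<bar>value_at (grid_angle (K r) (fst (p r))) l\<bar> \<le> \<bar>value_at (grid_angle (K r) (fst (p r))) (snd (snd (p r)))\<bar>)"
    by blast
  define s where "s r = grid_angle (K r) (fst (p r))" for r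
  define t where "t r = grid_angle (K r) (fst (snd (p r)))" for r
  define ix where "ix r = snd (snd (p r))" for r
  have ix: "ix r \<in> {1..n}" "value_at (s r) (ix r) * value_at (t r) (ix r) \<le> 0"
    "l \<in> {1..n} \<Longrightarrow> \<bar>value_at (s r) l\<bar> \<le> \<bar>value_at (s r) (ix r)\<bar>" for r l
    using p by (auto simp: s_def t_def ix_def)
  \<comment> \<open>Coordinates from \<open>n\<close> on stay 0, so all grid angles lie in a product
    of compact sets, compact although the index set is infinite.\<close>
  define B where "B = PiE UNIV (\<lambda>i. if i < n then {0..pi} else {0 :: real})"
  have "compactin (product_topology (\<lambda>_. euclidean) UNIV) B"
    unfolding B_def by (subst compactin_PiE) auto
  then have "compact B" by (simp add: euclidean_product_topology)
  then have "seq_compact B" by (rule compact_imp_seq_compact)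
  moreover have "\<forall>r. s r \<in> B"
  proof
    fix r
    have y: "fst (p r) \<in> grid_box (K r) {..<n} (\<lambda>_. 0)" using p by blast
    have "0 \<le> pi * real_of_int (fst (p r) i) / real_of_int (K r) \<and> pi * real_of_int (fst (p r) i) / real_of_int (K r) \<le> pi"
      if "i < n" for i
      using grid_boxD(1,2)[OF y, of i] that K(2)[of r] by (simp add: divide_le_eq mult_left_mono)
    then show "s r \<in> B"
      using grid_boxD(3)[OF y] by (auto simp: B_def s_def grid_angle_def)
  qed
  ultimately obtain x h where x: "x \<in> B" "strict_mono h" "(s \<circ> h) \<longlonglongrightarrow> x"
    by (rule seq_compactE)
  obtain i where i: "i \<in> {1..n}" "infinite {r. ix (h r) = i}"
  proof -
    have "\<exists>i\<in>{1..n}. infinite {a \<in> (UNIV :: nat set). ix (h a) = i}"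
      using pigeonhole_infinite_rel[of "UNIV :: nat set" "{1..n}" "\<lambda>r i. ix (h r) = i"] ix(1) by auto
    then show ?thesis using that by auto
  qed
  obtain g :: "nat \<Rightarrow> nat" where "strict_mono g" "\<forall>r. g r \<in> {r. ix (h r) = i}"
    using infinite_enumerate[OF i(2)] by blast
  then have g: "strict_mono g" "\<And>r. ix (h (g r)) = i" by auto
  define e where "e = (\<lambda>r. h (g r))"
  have e: "strict_mono e" using strict_mono_o[OF x(2) g(1)] by (simp add: e_def o_def)
  have s_lim: "(\<lambda>r. s (e r)) \<longlonglongrightarrow> x"
    using LIMSEQ_subseq_LIMSEQ[OF x(3) g(1)] by (simp add: o_def e_def)
  have t_lim: "(\<lambda>r. t (e r)) \<longlonglongrightarrow> x"
    unfolding tendsto_coordinatewise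
  proof
    fix c
    have "\<bar>t r c - s r c\<bar> \<le> pi / K r" for r
    proof -
      have "\<bar>fst (snd (p r)) c - fst (p r) c\<bar> \<le> 1" using p by (simp add: abs_minus_commute)
      then have "\<bar>real_of_int (fst (snd (p r)) c) - real_of_int (fst (p r) c)\<bar> \<le> 1" by linarith
      then have "pi * \<bar>real_of_int (fst (snd (p r)) c) - real_of_int (fst (p r) c)\<bar> / K r \<le> pi / K r"
        using K(2)[of r] by (intro divide_right_mono mult_left_le) auto
      moreover have "t r c - s r c = pi * (real_of_int (fst (snd (p r)) c) - real_of_int (fst (p r) c)) / K r"
        by (simp add: s_def t_def grid_angle_def right_diff_distrib diff_divide_distrib)
      ultimately show ?thesis using K(2)[of r] by (simp add: abs_mult)
    qed
    moreover have "(\<lambda>r. pi / K r) \<longlonglongrightarrow> 0" unfolding K_def by real_asymp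
    ultimately have "(\<lambda>r. t r c - s r c) \<longlonglongrightarrow> 0"
      by (intro Lim_null_comparison[of "\<lambda>r. t r c - s r c" "\<lambda>r. pi / K r"]) auto
    from LIMSEQ_subseq_LIMSEQ[OF this e] have "(\<lambda>r. t (e r) c - s (e r) c) \<longlonglongrightarrow> 0" by (simp add: o_def)
    moreover have "(\<lambda>r. s (e r) c) \<longlonglongrightarrow> x c" using s_lim unfolding tendsto_coordinatewise by blast
    ultimately have "(\<lambda>r. (t (e r) c - s (e r) c) + s (e r) c) \<longlonglongrightarrow> 0 + x c" by (rule tendsto_add)
    then show "(\<lambda>r. t (e r) c) \<longlonglongrightarrow> x c" by simp
  qed
  have F: "(\<lambda>r. value_at (f r) l) \<longlonglongrightarrow> value_at x l" if "f \<longlonglongrightarrow> x" "l \<in> {1..n}" for f l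
    by (rule continuous_on_tendsto_compose[OF cont[OF that(2)] that(1)]) auto
  have "value_at x i * value_at x i \<le> 0"
    by (rule LIMSEQ_le_const2[OF tendsto_mult[OF F[OF s_lim i(1)] F[OF t_lim i(1)]]])
       (use ix(2) g(2) e_def in metis)
  then have zero: "value_at x i = 0" by (auto simp: mult_le_0_iff)
  have "\<bar>value_at x l\<bar> \<le> \<bar>value_at x i\<bar>" if "l \<in> {1..n}" for l
    by (rule LIMSEQ_le[OF tendsto_rabs[OF F[OF s_lim that]] tendsto_rabs[OF F[OF s_lim i(1)]]])
       (use ix(3)[OF that] g(2) e_def in metis)
  then show ?thesis using zero by (intro exI[of _ x]) auto
qed

end

subsection \<open>Orthogonal projections and the Grassmann manifold\<close>

definition orth_proj :: "'a::euclidean_space set \<Rightarrow> 'a \<Rightarrow> 'a" where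
  "orth_proj V x = (SOME y. y \<in> V \<and> (\<forall>z\<in>V. (x - y) \<bullet> z = 0))"

lemma orth_proj:
  assumes "subspace V"
  shows "orth_proj V x \<in> V" "z \<in> V \<Longrightarrow> (x - orth_proj V x) \<bullet> z = 0"
proof -
  obtain y u where "y \<in> span V" "\<And>w. w \<in> span V \<Longrightarrow> orthogonal u w" "x = y + u"
    using orthogonal_subspace_decomp_exists[of V x] by metis
  then have "\<exists>y. y \<in> V \<and> (\<forall>z\<in>V. (x - y) \<bullet> z = 0)"
    using assms by (intro exI[of _ y]) (auto simp: orthogonal_def span_eq_iff[THEN iffD2])
  from someI_ex[OF this]
  show "orth_proj V x \<in> V" "z \<in> V \<Longrightarrow> (x - orth_proj V x) \<bullet> z = 0"
    by (auto simp: orth_proj_def)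
qed

lemma orth_proj_unique:
  assumes "subspace V" "y \<in> V" "\<And>z. z \<in> V \<Longrightarrow> (x - y) \<bullet> z = 0"
  shows "orth_proj V x = y"
proof -
  let ?u = "orth_proj V x - y"
  have u: "?u \<in> V" using orth_proj(1)[OF assms(1)] assms(1,2) by (simp add: subspace_diff)
  have "?u \<bullet> ?u = (x - y) \<bullet> ?u - (x - orth_proj V x) \<bullet> ?u" by (simp add: inner_diff_left)
  then show ?thesis using assms(3)[OF u] orth_proj(2)[OF assms(1) u] by simp
qed

lemma orth_proj_id: "subspace V \<Longrightarrow> x \<in> V \<Longrightarrow> orth_proj V x = x"
  by (rule orth_proj_unique) auto

lemma linear_orth_proj:
  assumes "subspace V"
  shows "linear (orth_proj V)"
proof (rule linearI)
  fix x y :: 'a and r :: real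
  show "orth_proj V (x + y) = orth_proj V x + orth_proj V y"
  proof (rule orth_proj_unique[OF assms subspace_add[OF assms orth_proj(1)[OF assms] orth_proj(1)[OF assms]]])
    fix z assume "z \<in> V"
    have "(x + y - (orth_proj V x + orth_proj V y)) \<bullet> z = (x - orth_proj V x) \<bullet> z + (y - orth_proj V y) \<bullet> z"
      by (simp add: inner_diff_left inner_add_left)
    then show "(x + y - (orth_proj V x + orth_proj V y)) \<bullet> z = 0"
      using orth_proj(2)[OF assms \<open>z \<in> V\<close>] by simp
  qed
  show "orth_proj V (r *\<^sub>R x) = r *\<^sub>R orth_proj V x"
  proof (rule orth_proj_unique[OF assms subspace_scale[OF assms orth_proj(1)[OF assms]]])
    fix z assume "z \<in> V"
    have "(r *\<^sub>R x - r *\<^sub>R orth_proj V x) \<bullet> z = r * ((x - orth_proj V x) \<bullet> z)"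
      by (simp add: inner_diff_left right_diff_distrib)
    then show "(r *\<^sub>R x - r *\<^sub>R orth_proj V x) \<bullet> z = 0"
      using orth_proj(2)[OF assms \<open>z \<in> V\<close>] by simp
  qed
qed

lemma norm_orth_proj_le:
  assumes "subspace V"
  shows "norm (orth_proj V x) \<le> norm x"
proof -
  have "x \<bullet> orth_proj V x = orth_proj V x \<bullet> orth_proj V x"
    using orth_proj(2)[OF assms orth_proj(1)[OF assms], of x x] by (simp add: inner_diff_left)
  then have "norm (orth_proj V x) * norm (orth_proj V x) \<le> norm x * norm (orth_proj V x)"
    by (metis norm_cauchy_schwarz power2_eq_square power2_norm_eq_inner)
  then show ?thesis
    by (cases "orth_proj V x = 0") auto
qed

lemma continuous_on_orth_proj: "subspace V \<Longrightarrow> continuous_on S (orth_proj V)"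
  by (simp add: linear_orth_proj linear_continuous_on linear_linear)

section \<open>Frames and the topology of the Grassmann manifold\<close>

definition orthonormal_frame :: "nat \<Rightarrow> (nat \<Rightarrow> 'a::euclidean_space) \<Rightarrow> bool" where
  "orthonormal_frame d e \<longleftrightarrow> (\<forall>i<d. \<forall>j<d. e i \<bullet> e j = (if i = j then 1 else 0))"

lemma orthonormal_frameD:
  "orthonormal_frame d e \<Longrightarrow> i < d \<Longrightarrow> j < d \<Longrightarrow> e i \<bullet> e j = (if i = j then 1 else 0)"
  by (simp add: orthonormal_frame_def)

lemma orthonormal_frame_independent:
  assumes "orthonormal_frame d e"
  shows "independent (e ` {..<d})" "inj_on e {..<d}"
proof -
  show inj: "inj_on e {..<d}"
    by (rule inj_onI) (metis assms lessThan_iff orthonormal_frameD zero_neq_one)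
  show "independent (e ` {..<d})"
  proof (rule pairwise_orthogonal_independent)
    show "pairwise orthogonal (e ` {..<d})"
      using assms by (auto simp: pairwise_def orthogonal_def orthonormal_frameD)
    show "0 \<notin> e ` {..<d}"
      using orthonormal_frameD[OF assms] by (metis imageE inner_zero_left lessThan_iff zero_neq_one)
  qed
qed

lemma span_frame_grassmannian: "orthonormal_frame d e \<Longrightarrow> span (e ` {..<d}) \<in> grassmannian d"
  using orthonormal_frame_independent[of d e]
  by (simp add: grassmannian_def dim_span dim_eq_card_independent card_image)

lemma orth_proj_frame:
  assumes "orthonormal_frame d e"
  shows "orth_proj (span (e ` {..<d})) x = (\<Sum>i<d. (x \<bullet> e i) *\<^sub>R e i)"
proof (rule orth_proj_unique)
  show "(\<Sum>i<d. (x \<bullet> e i) *\<^sub>R e i) \<in> span (e ` {..<d})"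
    by (intro span_sum span_scale span_base) auto
  fix z assume "z \<in> span (e ` {..<d})"
  then show "(x - (\<Sum>i<d. (x \<bullet> e i) *\<^sub>R e i)) \<bullet> z = 0"
  proof (induction rule: span_induct_alt)
    case (step c u y)
    then obtain j where j: "j < d" "u = e j" by auto
    have "(\<Sum>i<d. (x \<bullet> e i) *\<^sub>R e i) \<bullet> e j = (\<Sum>i<d. if i = j then x \<bullet> e i else 0)"
      unfolding inner_sum_left using assms j by (intro sum.cong) (auto simp: orthonormal_frameD)
    then have "(x - (\<Sum>i<d. (x \<bullet> e i) *\<^sub>R e i)) \<bullet> u = 0"
      using j by (simp add: inner_diff_left)
    then show ?case using step by (simp add: inner_add_right)
  qed simp
qed simp

lemma stiefel_topspace:
  "e \<in> topspace (stiefel_topology d) \<Longrightarrow> orthonormal_frame d e"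
  by (simp add: stiefel_topology_def orthonormal_frame_def)

lemma topspace_grassmannian:
  "topspace (grassmannian_topology d) = (grassmannian d :: 'a::euclidean_space set set)"
proof
  show "topspace (grassmannian_topology d) \<subseteq> (grassmannian d :: 'a set set)"
    using openin_grassmannian_topology openin_topspace by blast
  have "{e \<in> topspace (stiefel_topology d). span (e ` {..<d}) \<in> (grassmannian d :: 'a set set)}
      = topspace (stiefel_topology d)"
    using stiefel_topspace span_frame_grassmannian by blast
  then have "openin (grassmannian_topology d) (grassmannian d :: 'a set set)"
    by (simp add: openin_grassmannian_topology)
  then show "(grassmannian d :: 'a set set) \<subseteq> topspace (grassmannian_topology d)"
    by (rule openin_subset)
qed

text \<open>The topology is a quotient of the space of frames, so continuity may be tested on
  frames, where the projection is the explicit sum of \<open>orth_proj_frame\<close>.\<close>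

lemma continuous_map_orth_proj:
  "continuous_map (grassmannian_topology d) euclidean (\<lambda>V. orth_proj V x)"
proof -
  have cont: "continuous_map (stiefel_topology d) euclidean (\<lambda>e. \<Sum>i<d. (x \<bullet> e i) *\<^sub>R e i)"
  proof (intro continuous_map_sum)
    fix i assume i: "i \<in> {..<d}"
    have "continuous_map (stiefel_topology d) euclidean (\<lambda>e. e i)"
      unfolding stiefel_topology_def
      using i by (intro continuous_map_from_subtopology continuous_map_product_projection)
    moreover have "continuous_map euclidean euclidean (\<lambda>u. (x \<bullet> u) *\<^sub>R u)"
      unfolding continuous_map_iff_continuous2 by (intro continuous_intros)
    ultimately show "continuous_map (stiefel_topology d) euclidean (\<lambda>e. (x \<bullet> e i) *\<^sub>R e i)"
      by (rule continuous_map_compose[unfolded o_def])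
  qed simp
  show ?thesis
    unfolding continuous_map_def
  proof (intro conjI allI impI)
    fix U :: "'a set" assume "openin euclidean U"
    then have "openin (stiefel_topology d) {e \<in> topspace (stiefel_topology d). (\<Sum>i<d. (x \<bullet> e i) *\<^sub>R e i) \<in> U}"
      using cont by (rule openin_continuous_map_preimage[rotated])
    also have "{e \<in> topspace (stiefel_topology d). (\<Sum>i<d. (x \<bullet> e i) *\<^sub>R e i) \<in> U}
      = {e \<in> topspace (stiefel_topology d). span (e ` {..<d}) \<in> {V \<in> grassmannian d. orth_proj V x \<in> U}}"
      using stiefel_topspace span_frame_grassmannian orth_proj_frame by fastforce
    finally show "openin (grassmannian_topology d) {V \<in> topspace (grassmannian_topology d). orth_proj V x \<in> U}"
      by (simp add: openin_grassmannian_topology topspace_grassmannian)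
  qed simp
qed

text \<open>Dominates the operator norm of the difference of the two projections
  (\<open>norm_orth_proj_diff\<close>), while its continuity in \<open>W\<close> is immediate
  because it is a finite sum.\<close>

definition gap :: "'a::euclidean_space set \<Rightarrow> 'a set \<Rightarrow> real" where
  "gap V W = (\<Sum>b\<in>Basis. norm (orth_proj W b - orth_proj V b))"

lemma gap_self: "gap V V = 0"
  by (simp add: gap_def)

lemma gap_nonneg: "gap V W \<ge> 0"
  by (simp add: gap_def sum_nonneg)

lemma continuous_map_gap: "continuous_map (grassmannian_topology d) euclidean (gap V)"
  unfolding gap_def
  by (intro continuous_intros continuous_map_orth_proj) auto

lemma norm_orth_proj_diff:
  assumes "subspace V" "subspace W"
  shows "norm (orth_proj W x - orth_proj V x) \<le> gap V W * norm x"
proof -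
  interpret V: linear "orth_proj V" by (rule linear_orth_proj[OF assms(1)])
  interpret W: linear "orth_proj W" by (rule linear_orth_proj[OF assms(2)])
  have "orth_proj W x - orth_proj V x = (\<Sum>b\<in>Basis. (x \<bullet> b) *\<^sub>R (orth_proj W b - orth_proj V b))"
    using euclidean_representation[of x] 
    by (simp add: scaleR_diff_right sum_subtractf flip: V.scaleR V.sum W.scaleR W.sum)
  also have "norm \<dots> \<le> (\<Sum>b\<in>Basis. norm x * norm (orth_proj W b - orth_proj V b))"
    by (intro sum_norm_le) (simp add: mult_right_mono Basis_le_norm)
  finally show ?thesis by (simp add: gap_def sum_distrib_left mult.commute)
qed

lemma gap_norm_le:
  assumes "subspace V" "subspace W" "gap V W \<le> 1 / 2" "u \<in> W"
  shows "norm u \<le> 2 * norm (orth_proj V u)"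
proof -
  have "norm (u - orth_proj V u) \<le> gap V W * norm u"
    using norm_orth_proj_diff[OF assms(1,2), of u] orth_proj_id[OF assms(2,4)] by simp
  also have "\<dots> \<le> 1 / 2 * norm u" using assms(3) by (intro mult_right_mono) auto
  finally show ?thesis using norm_triangle_ineq2[of u "orth_proj V u"] by linarith
qed

text \<open>With the bound 1/2, projecting to \<open>V\<close> shrinks vectors of \<open>W\<close>
  at most by the factor 2 (\<open>gap_norm_le\<close>), so for \<open>V\<close> of dimension
  \<open>d\<close> the projection from \<open>W\<close> to \<open>V\<close> is an
  isomorphism.\<close>

definition chart :: "nat \<Rightarrow> 'a::euclidean_space set \<Rightarrow> 'a set set" where
  "chart d V = {W \<in> grassmannian d. gap V W < 1 / 2}"

lemma openin_chart: "openin (grassmannian_topology d) (chart d V)"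
proof -
  have "openin (grassmannian_topology d) {W \<in> topspace (grassmannian_topology d). gap V W \<in> {..<1 / 2}}"
    by (rule openin_continuous_map_preimage[OF continuous_map_gap]) auto
  then show ?thesis by (simp add: chart_def topspace_grassmannian)
qed

lemma orth_proj_image_chart:
  assumes "V \<in> grassmannian d" "W \<in> chart d V"
  shows "orth_proj V ` W = V" "inj_on (orth_proj V) W"
proof -
  have sub: "subspace V" "subspace W" "gap V W \<le> 1 / 2" "dim V = d" "dim W = d"
    using assms by (auto simp: grassmannian_def chart_def)
  have zero: "u = 0" if "u \<in> W" "orth_proj V u = 0" for u
    using gap_norm_le[OF sub(1-3) that(1)] that(2) by simp
  have lin: "linear (orth_proj V)" by (rule linear_orth_proj[OF sub(1)])
  show inj: "inj_on (orth_proj V) W"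
    using zero linear_inj_on_iff_eq_0[OF lin sub(2)] sub(2) by blast
  have "dim (orth_proj V ` W) = dim W"
    by (rule dim_image_eq) (use lin inj sub(2) in \<open>auto simp: span_eq_iff[THEN iffD2]\<close>)
  then show "orth_proj V ` W = V"
    using sub orth_proj(1)[OF sub(1)]
    by (intro subspace_dim_equal) (auto simp: linear_subspace_image[OF lin])
qed

lemma continuous_map_euclideanI:
  fixes f :: "'a \<Rightarrow> 'b::metric_space"
  assumes "\<And>x \<epsilon>. x \<in> topspace X \<Longrightarrow> \<epsilon> > 0 \<Longrightarrow> \<exists>U. openin X U \<and> x \<in> U \<and> (\<forall>y\<in>U. f y \<in> ball (f x) \<epsilon>)"
  shows "continuous_map X euclidean f"
  using assms Met_TC.continuous_map_to_metric[of X f] by simp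

text \<open>One trivialization around each \<open>V\<close> is enough to extract what is needed from
  the topology of the mass bundle. Continuity of the inverse rests on the lower bound
  \<open>gap_norm_le\<close>, which is uniform over the chart.\<close>

lemma local_trivialization_chart:
  assumes V: "V \<in> grassmannian d"
  shows "local_trivialization d (chart d V) V (\<lambda>_. orth_proj V)"
proof -
  let ?Gr = "grassmannian_topology d :: 'a set topology" and ?U = "chart d V"
  let ?X = "subtopology (canonical_bundle d) {(W, v). W \<in> ?U}"
  let ?Y = "prod_topology (subtopology ?Gr ?U) (top_of_set V)"
  let ?f = "\<lambda>(W, v). (W, orth_proj V v)"
  define g where "g = (\<lambda>(W, w). (W, inv_into W (orth_proj V) w))"
  have sV: "subspace V" using V by (simp add: grassmannian_def)
  have U: "?U \<subseteq> grassmannian d" by (auto simp: chart_def)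
  have topX: "topspace ?X = {(W, v). W \<in> ?U \<and> v \<in> W}"
    using U by (auto simp: canonical_bundle_def topspace_grassmannian)
  have topY: "topspace ?Y = {(W, w). W \<in> ?U \<and> w \<in> V}"
    using U by (auto simp: topspace_grassmannian)
  have inv: "inv_into W (orth_proj V) w \<in> W" "orth_proj V (inv_into W (orth_proj V) w) = w"
    if "W \<in> ?U" "w \<in> V" for W w
    using orth_proj_image_chart[OF V that(1)] that(2) by (auto intro: inv_into_into f_inv_into_f)
  have X: "?X = subtopology (prod_topology ?Gr euclidean) {(W, v). W \<in> ?U \<and> v \<in> W}"
    using U by (auto simp: canonical_bundle_def subtopology_subtopology intro!: arg_cong2[of _ _ _ _ subtopology])
  have f: "continuous_map ?X ?Y ?f"
    unfolding continuous_map_pairwise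
  proof
    have "continuous_map ?X ?Gr fst"
      unfolding X by (intro continuous_map_from_subtopology continuous_map_fst)
    then have "continuous_map ?X (subtopology ?Gr ?U) fst"
      by (rule continuous_map_into_subtopology) (use topX in auto)
    then show "continuous_map ?X (subtopology ?Gr ?U) (fst \<circ> ?f)" by (simp add: o_def split_def)
    have "continuous_map ?X euclidean snd"
      unfolding X by (intro continuous_map_from_subtopology continuous_map_snd)
    moreover have "continuous_map euclidean euclidean (orth_proj V)"
      unfolding continuous_map_iff_continuous2 by (rule continuous_on_orth_proj[OF sV])
    ultimately have "continuous_map ?X euclidean (orth_proj V \<circ> snd)" by (rule continuous_map_compose)
    then have "continuous_map ?X (top_of_set V) (orth_proj V \<circ> snd)"
      by (rule continuous_map_into_subtopology) (use orth_proj(1)[OF sV] in auto)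
    then show "continuous_map ?X (top_of_set V) (snd \<circ> ?f)" by (simp add: o_def split_def)
  qed
  have g2: "continuous_map ?Y euclidean (snd \<circ> g)"
  proof (rule continuous_map_euclideanI)
    fix p and \<epsilon> :: real assume p: "p \<in> topspace ?Y" and \<epsilon>: "\<epsilon> > 0"
    obtain W1 w1 where p1: "p = (W1, w1)" by (cases p)
    then have W1: "W1 \<in> ?U" "w1 \<in> V" using p topY by auto
    define v1 where "v1 = inv_into W1 (orth_proj V) w1"
    have v1: "v1 \<in> W1" "orth_proj V v1 = w1" using inv[OF W1] by (auto simp: v1_def)
    \<comment> \<open>Below, \<open>norm (v - z) \<le> 2 * norm (w - w1) + 2 * norm (z - v1)\<close>
      for the projection \<open>z\<close> of \<open>v1\<close> to \<open>W\<close>; passing from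
      \<open>z\<close> to \<open>v1\<close> costs a third \<open>norm (z - v1)\<close>.\<close>
    define h where "h = (\<lambda>q. 2 * norm (snd q - w1) + 3 * norm (orth_proj (fst q) v1 - v1))"
    have "continuous_map ?Y euclideanreal h"
      unfolding h_def
    proof (intro continuous_intros)
      have "continuous_map ?Y ?Gr fst"
        by (rule continuous_map_into_fulltopology[OF continuous_map_fst])
      from continuous_map_compose[OF this continuous_map_orth_proj[of d v1]]
      show "continuous_map ?Y euclidean (\<lambda>q. orth_proj (fst q) v1)" by (simp add: o_def)
      show "continuous_map ?Y euclidean snd"
        by (rule continuous_map_into_fulltopology[OF continuous_map_snd])
    qed auto
    then have op: "openin ?Y {q \<in> topspace ?Y. h q \<in> {..<\<epsilon>}}"
      by (rule openin_continuous_map_preimage) auto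
    have "h p < \<epsilon>"
      using \<epsilon> orth_proj_id[of W1 v1] v1 W1 U by (auto simp: h_def p1 grassmannian_def)
    moreover have "snd (g q) \<in> ball (snd (g p)) \<epsilon>" if q: "q \<in> topspace ?Y" "h q < \<epsilon>" for q
    proof -
      obtain W w where qq: "q = (W, w)" by (cases q)
      then have W: "W \<in> ?U" "w \<in> V" using q topY by auto
      then have sW: "subspace W" "gap V W \<le> 1 / 2" by (auto simp: chart_def grassmannian_def)
      define v where "v = inv_into W (orth_proj V) w"
      have v: "v \<in> W" "orth_proj V v = w" using inv[OF W] by (auto simp: v_def)
      \<comment> \<open>\<open>v1\<close> need not lie in \<open>W\<close>, while the lower bound
        applies to vectors of \<open>W\<close>; hence the comparison with the projection of
        \<open>v1\<close>.\<close>
      define z where "z = orth_proj W v1"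
      have z: "z \<in> W" unfolding z_def by (rule orth_proj(1)[OF sW(1)])
      interpret P: linear "orth_proj V" by (rule linear_orth_proj[OF sV])
      have "norm (v - z) \<le> 2 * norm (orth_proj V (v - z))"
        by (rule gap_norm_le[OF sV sW subspace_diff[OF sW(1) v(1) z]])
      also have "orth_proj V (v - z) = (w - w1) + orth_proj V (v1 - z)"
        by (simp add: P.diff v v1)
      also have "norm \<dots> \<le> norm (w - w1) + norm (v1 - z)"
        using norm_orth_proj_le[OF sV, of "v1 - z"] by (intro norm_triangle_mono) auto
      finally have "norm (v - z) \<le> 2 * norm (w - w1) + 2 * norm (z - v1)"
        by (simp add: norm_minus_commute)
      moreover have "norm (v - v1) \<le> norm (v - z) + norm (z - v1)"
        using norm_triangle_ineq[of "v - z" "z - v1"] by simp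
      ultimately have "norm (v - v1) < \<epsilon>" using q(2) by (simp add: h_def qq z_def)
      then show ?thesis by (simp add: g_def qq p1 v_def v1_def dist_norm norm_minus_commute)
    qed
    ultimately show "\<exists>U. openin ?Y U \<and> p \<in> U \<and> (\<forall>y\<in>U. (snd \<circ> g) y \<in> ball ((snd \<circ> g) p) \<epsilon>)"
      using op p by (intro exI[of _ "{q \<in> topspace ?Y. h q \<in> {..<\<epsilon>}}"]) auto
  qed
  have g: "continuous_map ?Y ?X g"
    unfolding X
  proof (rule continuous_map_into_subtopology)
    have "fst \<circ> g = fst" by (auto simp: g_def)
    then show "continuous_map ?Y (prod_topology ?Gr euclidean) g"
      using g2 by (simp add: continuous_map_pairwise continuous_map_into_fulltopology[OF continuous_map_fst])
    show "g \<in> topspace ?Y \<rightarrow> {(W, v). W \<in> ?U \<and> v \<in> W}"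
      using inv(1) topY by (auto simp: g_def)
  qed
  have "homeomorphic_maps ?X ?Y ?f g"
    unfolding homeomorphic_maps_def topX topY
    using f g inv orth_proj_image_chart[OF V] by (auto simp: g_def)
  then have "homeomorphic_map ?X ?Y ?f"
    using homeomorphic_maps_map by blast
  then show ?thesis
    using V openin_chart linear_orth_proj[OF sV] by (auto simp: local_trivialization_def)
qed

subsection \<open>Mass assignments and sign integrals\<close>

lemma massesD:
  assumes "\<nu> \<in> masses V"
  shows "sets \<nu> = sets (restrict_space borel V)" "space \<nu> = V" "finite_measure \<nu>"
    "absolutely_continuous (lebesgue_subspace V) \<nu>"
proof -
  show s: "sets \<nu> = sets (restrict_space borel V)" and "finite_measure \<nu>"
    "absolutely_continuous (lebesgue_subspace V) \<nu>"
    using assms by (auto simp: masses_def)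
  show "space \<nu> = V" using sets_eq_imp_space_eq[OF s] by (simp add: space_restrict_space)
qed

lemma borel_measurable_mass:
  assumes "\<nu> \<in> masses V" "continuous_on V (f :: _ \<Rightarrow> 'b::topological_space)"
  shows "f \<in> borel_measurable \<nu>"
  using borel_measurable_continuous_on_restrict[OF assms(2)] massesD(1)[OF assms(1)]
  by (simp cong: measurable_cong_sets)

lemma measurable_orth_proj:
  assumes "\<nu> \<in> masses W" "subspace V"
  shows "orth_proj V \<in> measurable \<nu> (restrict_space borel V)"
  by (rule measurable_restrict_space2)
     (use orth_proj(1)[OF assms(2)] borel_measurable_mass[OF assms(1) continuous_on_orth_proj[OF assms(2)]] in auto)

lemma mass_assignment_masses:
  assumes "mass_assignment d \<mu>" "V \<in> grassmannian d"
  shows "\<mu> V \<in> masses V"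
proof -
  have "(V, \<mu> V) \<in> topspace (mass_bundle d)"
    using continuous_map_image_subset_topspace[of _ _ "\<lambda>V. (V, \<mu> V)"] assms topspace_grassmannian[of d]
    unfolding mass_assignment_def by blast
  then show ?thesis unfolding mass_bundle_def topology_generated_by_topspace by auto
qed

lemma distr_orth_proj_self:
  assumes "\<nu> \<in> masses V" "subspace V"
  shows "distr \<nu> (restrict_space borel V) (orth_proj V) = \<nu>"
proof -
  have "distr \<nu> (restrict_space borel V) (orth_proj V) = distr \<nu> (restrict_space borel V) (\<lambda>x. x)"
    using massesD(2)[OF assms(1)] orth_proj_id[OF assms(2)] by (intro distr_cong) auto
  also have "\<dots> = \<nu>" by (rule distr_id2) (simp add: massesD(1)[OF assms(1)])
  finally show ?thesis .
qed

text \<open>Continuity of the section is read in the chart centred at \<open>V\<close>: nearby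
  measures are pushed forward to \<open>V\<close> by the orthogonal projection, which leaves the
  measure on \<open>V\<close> itself unchanged.\<close>

lemma mass_assignment_weakly_continuous:
  fixes g :: "'a::euclidean_space \<Rightarrow> real"
  assumes \<mu>: "mass_assignment d \<mu>" and V: "V \<in> grassmannian d"
    and g: "continuous_on V g" "bounded (g ` V)" and "\<epsilon> > 0"
  obtains N where "openin (grassmannian_topology d) N" "V \<in> N"
    "\<And>W. W \<in> N \<Longrightarrow> \<bar>(\<integral>x. g (orth_proj V x) \<partial>\<mu> W) - (\<integral>x. g x \<partial>\<mu> V)\<bar> < \<epsilon>"
proof -
  let ?I = "\<integral>x. g x \<partial>\<mu> V"
  define O1 where "O1 = {\<nu> \<in> masses V. (\<integral>x. g x \<partial>\<nu>) \<in> ball ?I \<epsilon>}"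
  have "openin (weak_topology V) O1"
    unfolding weak_topology_def O1_def by (rule topology_generated_by_Basis) (use g in blast)
  define S where "S = chart d V \<times> O1"
  have "openin (prod_topology (subtopology (grassmannian_topology d) (chart d V)) (weak_topology V)) S"
    using \<open>openin (weak_topology V) O1\<close> openin_chart[of d V]
    by (simp add: S_def openin_prod_Times_iff openin_open_subtopology)
  then have "openin (mass_bundle d) {(W, \<nu>). W \<in> chart d V \<and> \<nu> \<in> masses W \<and>
       (W, distr \<nu> (restrict_space borel V) (orth_proj V)) \<in> S}"
    unfolding mass_bundle_def using local_trivialization_chart[OF V]
    by (intro topology_generated_by_Basis CollectI exI[of _ "chart d V"] exI[of _ V]
        exI[of _ "\<lambda>_. orth_proj V"] exI[of _ S] conjI refl)
  then have op: "openin (grassmannian_topology d) {W \<in> topspace (grassmannian_topology d). (W, \<mu> W) \<in>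
      {(W, \<nu>). W \<in> chart d V \<and> \<nu> \<in> masses W \<and> (W, distr \<nu> (restrict_space borel V) (orth_proj V)) \<in> S}}"
    using \<mu> unfolding mass_assignment_def by (intro openin_continuous_map_preimage)
  have sV: "subspace V" using V by (simp add: grassmannian_def)
  show ?thesis
  proof (rule that[OF op])
    have "V \<in> chart d V" using V by (simp add: chart_def gap_self)
    then show "V \<in> {W \<in> topspace (grassmannian_topology d). (W, \<mu> W) \<in>
      {(W, \<nu>). W \<in> chart d V \<and> \<nu> \<in> masses W \<and> (W, distr \<nu> (restrict_space borel V) (orth_proj V)) \<in> S}}"
      using mass_assignment_masses[OF \<mu> V] distr_orth_proj_self[OF mass_assignment_masses[OF \<mu> V] sV] V \<open>\<epsilon> > 0\<close>
      by (simp add: topspace_grassmannian S_def O1_def)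
    fix W assume "W \<in> {W \<in> topspace (grassmannian_topology d). (W, \<mu> W) \<in>
      {(W, \<nu>). W \<in> chart d V \<and> \<nu> \<in> masses W \<and> (W, distr \<nu> (restrict_space borel V) (orth_proj V)) \<in> S}}"
    then have W: "\<mu> W \<in> masses W" "(\<integral>x. g x \<partial>distr (\<mu> W) (restrict_space borel V) (orth_proj V)) \<in> ball ?I \<epsilon>"
      by (auto simp: S_def O1_def)
    have "(\<integral>x. g x \<partial>distr (\<mu> W) (restrict_space borel V) (orth_proj V)) = (\<integral>x. g (orth_proj V x) \<partial>\<mu> W)"
      by (intro integral_distr measurable_orth_proj[OF W(1) sV] borel_measurable_continuous_on_restrict g)
    then show "\<bar>(\<integral>x. g (orth_proj V x) \<partial>\<mu> W) - ?I\<bar> < \<epsilon>"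
      using W(2) by (simp add: dist_real_def abs_minus_commute)
  qed
qed

text \<open>By Fubini: some vector \<open>b\<close> of the orthonormal basis is not orthogonal to
  \<open>v\<close>, and once the other coordinates are fixed, the equation leaves at most one value
  for the coordinate along \<open>b\<close>.\<close>

lemma hyperplane_null_set_lebesgue_subspace:
  assumes V: "subspace V" and v: "v \<in> V" "v \<noteq> (0 :: 'a::euclidean_space)"
  shows "{x \<in> V. x \<bullet> v = s} \<in> null_sets (lebesgue_subspace V)"
proof -
  define B where "B = (SOME B. orthonormal_basis_of V B)"
  have "\<exists>B. orthonormal_basis_of V B"
  proof -
    obtain B where "B \<subseteq> V" "pairwise orthogonal B" "\<And>x. x \<in> B \<Longrightarrow> norm x = 1" "independent B"
        "card B = dim V" "span B = V"
      using orthonormal_basis_subspace[OF V] by metis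
    then show ?thesis unfolding orthonormal_basis_of_def by blast
  qed
  then have B: "orthonormal_basis_of V B" unfolding B_def by (rule someI_ex)
  then have "independent B"
    by (intro pairwise_orthogonal_independent) (auto simp: orthonormal_basis_of_def)
  then have fin: "finite B" by (rule independent_bound[THEN conjunct1])
  interpret product_sigma_finite "\<lambda>_ :: 'a. lborel :: real measure" by standard
  let ?P = "Pi\<^sub>M B (\<lambda>_. lborel :: real measure)" and ?f = "\<lambda>x. \<Sum>b\<in>B. x b *\<^sub>R b"
  have leb: "lebesgue_subspace V = distr ?P (restrict_space borel V) ?f"
    by (simp add: lebesgue_subspace_def B_def Let_def)
  have BV: "B \<subseteq> V" "span B = V" using B by (auto simp: orthonormal_basis_of_def)
  have fV: "?f x \<in> V" for x
    unfolding BV(2)[symmetric] by (intro span_sum span_scale span_base) 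
  have f_borel: "?f \<in> measurable ?P borel"
    by (intro borel_measurable_sum borel_measurable_scaleR) (auto intro: measurable_component_singleton)
  then have f: "?f \<in> measurable ?P (restrict_space borel V)"
    using fV by (intro measurable_restrict_space2) auto
  have "(\<lambda>x. x \<bullet> v) \<in> borel_measurable (restrict_space borel V)"
    by (intro borel_measurable_continuous_on_restrict continuous_intros)
  from measurable_sets[OF this, of "{s}"]
  have S: "{x \<in> V. x \<bullet> v = s} \<in> sets (restrict_space borel V)"
    by (simp add: space_restrict_space vimage_def Int_def conj_commute)
  obtain b where b: "b \<in> B" "b \<bullet> v \<noteq> 0"
  proof -
    have "\<not> (\<forall>b\<in>B. b \<bullet> v = 0)"
    proof
      assume "\<forall>b\<in>B. b \<bullet> v = 0"
      moreover have "v \<in> span B" using v BV by simp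
      ultimately have "v \<bullet> v = 0"
        by (metis (no_types, lifting) inner_commute orthogonal_def orthogonal_to_span)
      then show False using v by simp
    qed
    then show ?thesis using that by blast
  qed
  let ?A = "?f -` {x \<in> V. x \<bullet> v = s} \<inter> space ?P"
  have A: "?A \<in> sets ?P" by (rule measurable_sets[OF f S])
  have B_eq: "insert b (B - {b}) = B" using b by auto
  have "emeasure ?P ?A = (\<integral>\<^sup>+ x. indicator ?A x \<partial>Pi\<^sub>M (insert b (B - {b})) (\<lambda>_. lborel))"
    unfolding B_eq using A by simp
  also have "\<dots> = (\<integral>\<^sup>+ x. (\<integral>\<^sup>+ y. indicator ?A (x(b := y)) \<partial>lborel) \<partial>Pi\<^sub>M (B - {b}) (\<lambda>_. lborel))"
    by (rule product_nn_integral_insert) (use fin A b(1) in \<open>simp_all add: insert_absorb\<close>)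
  also have "\<dots> = (\<integral>\<^sup>+ x. 0 \<partial>Pi\<^sub>M (B - {b}) (\<lambda>_. lborel :: real measure))"
  proof (rule nn_integral_cong)
    fix x :: "'a \<Rightarrow> real"
    let ?c = "(s - (\<Sum>a\<in>B - {b}. x a * (a \<bullet> v))) / (b \<bullet> v)"
    have "indicator ?A (x(b := y)) \<le> (indicator {?c} y :: ennreal)" for y
    proof (cases "x(b := y) \<in> ?A")
      case True
      then have "(\<Sum>a\<in>B. (x(b := y)) a * (a \<bullet> v)) = s" by (simp add: inner_sum_left)
      moreover have "(\<Sum>a\<in>B. (x(b := y)) a * (a \<bullet> v)) = y * (b \<bullet> v) + (\<Sum>a\<in>B - {b}. x a * (a \<bullet> v))"
        using fin b by (subst sum.remove[of B b]) auto
      ultimately have "y = ?c" using b by (simp add: field_simps)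
      then have "indicator {?c} y = (1 :: ennreal)" by simp
      then show ?thesis by (simp add: indicator_def)
    qed simp
    then have "(\<integral>\<^sup>+ y. indicator ?A (x(b := y)) \<partial>lborel) \<le> (\<integral>\<^sup>+ y. indicator {?c} y \<partial>lborel)"
      by (rule nn_integral_mono)
    then show "(\<integral>\<^sup>+ y. indicator ?A (x(b := y)) \<partial>lborel) = 0" by simp
  qed
  finally have "emeasure ?P ?A = 0" by simp
  then have "emeasure (lebesgue_subspace V) {x \<in> V. x \<bullet> v = s} = 0"
    unfolding leb by (subst emeasure_distr[OF f S])
  then show ?thesis using S unfolding leb by (simp add: null_sets_def)
qed

lemma hyperplane_null_set:
  assumes "\<nu> \<in> masses V" "subspace V" "v \<in> V" "v \<noteq> 0"
  shows "{x \<in> V. x \<bullet> v = s} \<in> null_sets \<nu>"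
  using massesD(4)[OF assms(1)] hyperplane_null_set_lebesgue_subspace[OF assms(2-4)]
  by (auto simp: absolutely_continuous_def)

lemma AE_polynomial_nonzero:
  assumes "\<nu> \<in> masses V" "subspace V" "v \<in> V" "v \<noteq> 0" "p \<noteq> (0 :: real poly)"
  shows "AE x in \<nu>. poly p (x \<bullet> v) \<noteq> 0"
proof -
  have "AE x in \<nu>. \<forall>s\<in>{s. poly p s = 0}. x \<bullet> v \<noteq> s"
  proof (rule AE_finite_allI[OF poly_roots_finite[OF assms(5)]])
    fix s
    show "AE x in \<nu>. x \<bullet> v \<noteq> s"
      by (rule AE_I'[OF hyperplane_null_set[OF assms(1-4), of s]]) (use massesD(2)[OF assms(1)] in auto)
  qed
  then show ?thesis by eventually_elim auto
qed

section \<open>Signs of polynomials and their continuous approximation\<close>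

definition polysum :: "nat \<Rightarrow> (nat \<Rightarrow> real) \<Rightarrow> real \<Rightarrow> real" where
  "polysum k c s = (\<Sum>j\<le>k. c j * s ^ j)"

lemma polysum_poly: "polysum k c s = poly (\<Sum>j\<le>k. monom (c j) j) s"
  by (simp add: polysum_def poly_sum poly_monom)

lemma polysum_poly_nonzero:
  assumes "j \<le> k" "c j \<noteq> 0"
  shows "(\<Sum>j\<le>k. monom (c j) j) \<noteq> 0"
proof -
  have "coeff (\<Sum>j\<le>k. monom (c j) j) j = c j"
    using assms(1) by (simp add: coeff_sum)
  then show ?thesis using assms(2) by (metis coeff_0)
qed

lemma continuous_on_polysum:
  "continuous_on S f \<Longrightarrow> continuous_on S (\<lambda>x. polysum k c (f x))"
  unfolding polysum_def by (intro continuous_intros)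

lemma power_diff_bound:
  fixes s r :: real
  assumes "\<bar>s\<bar> \<le> M" "\<bar>r\<bar> \<le> M" "M \<ge> 1"
  shows "\<bar>s ^ j - r ^ j\<bar> \<le> real j * M ^ j * \<bar>s - r\<bar>"
proof (induction j)
  case (Suc j)
  have "s ^ Suc j - r ^ Suc j = s * (s ^ j - r ^ j) + (s - r) * r ^ j" by (simp add: algebra_simps)
  also have "\<bar>\<dots>\<bar> \<le> \<bar>s\<bar> * \<bar>s ^ j - r ^ j\<bar> + \<bar>s - r\<bar> * \<bar>r\<bar> ^ j"
    by (metis abs_mult abs_triangle_ineq power_abs)
  also have "\<dots> \<le> M * (real j * M ^ j * \<bar>s - r\<bar>) + \<bar>s - r\<bar> * M ^ j"
    using assms Suc by (intro add_mono mult_mono power_mono) auto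
  also have "\<dots> \<le> M * (real j * M ^ j * \<bar>s - r\<bar>) + \<bar>s - r\<bar> * (M * M ^ j)"
    using assms(3) by (intro add_mono mult_left_mono) (auto simp: mult_le_cancel_right1)
  also have "\<dots> = real (Suc j) * M ^ Suc j * \<bar>s - r\<bar>" by (simp add: algebra_simps)
  finally show ?case .
qed simp

lemma polysum_diff_bound:
  assumes "\<bar>s\<bar> \<le> M" "\<bar>r\<bar> \<le> M" "M \<ge> 1"
  shows "\<bar>polysum k c s - polysum k c' r\<bar> \<le> (\<Sum>j\<le>k. \<bar>c j - c' j\<bar> * M ^ j + \<bar>c' j\<bar> * (real j * M ^ j * \<bar>s - r\<bar>))"
proof -
  have "polysum k c s - polysum k c' r = (\<Sum>j\<le>k. (c j - c' j) * s ^ j + c' j * (s ^ j - r ^ j))"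
    by (simp add: polysum_def sum_subtractf[symmetric] algebra_simps)
  also have "\<bar>\<dots>\<bar> \<le> (\<Sum>j\<le>k. \<bar>c j - c' j\<bar> * M ^ j + \<bar>c' j\<bar> * (real j * M ^ j * \<bar>s - r\<bar>))"
  proof (rule order_trans[OF sum_abs], rule sum_mono)
    fix j
    have "\<bar>(c j - c' j) * s ^ j + c' j * (s ^ j - r ^ j)\<bar> \<le> \<bar>c j - c' j\<bar> * \<bar>s\<bar> ^ j + \<bar>c' j\<bar> * \<bar>s ^ j - r ^ j\<bar>"
      by (metis abs_mult abs_triangle_ineq power_abs)
    also have "\<dots> \<le> \<bar>c j - c' j\<bar> * M ^ j + \<bar>c' j\<bar> * (real j * M ^ j * \<bar>s - r\<bar>)"
      using assms power_diff_bound[OF assms] by (intro add_mono mult_left_mono power_mono) auto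
    finally show "\<bar>(c j - c' j) * s ^ j + c' j * (s ^ j - r ^ j)\<bar> \<le>
       \<bar>c j - c' j\<bar> * M ^ j + \<bar>c' j\<bar> * (real j * M ^ j * \<bar>s - r\<bar>)" .
  qed
  finally show ?thesis .
qed

definition ramp :: "real \<Rightarrow> real" where "ramp s = max 0 (min 1 s)"

lemma ramp_bounds: "0 \<le> ramp s" "ramp s \<le> 1" and ramp_0: "s \<le> 0 \<Longrightarrow> ramp s = 0" and ramp_1: "s \<ge> 1 \<Longrightarrow> ramp s = 1"
  by (auto simp: ramp_def)

lemma continuous_on_ramp [continuous_intros]: "continuous_on S f \<Longrightarrow> continuous_on S (\<lambda>x. ramp (f x))"
  unfolding ramp_def by (intro continuous_intros)

text \<open>If \<open>\<bar>h\<bar> * \<kappa> > 1\<close>, then \<open>p * \<kappa>\<close> is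
  closer than 1 to \<open>h * \<kappa>\<close> and has its sign, which is also the clamped value.
  Otherwise the ramp is 1 and the bound 2 is trivial. A ramp replaces an indicator function so that
  the error bound is continuous in \<open>h\<close>.\<close>

lemma sgn_approx:
  fixes p h \<kappa> :: real
  assumes "\<bar>p - h\<bar> * \<kappa> < 1" "\<kappa> > 0"
  shows "\<bar>sgn p - max (- 1) (min 1 (h * \<kappa>))\<bar> \<le> 2 * ramp (2 - \<bar>h\<bar> * \<kappa>)"
proof (cases "\<bar>h\<bar> * \<kappa> \<le> 1")
  case True
  then show ?thesis by (simp add: ramp_1 sgn_if) linarith
next
  case False
  have ph: "\<bar>p * \<kappa> - h * \<kappa>\<bar> < 1" using assms by (metis abs_mult abs_of_pos left_diff_distrib)
  have "\<bar>h * \<kappa>\<bar> > 1" using False assms(2) by (simp add: abs_mult)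
  then consider "h * \<kappa> > 1" | "h * \<kappa> < - 1" by linarith
  then have "sgn p = max (- 1) (min 1 (h * \<kappa>))"
  proof cases
    case 1
    then have "p * \<kappa> > 0" using ph by linarith
    then have "p > 0" using assms(2) zero_less_mult_pos2 by blast
    then show ?thesis using 1 by simp
  next
    case 2
    then have "p * \<kappa> < 0" using ph by linarith
    then have "p < 0" using assms(2) by (simp add: mult_less_0_iff)
    then show ?thesis using 2 by simp
  qed
  then show ?thesis by (simp add: ramp_bounds)
qed

lemma mass_integrable:
  assumes "\<nu> \<in> masses V" "(f :: _ \<Rightarrow> real) \<in> borel_measurable \<nu>" "\<And>x. \<bar>f x\<bar> \<le> C"
  shows "integrable \<nu> f"
  using finite_measure.integrable_const_bound[OF massesD(3)[OF assms(1)] _ assms(2), of C] assms(3) by simp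

text \<open>As \<open>\<kappa>\<close> grows, the first ramp shrinks to the zero set of
  \<open>h\<close>, which is null, and the second escapes to infinity; both are bounded by 1 on a
  finite measure, so dominated convergence applies.\<close>

lemma exists_cutoff:
  fixes h :: "'a::euclidean_space \<Rightarrow> real"
  assumes \<nu>: "\<nu> \<in> masses V" and h: "continuous_on V h" "AE y in \<nu>. h y \<noteq> 0" and "\<epsilon> > 0"
  obtains \<kappa> :: real where "\<kappa> \<ge> 1" "(\<integral>y. max (ramp (2 - \<bar>h y\<bar> * \<kappa>)) (ramp (norm y - \<kappa>)) \<partial>\<nu>) < \<epsilon>"
proof -
  let ?b = "\<lambda>N y. max (ramp (2 - \<bar>h y\<bar> * real (Suc N))) (ramp (norm y - real (Suc N)))"
  have meas: "?b N \<in> borel_measurable \<nu>" for N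
    by (rule borel_measurable_mass[OF \<nu>]) (intro continuous_intros h)
  have "(\<lambda>N. \<integral>y. ?b N y \<partial>\<nu>) \<longlonglongrightarrow> (\<integral>y. 0 \<partial>\<nu>)"
  proof (rule integral_dominated_convergence[where w = "\<lambda>_. 1"])
    show "integrable \<nu> (\<lambda>_. 1 :: real)" by (rule mass_integrable[OF \<nu>, where C = 1]) auto
    show "AE y in \<nu>. (\<lambda>N. ?b N y) \<longlonglongrightarrow> 0"
      using h(2)
    proof eventually_elim
      fix y assume "h y \<noteq> 0"
      obtain N0 where N0: "real N0 \<ge> max (norm y) (2 / \<bar>h y\<bar>)" using real_arch_simple by blast
      have "?b N y = 0" if "N \<ge> N0" for N
      proof -
        have "real (Suc N) \<ge> norm y" "real (Suc N) \<ge> 2 / \<bar>h y\<bar>"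
          using N0 that by (auto intro: order_trans[of _ "real N0"])
        then have "\<bar>h y\<bar> * real (Suc N) \<ge> 2" using \<open>h y \<noteq> 0\<close> by (simp add: divide_le_eq mult.commute)
        with \<open>real (Suc N) \<ge> norm y\<close> have "ramp (2 - \<bar>h y\<bar> * real (Suc N)) = 0" "ramp (norm y - real (Suc N)) = 0"
          by (auto intro!: ramp_0 simp del: of_nat_Suc)
        then show ?thesis by simp
      qed
      then show "(\<lambda>N. ?b N y) \<longlonglongrightarrow> 0"
        by (intro tendsto_eventually) (auto simp: eventually_sequentially simp del: of_nat_Suc)
    qed
    show "AE y in \<nu>. norm (?b N y) \<le> 1" for N
      using ramp_bounds by (intro AE_I2) (auto simp: max_def)
  qed (use meas in auto)
  then have "eventually (\<lambda>N. (\<integral>y. ?b N y \<partial>\<nu>) < \<epsilon>) sequentially"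
    using \<open>\<epsilon> > 0\<close> by (auto dest!: order_tendstoD(2))
  then obtain N where "(\<integral>y. ?b N y \<partial>\<nu>) < \<epsilon>" by (auto simp: eventually_sequentially)
  then show ?thesis by (intro that[of "real (Suc N)"]) auto
qed

text \<open>The sign is discontinuous and the spaces vary, whereas weak convergence controls bounded
  continuous functions on \<open>V0\<close>. So the sign is compared with a clamped multiple of the
  limiting polynomial, composed with the projection to \<open>V0\<close>. The error is at most twice
  \<open>b\<close>, again bounded and continuous, whose integral is small at \<open>V0\<close> and
  therefore nearby.\<close>

lemma sgn_integral_continuous:
  fixes V :: "'t \<Rightarrow> 'a::euclidean_space set"
  assumes \<mu>: "mass_assignment d \<mu>" and V0: "V0 \<in> grassmannian d" and Vt: "\<And>t. V t \<in> grassmannian d"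
    and v0: "v0 \<in> V0" "v0 \<noteq> 0" and c0: "j \<le> k" "c0 j \<noteq> 0"
    and V: "\<And>N. openin (grassmannian_topology d) N \<Longrightarrow> V0 \<in> N \<Longrightarrow> eventually (\<lambda>t. V t \<in> N) F"
    and v: "(v \<longlongrightarrow> v0) F" and c: "\<And>j. j \<le> k \<Longrightarrow> ((\<lambda>t. c t j) \<longlongrightarrow> c0 j) F"
  shows "((\<lambda>t. \<integral>x. sgn (polysum k (c t) (x \<bullet> v t)) \<partial>\<mu> (V t))
     \<longlongrightarrow> (\<integral>x. sgn (polysum k c0 (x \<bullet> v0)) \<partial>\<mu> V0)) F"
proof (rule tendstoI)
  fix \<epsilon> :: real assume "\<epsilon> > 0"
  have mass: "\<mu> W \<in> masses W" if "W \<in> grassmannian d" for W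
    by (rule mass_assignment_masses[OF \<mu> that])
  have sub: "subspace W" if "W \<in> grassmannian d" for W using that by (simp add: grassmannian_def)
  define h where "h = (\<lambda>y. polysum k c0 (y \<bullet> v0))"
  have h_cont: "continuous_on S h" for S unfolding h_def by (intro continuous_on_polysum continuous_intros)
  have "AE y in \<mu> V0. h y \<noteq> 0"
    unfolding h_def polysum_poly
    by (rule AE_polynomial_nonzero[OF mass[OF V0] sub[OF V0] v0 polysum_poly_nonzero[of j k c0, OF c0]])
  \<comment> \<open>The error at \<open>V t\<close> will be less than
    \<open>2 * (\<epsilon> / 8 + \<epsilon> / 8)\<close>, the one at \<open>V0\<close> less than
    \<open>2 * \<epsilon> / 8\<close>, and the clamped integral changes by less than
    \<open>\<epsilon> / 8\<close>; together this stays below \<open>\<epsilon>\<close>.\<close>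
  then obtain \<kappa> where \<kappa>: "\<kappa> \<ge> 1" "(\<integral>y. max (ramp (2 - \<bar>h y\<bar> * \<kappa>)) (ramp (norm y - \<kappa>)) \<partial>\<mu> V0) < \<epsilon> / 8"
    using exists_cutoff[OF mass[OF V0] h_cont] \<open>\<epsilon> > 0\<close> by (metis divide_pos_pos zero_less_numeral)
  define b where "b = (\<lambda>y. max (ramp (2 - \<bar>h y\<bar> * \<kappa>)) (ramp (norm y - \<kappa>)))"
  define g where "g = (\<lambda>y. max (- 1) (min 1 (h y * \<kappa>)))"
  have b_cont: "continuous_on S b" and g_cont: "continuous_on S g" for S
    unfolding b_def g_def by (intro continuous_intros h_cont)+
  have b01: "0 \<le> b y" "b y \<le> 1" for y using ramp_bounds by (auto simp: b_def max_def)
  have g1: "\<bar>g y\<bar> \<le> 1" for y by (auto simp: g_def)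
  have "bounded (b ` V0)" "bounded (g ` V0)"
    using b01 g1 by (auto simp: bounded_iff intro!: exI[of _ 1])
  obtain Nb where Nb: "openin (grassmannian_topology d) Nb" "V0 \<in> Nb"
    "\<And>W. W \<in> Nb \<Longrightarrow> \<bar>(\<integral>x. b (orth_proj V0 x) \<partial>\<mu> W) - (\<integral>x. b x \<partial>\<mu> V0)\<bar> < \<epsilon> / 8"
    using mass_assignment_weakly_continuous[OF \<mu> V0 b_cont \<open>bounded (b ` V0)\<close>, of "\<epsilon> / 8"] \<open>\<epsilon> > 0\<close> by auto
  obtain Ng where Ng: "openin (grassmannian_topology d) Ng" "V0 \<in> Ng"
    "\<And>W. W \<in> Ng \<Longrightarrow> \<bar>(\<integral>x. g (orth_proj V0 x) \<partial>\<mu> W) - (\<integral>x. g x \<partial>\<mu> V0)\<bar> < \<epsilon> / 8"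
    using mass_assignment_weakly_continuous[OF \<mu> V0 g_cont \<open>bounded (g ` V0)\<close>, of "\<epsilon> / 8"] \<open>\<epsilon> > 0\<close> by auto
  \<comment> \<open>Will bound \<open>\<bar>x \<bullet> v t\<bar>\<close> and
    \<open>\<bar>y \<bullet> v0\<bar>\<close> when the projection \<open>y\<close> of
    \<open>x\<close> has norm at most \<open>\<kappa> + 1\<close>: for \<open>t\<close> near the
    limit, \<open>norm x \<le> 2 * (\<kappa> + 1)\<close> and
    \<open>norm (v t) \<le> norm v0 + 1\<close>.\<close>
  define M where "M = 2 * (\<kappa> + 1) * (norm v0 + 1)"
  have M: "M \<ge> 1" unfolding M_def using \<kappa>(1) mult_mono[of 1 "2 * (\<kappa> + 1)" 1 "norm v0 + 1"] by simp
  have gap0: "((\<lambda>t. gap V0 (V t)) \<longlongrightarrow> 0) F"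
  proof (rule tendstoI)
    fix e :: real assume "e > 0"
    have "openin (grassmannian_topology d) {W \<in> topspace (grassmannian_topology d). gap V0 W \<in> {..<e}}"
      by (rule openin_continuous_map_preimage[OF continuous_map_gap]) auto
    then have "eventually (\<lambda>t. V t \<in> {W \<in> topspace (grassmannian_topology d). gap V0 W \<in> {..<e}}) F"
      by (rule V) (use V0 \<open>e > 0\<close> in \<open>simp add: gap_self topspace_grassmannian\<close>)
    then show "eventually (\<lambda>t. dist (gap V0 (V t)) 0 < e) F"
      by eventually_elim (simp add: gap_nonneg)
  qed
  \<comment> \<open>Bounds the difference of the two polynomials uniformly over all \<open>x\<close>
    whose projection has norm at most \<open>\<kappa> + 1\<close>.\<close>
  define \<Theta> where "\<Theta> t = (\<Sum>j\<le>k. \<bar>c t j - c0 j\<bar> * M ^ j + \<bar>c0 j\<bar> *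
     (real j * M ^ j * (2 * (\<kappa> + 1) * norm (v t - v0) + gap V0 (V t) * (2 * (\<kappa> + 1)) * norm v0)))" for t
  have "(\<Theta> \<longlongrightarrow> (\<Sum>j\<le>k. \<bar>c0 j - c0 j\<bar> * M ^ j + \<bar>c0 j\<bar> *
     (real j * M ^ j * (2 * (\<kappa> + 1) * norm (v0 - v0) + 0 * (2 * (\<kappa> + 1)) * norm v0)))) F"
    unfolding \<Theta>_def by (intro tendsto_intros c v gap0) auto
  then have "(\<Theta> \<longlongrightarrow> 0) F" by simp
  then have ev\<Theta>: "eventually (\<lambda>t. \<Theta> t < 1 / \<kappa>) F" using \<kappa>(1) by (auto dest: order_tendstoD(2)[of _ _ _ "1 / \<kappa>"])
  have evv: "eventually (\<lambda>t. norm (v t - v0) < 1) F"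
    using tendstoD[OF v, of 1] by (simp add: dist_norm)
  have evgap: "eventually (\<lambda>t. gap V0 (V t) < 1 / 2) F"
    using order_tendstoD(2)[OF gap0, of "1 / 2"] by simp
  show "eventually (\<lambda>t. dist (\<integral>x. sgn (polysum k (c t) (x \<bullet> v t)) \<partial>\<mu> (V t))
     (\<integral>x. sgn (polysum k c0 (x \<bullet> v0)) \<partial>\<mu> V0) < \<epsilon>) F"
    using ev\<Theta> evv evgap V[OF Nb(1,2)] V[OF Ng(1,2)]
  proof eventually_elim
    fix t assume \<Theta>: "\<Theta> t < 1 / \<kappa>" and vt: "norm (v t - v0) < 1" and gt: "gap V0 (V t) < 1 / 2"
      and inNb: "V t \<in> Nb" and inNg: "V t \<in> Ng"
    define f where "f = (\<lambda>x. sgn (polysum k (c t) (x \<bullet> v t)))"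
    define f0 where "f0 = (\<lambda>x. sgn (h x))"
    note mt = mass[OF Vt[of t]] and m0 = mass[OF V0] and s0 = sub[OF V0] and st = sub[OF Vt[of t]]
    have sgn_meas: "(\<lambda>x. sgn (p x)) \<in> borel_measurable \<nu>" if "\<nu> \<in> masses W" "continuous_on W p"
      for p :: "'a \<Rightarrow> real" and \<nu> W
      using borel_measurable_mass[OF that] by measurable
    have f_int: "integrable (\<mu> (V t)) f"
      unfolding f_def
      by (rule mass_integrable[OF mt sgn_meas[OF mt], where C = 1])
         (auto intro!: continuous_on_polysum continuous_intros simp: sgn_if)
    have f0_int: "integrable (\<mu> V0) f0"
      unfolding f0_def by (rule mass_integrable[OF m0 sgn_meas[OF m0 h_cont], where C = 1]) (auto simp: sgn_if)
    have cont_pr: "continuous_on (V t) (\<lambda>x. q (orth_proj V0 x))" if "\<And>S. continuous_on S q" for q :: "'a \<Rightarrow> real"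
      by (rule continuous_on_compose2[OF that[of UNIV] continuous_on_orth_proj[OF s0]]) auto
    have gt_int: "integrable (\<mu> (V t)) (\<lambda>x. g (orth_proj V0 x))"
      by (rule mass_integrable[OF mt borel_measurable_mass[OF mt cont_pr[OF g_cont]] g1])
    have bt_int: "integrable (\<mu> (V t)) (\<lambda>x. b (orth_proj V0 x))"
      by (rule mass_integrable[OF mt borel_measurable_mass[OF mt cont_pr[OF b_cont]], where C = 1]) (use b01 in auto)
    have g0_int: "integrable (\<mu> V0) g"
      by (rule mass_integrable[OF m0 borel_measurable_mass[OF m0 g_cont] g1])
    have b0_int: "integrable (\<mu> V0) b"
      by (rule mass_integrable[OF m0 borel_measurable_mass[OF m0 b_cont], where C = 1]) (use b01 in auto)
    have near: "\<bar>f x - g (orth_proj V0 x)\<bar> \<le> 2 * b (orth_proj V0 x)" if x: "x \<in> V t" for x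
    proof (cases "norm (orth_proj V0 x) \<ge> \<kappa> + 1")
      \<comment> \<open>Far out the second ramp makes \<open>b\<close> equal to 1, and the estimate
        is trivial.\<close>
      case True
      then have "b (orth_proj V0 x) = 1" by (simp add: b_def ramp_1 ramp_bounds max_absorb2)
      moreover have "\<bar>f x\<bar> \<le> 1" by (auto simp: f_def sgn_if)
      ultimately show ?thesis using g1[of "orth_proj V0 x"] by linarith
    next
      case False
      define y where "y = orth_proj V0 x"
      have ny: "norm y \<le> \<kappa> + 1" using False by (simp add: y_def)
      have nx: "norm x \<le> 2 * (\<kappa> + 1)"
        using gap_norm_le[OF s0 st _ x] gt ny by (simp add: y_def)
      have xy: "norm (x - y) \<le> gap V0 (V t) * (2 * (\<kappa> + 1))"
        using norm_orth_proj_diff[OF s0 st, of x] orth_proj_id[OF st x]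
          mult_left_mono[OF nx gap_nonneg[of V0 "V t"]] by (simp add: y_def)
      have nv: "norm (v t) \<le> norm v0 + 1" using vt norm_triangle_ineq2[of "v t" v0] by linarith
      have K1: "0 \<le> 2 * (\<kappa> + 1)" using \<kappa>(1) by simp
      have "\<bar>x \<bullet> v t\<bar> \<le> norm x * norm (v t)" by (rule Cauchy_Schwarz_ineq2)
      also have "\<dots> \<le> M" unfolding M_def using nx nv K1 by (intro mult_mono) auto
      finally have sM: "\<bar>x \<bullet> v t\<bar> \<le> M" .
      have "\<bar>y \<bullet> v0\<bar> \<le> norm y * norm v0" by (rule Cauchy_Schwarz_ineq2)
      also have "\<dots> \<le> M" unfolding M_def using ny K1 \<kappa>(1) by (intro mult_mono) auto
      finally have rM: "\<bar>y \<bullet> v0\<bar> \<le> M" .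
      have "x \<bullet> v t - y \<bullet> v0 = x \<bullet> (v t - v0) + (x - y) \<bullet> v0" by (simp add: inner_diff_left inner_diff_right)
      then have "\<bar>x \<bullet> v t - y \<bullet> v0\<bar> \<le> norm x * norm (v t - v0) + norm (x - y) * norm v0"
        using Cauchy_Schwarz_ineq2[of x "v t - v0"] Cauchy_Schwarz_ineq2[of "x - y" v0] by linarith
      also have "\<dots> \<le> 2 * (\<kappa> + 1) * norm (v t - v0) + gap V0 (V t) * (2 * (\<kappa> + 1)) * norm v0"
        using nx xy by (intro add_mono mult_right_mono) auto
      finally have d: "\<bar>x \<bullet> v t - y \<bullet> v0\<bar> \<le> 2 * (\<kappa> + 1) * norm (v t - v0) + gap V0 (V t) * (2 * (\<kappa> + 1)) * norm v0" .
      have "\<bar>polysum k (c t) (x \<bullet> v t) - h y\<bar> \<le>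
          (\<Sum>j\<le>k. \<bar>c t j - c0 j\<bar> * M ^ j + \<bar>c0 j\<bar> * (real j * M ^ j * \<bar>x \<bullet> v t - y \<bullet> v0\<bar>))"
        unfolding h_def by (rule polysum_diff_bound[OF sM rM M])
      also have "\<dots> \<le> \<Theta> t"
        unfolding \<Theta>_def using d M by (intro sum_mono add_left_mono mult_left_mono) auto
      finally have "\<bar>polysum k (c t) (x \<bullet> v t) - h y\<bar> < 1 / \<kappa>" using \<Theta> by linarith
      then have "\<bar>polysum k (c t) (x \<bullet> v t) - h y\<bar> * \<kappa> < 1" using \<kappa>(1) by (simp add: field_simps)
      then have "\<bar>f x - g y\<bar> \<le> 2 * ramp (2 - \<bar>h y\<bar> * \<kappa>)"
        unfolding f_def g_def using \<kappa>(1) by (intro sgn_approx) auto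
      also have "\<dots> \<le> 2 * b y" by (simp add: b_def)
      finally show ?thesis by (simp add: y_def)
    qed
    have near0: "\<bar>f0 y - g y\<bar> \<le> 2 * b y" for y
      using sgn_approx[of "h y" "h y" \<kappa>] \<kappa>(1) by (simp add: f0_def g_def b_def)
    have "\<bar>(\<integral>x. f x \<partial>\<mu> (V t)) - (\<integral>x. g (orth_proj V0 x) \<partial>\<mu> (V t))\<bar>
       = \<bar>\<integral>x. (f x - g (orth_proj V0 x)) \<partial>\<mu> (V t)\<bar>"
      by (simp add: f_int gt_int)
    also have "\<dots> \<le> (\<integral>x. 2 * b (orth_proj V0 x) \<partial>\<mu> (V t))"
      by (rule integral_abs_bound_integral) (use near massesD(2)[OF mt] f_int gt_int bt_int in auto)
    finally have 1: "\<bar>(\<integral>x. f x \<partial>\<mu> (V t)) - (\<integral>x. g (orth_proj V0 x) \<partial>\<mu> (V t))\<bar>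
       \<le> 2 * (\<integral>x. b (orth_proj V0 x) \<partial>\<mu> (V t))" by simp
    have "\<bar>(\<integral>x. f0 x \<partial>\<mu> V0) - (\<integral>x. g x \<partial>\<mu> V0)\<bar> = \<bar>\<integral>x. (f0 x - g x) \<partial>\<mu> V0\<bar>"
      by (simp add: f0_int g0_int)
    also have "\<dots> \<le> (\<integral>x. 2 * b x \<partial>\<mu> V0)"
      by (rule integral_abs_bound_integral) (use near0 f0_int g0_int b0_int in auto)
    finally have 2: "\<bar>(\<integral>x. f0 x \<partial>\<mu> V0) - (\<integral>x. g x \<partial>\<mu> V0)\<bar> \<le> 2 * (\<integral>x. b x \<partial>\<mu> V0)" by simp
    have "(\<integral>x. b x \<partial>\<mu> V0) < \<epsilon> / 8" using \<kappa>(2) by (simp add: b_def)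
    then have "\<bar>(\<integral>x. f x \<partial>\<mu> (V t)) - (\<integral>x. f0 x \<partial>\<mu> V0)\<bar> < \<epsilon>"
      using 1 2 Nb(3)[OF inNb] Ng(3)[OF inNg] by linarith
    then show "dist (\<integral>x. sgn (polysum k (c t) (x \<bullet> v t)) \<partial>\<mu> (V t))
     (\<integral>x. sgn (polysum k c0 (x \<bullet> v0)) \<partial>\<mu> V0) < \<epsilon>"
      by (simp add: dist_real_def f_def f0_def h_def)
  qed
qed

subsection \<open>The family of flags\<close>

lemma continuous_on_block: "continuous_on UNIV (\<lambda>t. block t s r l)"
  by (cases "l < r") (simp_all add: block_def)

lemma continuous_on_spherical_block: "continuous_on UNIV (\<lambda>t. spherical (block t s r) i)"
  unfolding spherical_def by (intro continuous_intros continuous_on_block)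

text \<open>The part of a point in spherical coordinates from coordinate \<open>i\<close> on,
  without the common factor of the sines before \<open>i\<close>. If the last sine is 0, it is a
  unit vector, even where those earlier sines vanish.\<close>

definition tail_vector :: "(nat \<Rightarrow> 'a::euclidean_space) \<Rightarrow> nat \<Rightarrow> (nat \<Rightarrow> real) \<Rightarrow> nat \<Rightarrow> 'a" where
  "tail_vector b d \<tau> i = (\<Sum>l\<in>{i..<d}. ((\<Prod>s\<in>{i..<l}. sin (\<tau> s)) * cos (\<tau> l)) *\<^sub>R b l)"

text \<open>The normalized derivative of \<^term>\<open>tail_vector b d \<tau> 0\<close> with respect to the \<open>i\<close>-th angle.\<close>

definition angular_vector :: "(nat \<Rightarrow> 'a::euclidean_space) \<Rightarrow> nat \<Rightarrow> (nat \<Rightarrow> real) \<Rightarrow> nat \<Rightarrow> 'a" where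
  "angular_vector b d \<tau> i = (- sin (\<tau> i)) *\<^sub>R b i + cos (\<tau> i) *\<^sub>R tail_vector b d \<tau> (Suc i)"

lemma tail_vector_rec:
  assumes "i < d"
  shows "tail_vector b d \<tau> i = cos (\<tau> i) *\<^sub>R b i + sin (\<tau> i) *\<^sub>R tail_vector b d \<tau> (Suc i)"
proof -
  have "tail_vector b d \<tau> i = cos (\<tau> i) *\<^sub>R b i
      + (\<Sum>l\<in>{Suc i..<d}. ((\<Prod>s\<in>{i..<l}. sin (\<tau> s)) * cos (\<tau> l)) *\<^sub>R b l)"
    unfolding tail_vector_def using assms by (subst sum.atLeast_Suc_lessThan) auto
  also have "(\<Sum>l\<in>{Suc i..<d}. ((\<Prod>s\<in>{i..<l}. sin (\<tau> s)) * cos (\<tau> l)) *\<^sub>R b l)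
     = sin (\<tau> i) *\<^sub>R tail_vector b d \<tau> (Suc i)"
    unfolding tail_vector_def scaleR_right.sum
    by (rule sum.cong) (auto simp: prod.atLeast_Suc_lessThan)
  finally show ?thesis .
qed

lemma tail_vector_0: "tail_vector b d \<tau> 0 = (\<Sum>l<d. spherical \<tau> l *\<^sub>R b l)"
  by (simp add: tail_vector_def spherical_def atLeast0LessThan)

text \<open>The angular vectors complete the unit vector \<open>Tl 0\<close> to an orthonormal frame
  of the span of the first \<open>d\<close> vectors. They stay orthonormal and continuous at the
  degenerate angles too, where the derivative vanishes and could not be normalized.\<close>

locale spherical_frame =
  fixes b :: "nat \<Rightarrow> 'a::euclidean_space" and d N :: nat and \<tau> :: "nat \<Rightarrow> real"
  assumes b: "orthonormal_frame N b" and d: "1 \<le> d" "d \<le> N" and \<tau>: "sin (\<tau> (d - 1)) = 0"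
begin

abbreviation "Tl \<equiv> tail_vector b d \<tau>"
abbreviation "An \<equiv> angular_vector b d \<tau>"

lemma tail_inner: "l < N \<Longrightarrow> l < i \<or> d \<le> l \<Longrightarrow> Tl i \<bullet> b l = 0"
  unfolding tail_vector_def inner_sum_left
  by (rule sum.neutral) (use b d in \<open>auto simp: orthonormal_frameD\<close>)

lemma angular_inner: "i < d - 1 \<Longrightarrow> l < N \<Longrightarrow> l < i \<or> d \<le> l \<Longrightarrow> An i \<bullet> b l = 0"
  using b d by (auto simp: angular_vector_def inner_add_left inner_diff_left orthonormal_frameD tail_inner)

lemma tail_norm: "i < d \<Longrightarrow> Tl i \<bullet> Tl i = 1"
proof (induction "d - 1 - i" arbitrary: i)
  case 0
  then have i: "i = d - 1" by simp
  have "Tl i = cos (\<tau> i) *\<^sub>R b i"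
    using tail_vector_rec[OF 0(2), of b \<tau>] \<tau> i by simp
  moreover have "(cos (\<tau> i))\<^sup>2 = 1" using \<tau> i sin_cos_squared_add[of "\<tau> i"] by simp
  ultimately show ?case using b d i by (simp add: orthonormal_frameD power2_eq_square)
next
  case (Suc n)
  have "Tl (Suc i) \<bullet> Tl (Suc i) = 1" using Suc by (intro Suc(1)) auto
  moreover have "Tl (Suc i) \<bullet> b i = 0" "b i \<bullet> b i = 1"
    using tail_inner[of i "Suc i"] b d Suc(3) by (auto simp: orthonormal_frameD)
  ultimately have "Tl i \<bullet> Tl i = (cos (\<tau> i))\<^sup>2 + (sin (\<tau> i))\<^sup>2"
    unfolding tail_vector_rec[OF Suc(3)]
    by (simp add: inner_add_left inner_add_right inner_commute power2_eq_square)
  then show ?case by simp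
qed

lemma angular_norm:
  assumes "i < d - 1" shows "An i \<bullet> An i = 1"
proof -
  have "Tl (Suc i) \<bullet> Tl (Suc i) = 1" "Tl (Suc i) \<bullet> b i = 0" "b i \<bullet> b i = 1"
    using assms tail_norm tail_inner[of i "Suc i"] b d by (auto simp: orthonormal_frameD)
  moreover have "sin (\<tau> i) * sin (\<tau> i) + cos (\<tau> i) * cos (\<tau> i) = 1"
    by (metis add.commute sin_cos_squared_add3)
  ultimately show ?thesis
    by (simp add: angular_vector_def inner_add_left inner_add_right inner_diff_left inner_diff_right
        inner_commute)
qed

text \<open>For \<open>j = i\<close>, a unit vector is orthogonal to its derivative with respect to
  its first angle; smaller \<open>j\<close> follow by the recursion for tails, since
  \<open>An i\<close> has no component along \<open>b j\<close>.\<close>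

lemma tail_angular: "j \<le> i \<Longrightarrow> i < d - 1 \<Longrightarrow> Tl j \<bullet> An i = 0"
proof (induction "i - j" arbitrary: j)
  case 0
  then have [simp]: "j = i" by simp
  have "Tl (Suc i) \<bullet> Tl (Suc i) = 1" "Tl (Suc i) \<bullet> b i = 0" "b i \<bullet> b i = 1"
    using 0 tail_norm tail_inner[of i "Suc i"] b d by (auto simp: orthonormal_frameD)
  moreover have "Tl i = cos (\<tau> i) *\<^sub>R b i + sin (\<tau> i) *\<^sub>R Tl (Suc i)"
    using 0 by (intro tail_vector_rec) auto
  ultimately show ?case
    by (simp add: angular_vector_def inner_add_left inner_add_right inner_diff_left inner_diff_right
        inner_commute)
next
  case (Suc n)
  have "Tl (Suc j) \<bullet> An i = 0" using Suc by (intro Suc(1)) auto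
  moreover have "j < i" "j < N" using Suc(2-4) d by auto
  then have "b j \<bullet> An i = 0" using angular_inner[of i j] Suc(4) by (simp add: inner_commute)
  moreover have "Tl j = cos (\<tau> j) *\<^sub>R b j + sin (\<tau> j) *\<^sub>R Tl (Suc j)"
    using Suc by (intro tail_vector_rec) auto
  ultimately show ?case by (simp add: inner_add_left)
qed

lemma angular_angular:
  assumes "j < i" "i < d - 1" shows "An j \<bullet> An i = 0"
proof -
  have "b j \<bullet> An i = 0" "Tl (Suc j) \<bullet> An i = 0"
    using angular_inner[of i j] tail_angular[of "Suc j" i] assms d by (auto simp: inner_commute)
  then show ?thesis by (simp add: angular_vector_def inner_add_left inner_diff_left)
qed

lemma orthonormal_frame_angular:
  assumes "v \<bullet> v = 1" "\<And>i. i < d - 1 \<Longrightarrow> v \<bullet> An i = 0"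
  shows "orthonormal_frame d (case_nat v An)"
  unfolding orthonormal_frame_def
proof (intro allI impI)
  fix i j assume ij: "i < d" "j < d"
  show "case_nat v An i \<bullet> case_nat v An j = (if i = j then 1 else 0)"
  proof (cases i; cases j)
    fix i' j' assume [simp]: "i = Suc i'" "j = Suc j'"
    show ?thesis using ij angular_norm[of i'] angular_angular[of i' j'] angular_angular[of j' i']
      by (cases i' j' rule: linorder_cases) (auto simp: inner_commute)
  qed (use assms ij in \<open>auto simp: inner_commute\<close>)
qed

lemma image_frame: "case_nat v An ` {..<d} = insert v (An ` {..<d - 1})"
proof -
  have "{..<d} = insert 0 (Suc ` {..<d - 1})"
    using d lessThan_Suc_eq_insert_0[of "d - 1"] by simp
  then show ?thesis by (simp add: image_image)
qed

text \<open>\<open>Tl 0\<close> and the angular vectors are \<open>d\<close> orthonormal vectors in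
  a \<open>d\<close>-dimensional space, hence a basis; in the expansion of a vector orthogonal to
  \<open>Tl 0\<close> the first term vanishes.\<close>

lemma span_angular: "span (An ` {..<d - 1}) = {h \<in> span (b ` {..<d}). h \<bullet> Tl 0 = 0}"
proof
  have inF: "Tl i \<in> span (b ` {..<d})" for i
    unfolding tail_vector_def by (intro span_sum span_scale span_base) auto
  have AnF: "An i \<in> span (b ` {..<d})" if "i < d - 1" for i
    unfolding angular_vector_def using that by (intro span_add span_scale inF span_base) auto
  have sub: "subspace {h \<in> span (b ` {..<d}). h \<bullet> Tl 0 = 0}"
    by (auto simp: subspace_def span_zero span_add span_scale inner_add_left)
  show "span (An ` {..<d - 1}) \<subseteq> {h \<in> span (b ` {..<d}). h \<bullet> Tl 0 = 0}"
    using AnF tail_angular[of 0] by (intro span_minimal sub) (auto simp: inner_commute)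
  let ?e = "case_nat (Tl 0) An"
  have e: "orthonormal_frame d ?e"
    using tail_norm[of 0] tail_angular[of 0] d by (intro orthonormal_frame_angular) auto
  have "orthonormal_frame d b" using b d by (auto simp: orthonormal_frame_def)
  then have "dim (span (b ` {..<d})) = d" "dim (span (?e ` {..<d})) = d"
    using span_frame_grassmannian e by (auto simp: grassmannian_def)
  moreover have "span (?e ` {..<d}) \<subseteq> span (b ` {..<d})"
    unfolding image_frame using inF AnF by (intro span_minimal subspace_span) auto
  ultimately have F: "span (?e ` {..<d}) = span (b ` {..<d})"
    by (intro subspace_dim_equal subspace_span) auto
  show "{h \<in> span (b ` {..<d}). h \<bullet> Tl 0 = 0} \<subseteq> span (An ` {..<d - 1})"
  proof
    fix h assume "h \<in> {h \<in> span (b ` {..<d}). h \<bullet> Tl 0 = 0}"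
    then have h: "h \<in> span (?e ` {..<d})" "h \<bullet> Tl 0 = 0" using F by auto
    have "h = (\<Sum>i<d. (h \<bullet> ?e i) *\<^sub>R ?e i)"
      using orth_proj_frame[OF e, of h] orth_proj_id[OF subspace_span h(1)] by simp
    also have "\<dots> = (\<Sum>i<d - 1. (h \<bullet> An i) *\<^sub>R An i)"
      using d h(2) sum.lessThan_Suc_shift[of "\<lambda>i. (h \<bullet> ?e i) *\<^sub>R ?e i" "d - 1"] by simp
    also have "\<dots> \<in> span (An ` {..<d - 1})" by (intro span_sum span_scale span_base) auto
    finally show "h \<in> span (An ` {..<d - 1})" .
  qed
qed

end

section \<open>Poles, directions and the spaces they span\<close>

definition pole :: "(nat \<Rightarrow> 'a::euclidean_space) \<Rightarrow> nat \<Rightarrow> (nat \<Rightarrow> real) \<Rightarrow> 'a" where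
  "pole b d \<alpha> = (\<Sum>l<d. \<alpha> l *\<^sub>R b l)"

text \<open>The space \<open>F\<close> is spanned by the first \<open>d\<close> vectors. The pole is
  the unit vector in \<open>F\<close>, and \<open>d - 1 + l\<close> with \<open>l\<close> from 1 to
  \<open>m\<close> runs through the remaining vectors, which are orthogonal to
  \<open>F\<close>.\<close>

definition direction :: "(nat \<Rightarrow> 'a::euclidean_space) \<Rightarrow> nat \<Rightarrow> nat \<Rightarrow> (nat \<Rightarrow> real) \<Rightarrow> (nat \<Rightarrow> real) \<Rightarrow> 'a" where
  "direction b d m \<alpha> \<beta> = \<beta> 0 *\<^sub>R pole b d \<alpha> + (\<Sum>l\<in>{1..m}. \<beta> l *\<^sub>R b (d - 1 + l))"

text \<open>Defined by the orthogonal complement of the pole and not by a frame, so that it is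
  visibly unchanged when the pole is negated. The frame of the same space,
  \<open>flag_frame\<close>, serves for its dimension and its continuity.\<close>

definition flag_space :: "(nat \<Rightarrow> 'a::euclidean_space) \<Rightarrow> nat \<Rightarrow> nat \<Rightarrow> (nat \<Rightarrow> real) \<Rightarrow> (nat \<Rightarrow> real) \<Rightarrow> 'a set" where
  "flag_space b d m \<alpha> \<beta> = span (insert (direction b d m \<alpha> \<beta>) {h \<in> span (b ` {..<d}). h \<bullet> pole b d \<alpha> = 0})"

lemma span_insert_uminus: "span (insert (- v) S) = span (insert v (S :: 'a::real_vector set))"
proof -
  have *: "span (insert (- w) S) \<subseteq> span (insert w S)" for w :: 'a
  proof (rule span_minimal[OF _ subspace_span], rule insert_subsetI)
    show "- w \<in> span (insert w S)" by (intro span_neg span_base) simp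
    show "S \<subseteq> span (insert w S)" using span_superset[of "insert w S"] by simp
  qed
  from *[of v] *[of "- v"] show ?thesis by simp
qed

lemma pole_minus: "pole b d (\<lambda>i. - \<alpha> i) = - pole b d \<alpha>"
  by (simp add: pole_def sum_negf)

lemma direction_flip: "direction b d m (\<lambda>i. - \<alpha> i) (\<beta>(0 := - \<beta> 0)) = direction b d m \<alpha> \<beta>"
  by (simp add: direction_def pole_minus)

lemma direction_minus: "direction b d m \<alpha> (\<lambda>i. - \<beta> i) = - direction b d m \<alpha> \<beta>"
  by (simp add: direction_def sum_negf)

lemma flag_space_flip: "flag_space b d m (\<lambda>i. - \<alpha> i) (\<beta>(0 := - \<beta> 0)) = flag_space b d m \<alpha> \<beta>"
  by (simp add: flag_space_def direction_flip pole_minus)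

lemma flag_space_minus: "flag_space b d m \<alpha> (\<lambda>i. - \<beta> i) = flag_space b d m \<alpha> \<beta>"
  by (simp add: flag_space_def direction_minus span_insert_uminus)

definition flag_frame :: "(nat \<Rightarrow> 'a::euclidean_space) \<Rightarrow> nat \<Rightarrow> nat \<Rightarrow> (nat \<Rightarrow> real) \<Rightarrow> nat \<Rightarrow> 'a" where
  "flag_frame b d m t = case_nat
     (direction b d m (spherical (block t 0 (d - 1))) (spherical (block t (d - 1) m)))
     (angular_vector b d (block t 0 (d - 1)))"

lemma flag_frame:
  assumes b: "orthonormal_frame (d + m) b" and d: "d \<ge> 1"
  shows "orthonormal_frame d (flag_frame b d m t)"
    "span (flag_frame b d m t ` {..<d}) = flag_space b d m (spherical (block t 0 (d - 1))) (spherical (block t (d - 1) m))"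
proof -
  let ?\<tau> = "block t 0 (d - 1)"
  let ?\<alpha> = "spherical ?\<tau>" and ?\<beta> = "spherical (block t (d - 1) m)"
  interpret spherical_frame b d "d + m" ?\<tau>
    by unfold_locales (use b d in \<open>auto simp: block_def\<close>)
  let ?v = "direction b d m ?\<alpha> ?\<beta>"
  have T0: "pole b d ?\<alpha> = Tl 0" by (simp add: pole_def tail_vector_0)
  define w where "w = (\<Sum>l\<in>{1..m}. ?\<beta> l *\<^sub>R b (d - 1 + l))"
  have v: "?v = ?\<beta> 0 *\<^sub>R Tl 0 + w" by (simp only: direction_def T0 w_def)
  have "w \<bullet> An i = 0" if "i < d - 1" for i
    unfolding w_def inner_sum_left
  proof (intro sum.neutral ballI)
    fix l assume "l \<in> {1..m}"
    then have "An i \<bullet> b (d - 1 + l) = 0" using d by (intro angular_inner[OF that]) auto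
    then show "?\<beta> l *\<^sub>R b (d - 1 + l) \<bullet> An i = 0" by (simp add: inner_commute)
  qed
  then have vA: "?v \<bullet> An i = 0" if "i < d - 1" for i
    unfolding v using that tail_angular[of 0 i] by (simp add: inner_add_left)
  have wT: "w \<bullet> Tl 0 = 0"
    unfolding w_def inner_sum_left
  proof (intro sum.neutral ballI)
    fix l assume "l \<in> {1..m}"
    then have "Tl 0 \<bullet> b (d - 1 + l) = 0" using d by (intro tail_inner) auto
    then show "?\<beta> l *\<^sub>R b (d - 1 + l) \<bullet> Tl 0 = 0" by (simp add: inner_commute)
  qed
  have wb: "w \<bullet> b (d - 1 + l) = ?\<beta> l" if l: "l \<in> {1..m}" for l
  proof -
    have "w \<bullet> b (d - 1 + l) = (\<Sum>l'\<in>{1..m}. if l' = l then ?\<beta> l' else 0)"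
      unfolding w_def inner_sum_left
    proof (rule sum.cong[OF refl])
      fix l' assume "l' \<in> {1..m}"
      then have "b (d - 1 + l') \<bullet> b (d - 1 + l) = (if l' = l then 1 else 0)"
        using orthonormal_frameD[OF b, of "d - 1 + l'" "d - 1 + l"] l d by auto
      then show "?\<beta> l' *\<^sub>R b (d - 1 + l') \<bullet> b (d - 1 + l) = (if l' = l then ?\<beta> l' else 0)" by simp
    qed
    then show ?thesis using l by simp
  qed
  have "w \<bullet> w = (\<Sum>l\<in>{1..m}. w \<bullet> ?\<beta> l *\<^sub>R b (d - 1 + l))"
    using inner_sum_right[of w "\<lambda>l. ?\<beta> l *\<^sub>R b (d - 1 + l)" "{1..m}"] unfolding w_def[symmetric] .
  also have "\<dots> = (\<Sum>l\<in>{1..m}. (?\<beta> l)\<^sup>2)"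
    using wb by (intro sum.cong refl) (simp add: power2_eq_square)
  finally have ww: "w \<bullet> w = (\<Sum>l\<in>{1..m}. (?\<beta> l)\<^sup>2)" .
  have "?v \<bullet> ?v = (?\<beta> 0)\<^sup>2 * (Tl 0 \<bullet> Tl 0) + w \<bullet> w"
    unfolding v using wT by (simp add: inner_add_left inner_add_right inner_commute power2_eq_square)
  also have "\<dots> = (\<Sum>l\<le>m. (?\<beta> l)\<^sup>2)"
  proof -
    have "{..m} = insert 0 {1..m}" by auto
    then show ?thesis using tail_norm[of 0] d by (simp add: ww)
  qed
  also have "\<dots> = 1" by (rule sum_spherical_block)
  finally have vv: "?v \<bullet> ?v = 1" .
  show "orthonormal_frame d (flag_frame b d m t)"
    unfolding flag_frame_def by (rule orthonormal_frame_angular[OF vv vA])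
  have S: "{h \<in> span (b ` {..<d}). h \<bullet> pole b d ?\<alpha> = 0} = span (An ` {..<d - 1})"
    by (simp only: T0 span_angular)
  show "span (flag_frame b d m t ` {..<d}) = flag_space b d m ?\<alpha> ?\<beta>"
    unfolding flag_frame_def image_frame flag_space_def S span_insert span_span by (rule refl)
qed

lemma continuous_on_flag_frame: "continuous_on UNIV (\<lambda>t. flag_frame b d m t i)"
proof (cases i)
  case 0
  then show ?thesis unfolding flag_frame_def direction_def pole_def
    by (simp, intro continuous_intros continuous_on_spherical_block)
next
  case (Suc j)
  then show ?thesis unfolding flag_frame_def angular_vector_def tail_vector_def
    by (simp, intro continuous_intros continuous_on_block)
qed

lemma continuous_map_span_frame:
  fixes E :: "'t::topological_space \<Rightarrow> nat \<Rightarrow> 'a::euclidean_space"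
  assumes E: "\<And>t. orthonormal_frame d (E t)" "\<And>i. i < d \<Longrightarrow> continuous_on UNIV (\<lambda>t. E t i)"
    and N: "openin (grassmannian_topology d) N"
  shows "open {t. span (E t ` {..<d}) \<in> N}"
proof -
  \<comment> \<open>Points of the Stiefel space take the value \<open>undefined\<close> outside
    \<open>{..<d}\<close>, hence the restriction.\<close>
  let ?r = "\<lambda>t. restrict (E t) {..<d}"
  have r: "continuous_map euclidean (stiefel_topology d) ?r"
    unfolding stiefel_topology_def
  proof (rule continuous_map_into_subtopology)
    show "continuous_map euclidean (product_topology (\<lambda>_. euclidean) {..<d}) ?r"
      unfolding continuous_map_componentwise
      using E(2) by (auto simp: continuous_map_iff_continuous2)
    show "?r \<in> topspace euclidean \<rightarrow> {e. \<forall>i<d. \<forall>j<d. e i \<bullet> e j = (if i = j then 1 else 0)}"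
      using E(1) by (auto simp: orthonormal_frame_def)
  qed
  have "openin euclidean {t \<in> topspace euclidean. ?r t \<in> {e \<in> topspace (stiefel_topology d). span (e ` {..<d}) \<in> N}}"
    by (rule openin_continuous_map_preimage[OF r]) (use N in \<open>simp add: openin_grassmannian_topology\<close>)
  moreover have "?r t \<in> topspace (stiefel_topology d)" for t
    using continuous_map_image_subset_topspace[OF r] by auto
  ultimately show ?thesis by simp
qed

subsection \<open>Chessboard colorings by parallel hyperplanes\<close>

text \<open>\<open>T\<close> becomes the set of roots of odd multiplicity. Splitting off a root
  \<open>t\<close> inserts it into \<open>T\<close>; if it was already there, it is removed and the
  square of its factor, which does not change sign, joins \<open>r\<close>.\<close>

lemma poly_sign_factorization:
  fixes p :: "real poly"
  assumes "p \<noteq> 0"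
  shows "\<exists>T r. finite T \<and> card T \<le> degree p \<and> p = (\<Prod>t\<in>T. [:- t, 1:]) * r \<and>
     ((\<forall>s. poly r s \<ge> 0) \<or> (\<forall>s. poly r s \<le> 0))"
  using assms
proof (induction "degree p" arbitrary: p rule: less_induct)
  case less
  show ?case
  proof (cases "\<exists>t. poly p t = 0")
    case False
    have "(\<forall>s. poly p s \<ge> 0) \<or> (\<forall>s. poly p s \<le> 0)"
    proof (rule ccontr)
      assume "\<not> ?thesis"
      then obtain x y where "poly p x < 0" "poly p y > 0" by (meson not_less)
      then have "x \<noteq> y" "poly p x * poly p y < 0" by (auto simp: mult_neg_pos)
      then show False using False poly_IVT[of x y p] poly_IVT[of y x p]
        by (metis linorder_neqE mult.commute)
    qed
    then show ?thesis by (intro exI[of _ "{}"] exI[of _ p]) auto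
  next
    case True
    then obtain t p' where p: "p = [:- t, 1:] * p'" by (auto simp: poly_eq_0_iff_dvd elim: dvdE)
    then have "p' \<noteq> 0" using less.prems by auto
    then have deg: "degree p = Suc (degree p')" unfolding p by (subst degree_mult_eq) auto
    obtain T r where T: "finite T" "card T \<le> degree p'" "p' = (\<Prod>t\<in>T. [:- t, 1:]) * r"
      "(\<forall>s. poly r s \<ge> 0) \<or> (\<forall>s. poly r s \<le> 0)"
      using less.hyps[of p'] deg \<open>p' \<noteq> 0\<close> by auto
    show ?thesis
    proof (cases "t \<in> T")
      case False
      then have "p = (\<Prod>t\<in>insert t T. [:- t, 1:]) * r"
        unfolding p T(3) using T(1) by (simp add: mult.assoc del: mult_pCons_left)
      then show ?thesis
        using T False deg by (intro exI[of _ "insert t T"] exI[of _ r]) auto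
    next
      case True
      then have "(\<Prod>t\<in>T. [:- t, 1:]) = [:- t, 1:] * (\<Prod>t\<in>T - {t}. [:- t, 1:])"
        using T(1) by (simp add: prod.remove del: mult_pCons_left)
      then have "p = (\<Prod>t\<in>T - {t}. [:- t, 1:]) * ([:- t, 1:]\<^sup>2 * r)"
        unfolding p T(3) by (simp add: power2_eq_square ac_simps del: mult_pCons_left mult_pCons_right)
      moreover have "poly ([:- t, 1:]\<^sup>2 * r) s = (s - t)\<^sup>2 * poly r s" for s by simp
      then have "(\<forall>s. poly ([:- t, 1:]\<^sup>2 * r) s \<ge> 0) \<or> (\<forall>s. poly ([:- t, 1:]\<^sup>2 * r) s \<le> 0)"
        using T(4) by (auto simp: mult_nonneg_nonpos)
      moreover have "card (T - {t}) \<le> degree p" using card_mono[of T "T - {t}"] T(1,2) deg by auto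
      ultimately show ?thesis
        using T(1) by (intro exI[of _ "T - {t}"] exI[of _ "[:- t, 1:]\<^sup>2 * r"]) simp
    qed
  qed
qed

lemma prod_sign_change:
  fixes x y :: real
  assumes "finite T" "x \<notin> T" "y \<notin> T"
  shows "(\<Prod>t\<in>T. x - t) \<noteq> 0 \<and> (\<Prod>t\<in>T. y - t) \<noteq> 0 \<and>
    (((\<Prod>t\<in>T. x - t) > 0 \<longleftrightarrow> (\<Prod>t\<in>T. y - t) > 0) \<longleftrightarrow> even (card {t \<in> T. t \<in> closed_segment x y}))"
  using assms
proof (induction T rule: finite_induct)
  case (insert a T)
  let ?P = "\<lambda>z. \<Prod>t\<in>T. z - t"
  have IH: "?P x \<noteq> 0" "?P y \<noteq> 0"
    "(?P x > 0 \<longleftrightarrow> ?P y > 0) \<longleftrightarrow> even (card {t \<in> T. t \<in> closed_segment x y})"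
    using insert by auto
  have prod: "(\<Prod>t\<in>insert a T. z - t) = (z - a) * ?P z" for z using insert by simp
  have sign: "(z - a) * ?P z > 0 \<longleftrightarrow> (z > a \<longleftrightarrow> ?P z > 0)" if "z \<noteq> a" "?P z \<noteq> 0" for z
    using that by (auto simp: zero_less_mult_iff)
  have nea: "x \<noteq> a" "y \<noteq> a" using insert.prems by auto
  have seg: "a \<in> closed_segment x y \<longleftrightarrow> (x > a \<longleftrightarrow> \<not> y > a)"
    using nea by (auto simp: closed_segment_eq_real_ivl)
  have card: "card {t \<in> insert a T. t \<in> closed_segment x y}
     = (if a \<in> closed_segment x y then Suc (card {t \<in> T. t \<in> closed_segment x y}) else card {t \<in> T. t \<in> closed_segment x y})"
  proof (cases "a \<in> closed_segment x y")
    case True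
    then have "{t \<in> insert a T. t \<in> closed_segment x y} = insert a {t \<in> T. t \<in> closed_segment x y}" by auto
    then show ?thesis using True insert by simp
  next
    case False
    then have "{t \<in> insert a T. t \<in> closed_segment x y} = {t \<in> T. t \<in> closed_segment x y}" by auto
    then show ?thesis using False by simp
  qed
  show ?case
    unfolding prod card using IH nea seg sign[OF nea(1) IH(1)] sign[OF nea(2) IH(2)] by auto
qed simp

section \<open>Hyperplanes orthogonal to a direction\<close>

locale direction_in =
  fixes V :: "'a::euclidean_space set" and v :: 'a
  assumes V: "subspace V" and v: "v \<in> V" "v \<bullet> v = 1"
begin

definition level :: "real \<Rightarrow> 'a set" where
  "level t = {x \<in> V. x \<bullet> v = t}"

lemma level_translation: "level t = (+) ((t - s) *\<^sub>R v) ` level s"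
proof
  show "level t \<subseteq> (+) ((t - s) *\<^sub>R v) ` level s"
  proof
    fix x assume "x \<in> level t"
    then have "x - (t - s) *\<^sub>R v \<in> level s"
      using V v by (simp add: level_def subspace_diff subspace_scale inner_diff_left)
    then show "x \<in> (+) ((t - s) *\<^sub>R v) ` level s" by (intro image_eqI[of _ _ "x - (t - s) *\<^sub>R v"]) auto
  qed
  show "(+) ((t - s) *\<^sub>R v) ` level s \<subseteq> level t"
    using V v by (auto simp: level_def subspace_add subspace_scale inner_add_left)
qed

lemma level_nonempty: "t *\<^sub>R v \<in> level t"
  using V v by (simp add: level_def subspace_scale)

lemma level_inj: "inj level"
proof (rule injI)
  fix s t assume "level s = level t"
  then have "s *\<^sub>R v \<in> level t" using level_nonempty[of s] by simp
  then show "s = t" using v by (simp add: level_def)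
qed

lemma hyperplane_level: "hyperplane_in V (level t)"
proof -
  have sub0: "subspace (level 0)"
    using V by (auto simp: level_def subspace_def inner_add_left)
  have "v \<noteq> 0" using v by auto
  have "level 0 = {y \<in> V. \<forall>x\<in>span {v}. orthogonal x y}"
  proof -
    have "(\<forall>x\<in>span {v}. orthogonal x y) \<longleftrightarrow> y \<bullet> v = 0" for y
      by (auto simp: span_singleton orthogonal_def inner_commute dest: bspec[of _ _ "1 *\<^sub>R v"])
    then show ?thesis by (simp add: level_def)
  qed
  moreover have "span {v} \<subseteq> V" using v V by (intro span_minimal) auto
  ultimately have "dim (level 0) + 1 = dim V"
    using dim_subspace_orthogonal_to_vectors[of "span {v}" V] V \<open>v \<noteq> 0\<close> by simp
  then have "aff_dim (level 0) = int (dim V) - 1"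
    using aff_dim_subspace[OF sub0] by simp
  then have "aff_dim (level t) = int (dim V) - 1"
    unfolding level_translation[of t 0] by (simp add: aff_dim_translation_eq)
  moreover have "affine (level t)"
    unfolding level_translation[of t 0] using subspace_imp_affine[OF sub0] affine_translation by blast
  ultimately show ?thesis using level_nonempty[of t] by (auto simp: hyperplane_in_def level_def)
qed

lemma parallel_levels:
  assumes "finite T"
  shows "parallel_hyperplanes V (level ` T)"
proof -
  have "affine_parallel (level s) (level t)" for s t
    unfolding affine_parallel_def using level_translation[of t s] by blast
  then show ?thesis using assms hyperplane_level by (simp add: parallel_hyperplanes_def)
qed

lemma segment_level:
  assumes "x \<in> V" "y \<in> V"
  shows "closed_segment x y \<inter> level t \<noteq> {} \<longleftrightarrow> t \<in> closed_segment (x \<bullet> v) (y \<bullet> v)"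
proof -
  have "closed_segment x y \<subseteq> V"
    using assms subspace_imp_convex[OF V] by (simp add: closed_segment_subset)
  then have "closed_segment x y \<inter> level t \<noteq> {} \<longleftrightarrow> t \<in> (\<lambda>z. z \<bullet> v) ` closed_segment x y"
    by (auto simp: level_def)
  also have "(\<lambda>z. z \<bullet> v) ` closed_segment x y = closed_segment (x \<bullet> v) (y \<bullet> v)"
    by (rule closed_segment_linear_image[symmetric]) (simp add: linear_iff inner_add_left)
  finally show ?thesis .
qed

text \<open>Crossing a hyperplane changes the sign of exactly one factor of \<open>Q\<close>. As
  \<open>level\<close> is injective, the hyperplanes met by a segment correspond to the elements of
  \<open>T\<close> between the inner products of its ends with \<open>v\<close>.\<close>

lemma chessboard_levels:
  assumes "finite T"
  defines "Q \<equiv> \<lambda>x. \<Prod>t\<in>T. x \<bullet> v - t"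
  shows "chessboard_coloring V (level ` T) {x \<in> V. Q x \<ge> 0} {x \<in> V. Q x \<le> 0}"
  unfolding chessboard_coloring_def
proof (intro conjI ballI)
  have cont: "continuous_on UNIV Q" unfolding Q_def by (intro continuous_intros)
  show "closed {x \<in> V. Q x \<ge> 0}" "closed {x \<in> V. Q x \<le> 0}"
    unfolding Collect_conj_eq Collect_mem_eq
    by (intro closed_Int closed_subspace[OF V] closed_Collect_le continuous_intros cont)+
  show "{x \<in> V. Q x \<ge> 0} \<union> {x \<in> V. Q x \<le> 0} = V" by auto
  show "{x \<in> V. Q x \<ge> 0} \<inter> {x \<in> V. Q x \<le> 0} = \<Union> (level ` T)"
  proof -
    have "Q x = 0 \<longleftrightarrow> x \<bullet> v \<in> T" for x using assms(1) by (auto simp: Q_def)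
    then have "\<Union> (level ` T) = {x \<in> V. Q x = 0}" by (auto simp: level_def)
    then show ?thesis by auto
  qed
  fix x y assume x: "x \<in> V - \<Union> (level ` T)" and y: "y \<in> V - \<Union> (level ` T)"
  then have xy: "x \<in> V" "y \<in> V" "x \<bullet> v \<notin> T" "y \<bullet> v \<notin> T" by (auto simp: level_def)
  have "{H \<in> level ` T. closed_segment x y \<inter> H \<noteq> {}} = level ` {t \<in> T. t \<in> closed_segment (x \<bullet> v) (y \<bullet> v)}"
    using segment_level[OF xy(1,2)] by blast
  then have "card {H \<in> level ` T. closed_segment x y \<inter> H \<noteq> {}} = card {t \<in> T. t \<in> closed_segment (x \<bullet> v) (y \<bullet> v)}"
    using card_image[OF inj_on_subset[OF level_inj subset_UNIV]] by metis
  then show "((x \<in> {x \<in> V. Q x \<ge> 0}) \<longleftrightarrow> (y \<in> {x \<in> V. Q x \<ge> 0})) \<longleftrightarrow>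
      even (card {H \<in> level ` T. closed_segment x y \<inter> H \<noteq> {}})"
    using prod_sign_change[OF assms(1) xy(3,4)] xy(1,2) by (auto simp: Q_def less_le)
qed

text \<open>Outside the null set where the polynomial vanishes, its sign and that of
  \<open>Q\<close> differ by a constant factor, because \<open>r\<close> does not change sign. The
  integral of the sign of \<open>Q\<close> is the measure of the white set minus that of the black
  set; where \<open>Q\<close> is 0 both contribute and cancel.\<close>

lemma bisection_of_polynomial:
  assumes p: "p \<noteq> 0" "degree p \<le> k"
    and \<nu>: "\<And>i. i \<in> I \<Longrightarrow> \<nu> i \<in> masses V" "\<And>i. i \<in> I \<Longrightarrow> (\<integral>x. sgn (poly p (x \<bullet> v)) \<partial>\<nu> i) = 0"
  shows "\<exists>\<H> W B. parallel_hyperplanes V \<H> \<and> card \<H> \<le> k \<and> chessboard_coloring V \<H> W B \<and>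
     (\<forall>i\<in>I. bisects W B (\<nu> i))"
proof -
  obtain T r where T: "finite T" "card T \<le> degree p" "p = (\<Prod>t\<in>T. [:- t, 1:]) * r"
    and r: "(\<forall>s. poly r s \<ge> 0) \<or> (\<forall>s. poly r s \<le> 0)"
    using poly_sign_factorization[OF p(1)] by blast
  define Q where "Q = (\<lambda>x. \<Prod>t\<in>T. x \<bullet> v - t)"
  define \<sigma> :: real where "\<sigma> = (if \<forall>s. poly r s \<ge> 0 then 1 else - 1)"
  have pQ: "poly p (x \<bullet> v) = Q x * poly r (x \<bullet> v)" for x
    by (simp add: T(3) Q_def poly_prod)
  have sgn_eq: "sgn (Q x) = \<sigma> * sgn (poly p (x \<bullet> v))" if "poly p (x \<bullet> v) \<noteq> 0" for x
  proof -
    have "poly r (x \<bullet> v) \<noteq> 0" using that pQ by auto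
    have "sgn (poly r (x \<bullet> v)) = \<sigma>"
    proof (cases "\<forall>s. poly r s \<ge> 0")
      case True
      then have "poly r (x \<bullet> v) > 0" using \<open>poly r (x \<bullet> v) \<noteq> 0\<close> by (simp add: less_le)
      then show ?thesis using True by (simp add: \<sigma>_def)
    next
      case False
      then have "poly r (x \<bullet> v) < 0" using r \<open>poly r (x \<bullet> v) \<noteq> 0\<close> by (auto simp: less_le)
      then show ?thesis using False by (simp add: \<sigma>_def)
    qed
    moreover have "\<sigma> * \<sigma> = 1" by (simp add: \<sigma>_def)
    ultimately show ?thesis by (simp add: pQ sgn_mult)
  qed
  have "v \<noteq> 0" using v by auto
  have cont: "continuous_on S Q" for S unfolding Q_def by (intro continuous_intros)
  have "bisects {x \<in> V. Q x \<ge> 0} {x \<in> V. Q x \<le> 0} (\<nu> i)" if i: "i \<in> I" for i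
  proof -
    let ?W = "{x \<in> V. Q x \<ge> 0}" and ?B = "{x \<in> V. Q x \<le> 0}"
    note m = \<nu>(1)[OF i]
    have Qm[measurable]: "Q \<in> borel_measurable (\<nu> i)" by (rule borel_measurable_mass[OF m cont])
    have pm[measurable]: "(\<lambda>x. poly p (x \<bullet> v)) \<in> borel_measurable (\<nu> i)"
      by (rule borel_measurable_mass[OF m]) (intro continuous_intros)
    have sp: "space (\<nu> i) = V" by (rule massesD(2)[OF m])
    have "{x \<in> space (\<nu> i). Q x \<ge> 0} \<in> sets (\<nu> i)" "{x \<in> space (\<nu> i). Q x \<le> 0} \<in> sets (\<nu> i)"
      by measurable
    then have sets: "?W \<in> sets (\<nu> i)" "?B \<in> sets (\<nu> i)" by (simp_all add: sp)
    have int: "integrable (\<nu> i) (indicator ?W :: _ \<Rightarrow> real)" "integrable (\<nu> i) (indicator ?B :: _ \<Rightarrow> real)"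
      using sets by (auto intro!: mass_integrable[OF m, where C = 1] simp: indicator_def)
    have "measure (\<nu> i) ?W - measure (\<nu> i) ?B = (\<integral>x. indicator ?W x - indicator ?B x \<partial>\<nu> i)"
      using int sets by simp
    also have "\<dots> = (\<integral>x. sgn (Q x) \<partial>\<nu> i)"
      by (intro Bochner_Integration.integral_cong refl) (auto simp: indicator_def sgn_if sp)
    also have "\<dots> = (\<integral>x. \<sigma> * sgn (poly p (x \<bullet> v)) \<partial>\<nu> i)"
    proof (rule integral_cong_AE)
      have "AE x in \<nu> i. poly p (x \<bullet> v) \<noteq> 0"
        by (rule AE_polynomial_nonzero[OF m V v(1) \<open>v \<noteq> 0\<close> p(1)])
      then show "AE x in \<nu> i. sgn (Q x) = \<sigma> * sgn (poly p (x \<bullet> v))"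
        by eventually_elim (rule sgn_eq)
    qed measurable
    also have "\<dots> = 0" using \<nu>(2)[OF i] by simp
    finally show ?thesis by (simp add: bisects_def)
  qed
  moreover have "card (level ` T) \<le> k"
    using card_image_le[OF T(1), of level] T(2) p(2) by linarith
  ultimately show ?thesis
    using parallel_levels[OF T(1)] chessboard_levels[OF T(1)] unfolding Q_def by blast
qed

end

lemma exists_orthonormal_frame:
  "\<exists>b :: nat \<Rightarrow> 'a::euclidean_space. orthonormal_frame DIM('a) b"
proof -
  obtain b :: "nat \<Rightarrow> 'a" where b: "bij_betw b {..<DIM('a)} Basis"
    using ex_bij_betw_nat_finite[of "Basis :: 'a set"] by (auto simp: atLeast0LessThan)
  then have "b i \<bullet> b j = (if i = j then 1 else 0)" if "i < DIM('a)" "j < DIM('a)" for i j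
  proof -
    have "b i \<in> Basis" "b j \<in> Basis" "b i = b j \<longleftrightarrow> i = j"
      using b that by (auto simp: bij_betw_def inj_on_def)
    then show ?thesis by (simp add: inner_Basis)
  qed
  then show ?thesis unfolding orthonormal_frame_def by (intro exI[of _ b]) blast
qed

theorem theorem1p4:
  fixes d k m :: nat
    and \<mu> :: "nat \<Rightarrow> (real ^ 'n) set \<Rightarrow> (real ^ 'n) measure"
  assumes "d \<ge> 1" and "k \<ge> 1"
    and "CARD('n) = d + m"
    and "odd (Stirling (d + m + k - 1) k)"
    and "\<And>i. i \<in> {1..d + m + k - 1} \<Longrightarrow> mass_assignment d (\<mu> i)"
  shows "\<exists>V \<in> grassmannian d. \<exists>\<H> W B.
           parallel_hyperplanes V \<H> \<and> card \<H> \<le> k \<and>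
           chessboard_coloring V \<H> W B \<and>
           (\<forall>i \<in> {1..d + m + k - 1}. bisects W B (\<mu> i V))"
proof -
  define n where "n = d + m + k - 1"
  obtain b :: "nat \<Rightarrow> real ^ 'n" where b: "orthonormal_frame (d + m) b"
    using exists_orthonormal_frame[where 'a = "real ^ 'n"] assms(3) by auto
  \<comment> \<open>\<open>G\<close> is defined for arbitrary arguments, also where
    \<open>flag_space\<close> is not of dimension \<open>d\<close>. The symmetries are purely
    formal; the geometry enters only through arguments on unit spheres.\<close>
  define G where "G \<alpha> \<beta> c i = (\<integral>x. sgn (polysum k c (x \<bullet> direction b d m \<alpha> \<beta>)) \<partial>\<mu> i (flag_space b d m \<alpha> \<beta>))"
    for \<alpha> \<beta> c i
  \<comment> \<open>The pole varies on the \<open>(d - 1)\<close>-sphere of \<open>F\<close>, the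
    direction components on an \<open>m\<close>-sphere and the coefficients on a
    \<open>k\<close>-sphere.\<close>
  interpret equivariant_map "d - 1" m k n G
  proof
    show "n = d - 1 + m + k" "1 \<le> n" using assms(1,2) by (auto simp: n_def)
    show "G (\<lambda>i. - \<alpha> i) (\<beta>(0 := - \<beta> 0)) c = G \<alpha> \<beta> c" for \<alpha> \<beta> c
      by (simp add: G_def fun_eq_iff direction_flip flag_space_flip)
    show "G \<alpha> (\<lambda>i. - \<beta> i) (\<lambda>i. (-1) ^ i * c i) = G \<alpha> \<beta> c" for \<alpha> \<beta> c
    proof -
      have "polysum k (\<lambda>i. (-1) ^ i * c i) (- s) = polysum k c s" for s
        unfolding polysum_def
      proof (rule sum.cong[OF refl])
        fix j show "(-1) ^ j * c j * (- s) ^ j = c j * s ^ j"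
          by (cases "even j") auto
      qed
      then show ?thesis by (simp add: G_def fun_eq_iff direction_minus flag_space_minus)
    qed
    show "G \<alpha> \<beta> (\<lambda>i. - c i) = (\<lambda>l. - G \<alpha> \<beta> c l)" for \<alpha> \<beta> c
    proof -
      have "polysum k (\<lambda>i. - c i) s = - polysum k c s" for s by (simp add: polysum_def sum_negf)
      then show ?thesis by (simp add: G_def sgn_minus fun_eq_iff)
    qed
  qed
  define vv where "vv t = direction b d m (spherical (block t 0 (d - 1))) (spherical (block t (d - 1) m))" for t
  define VV where "VV t = flag_space b d m (spherical (block t 0 (d - 1))) (spherical (block t (d - 1) m))" for t
  define cc where "cc t = spherical (block t (d - 1 + m) k)" for t
  have value_eq: "value_at t i = (\<integral>x. sgn (polysum k (cc t) (x \<bullet> vv t)) \<partial>\<mu> i (VV t))" for t i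
    unfolding value_at_def G_def vv_def VV_def cc_def by (rule refl)
  have frame: "orthonormal_frame d (flag_frame b d m t)" and span: "span (flag_frame b d m t ` {..<d}) = VV t" for t
    using flag_frame[OF b assms(1)] by (auto simp: VV_def)
  have VV: "VV t \<in> grassmannian d" for t using span_frame_grassmannian[OF frame] span by metis
  have v_frame: "vv t = flag_frame b d m t 0" for t by (simp add: vv_def flag_frame_def)
  have vv: "vv t \<in> VV t" "vv t \<bullet> vv t = 1" for t
  proof -
    show "vv t \<in> VV t" unfolding v_frame span[symmetric] by (rule span_base) (use assms(1) in auto)
    show "vv t \<bullet> vv t = 1" unfolding v_frame using orthonormal_frameD[OF frame, of 0 0 t] assms(1) by simp
  qed
  \<comment> \<open>The coefficient vector has norm 1, so every parameter gives a nonzero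
    polynomial; both the continuity and the coloring rely on this.\<close>
  have cc: "\<exists>j\<le>k. cc t j \<noteq> 0" for t
  proof (rule ccontr)
    assume "\<not> ?thesis"
    then have "(\<Sum>i\<le>k. (cc t i)\<^sup>2) = 0" by auto
    then show False using sum_spherical_block[of t "d - 1 + m" k] by (simp add: cc_def)
  qed
  have "\<exists>t. \<forall>l\<in>{1..n}. value_at t l = 0"
  proof (rule common_zero)
    show "odd (Stirling n k)" using assms(4) by (simp add: n_def)
    fix l assume "l \<in> {1..n}"
    then have l: "mass_assignment d (\<mu> l)" using assms(5) by (simp add: n_def)
    show "continuous_on UNIV (\<lambda>t. value_at t l)"
      unfolding continuous_on_def value_eq
    proof
      fix t0
      obtain j where j: "j \<le> k" "cc t0 j \<noteq> 0" using cc by blast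
      have lim: "(f \<longlongrightarrow> f t0) (at t0)" if "continuous_on UNIV f"
        for f :: "(nat \<Rightarrow> real) \<Rightarrow> 'b::topological_space"
        using that by (simp add: continuous_on_def)
      show "((\<lambda>t. \<integral>x. sgn (polysum k (cc t) (x \<bullet> vv t)) \<partial>\<mu> l (VV t)) \<longlongrightarrow>
         (\<integral>x. sgn (polysum k (cc t0) (x \<bullet> vv t0)) \<partial>\<mu> l (VV t0))) (at t0)"
      proof (rule sgn_integral_continuous[where V = VV and v = vv and c = cc and ?V0.0 = "VV t0" and ?v0.0 = "vv t0"
          and ?c0.0 = "cc t0" and j = j, OF l VV VV vv(1) _ j])
        show "vv t0 \<noteq> 0" using vv(2)[of t0] by auto
        fix N assume N: "openin (grassmannian_topology d) N" "VV t0 \<in> N"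
        have "open {t. span (flag_frame b d m t ` {..<d}) \<in> N}"
          by (rule continuous_map_span_frame[OF frame continuous_on_flag_frame N(1)])
        then show "eventually (\<lambda>t. VV t \<in> N) (at t0)"
          using N(2) unfolding span by (auto simp: eventually_at_topological)
      next
        show "(vv \<longlongrightarrow> vv t0) (at t0)"
          by (rule lim) (use continuous_on_flag_frame[of b d m 0] in \<open>simp add: v_frame\<close>)
        fix j show "((\<lambda>t. cc t j) \<longlongrightarrow> cc t0 j) (at t0)"
          by (rule lim[of "\<lambda>t. cc t j"]) (simp add: cc_def continuous_on_spherical_block)
      qed
    qed
  qed
  then obtain t where t: "\<And>l. l \<in> {1..n} \<Longrightarrow> value_at t l = 0" by blast
  obtain j where j: "j \<le> k" "cc t j \<noteq> 0" using cc by blast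
  let ?p = "\<Sum>j\<le>k. monom (cc t j) j"
  interpret direction_in "VV t" "vv t"
    by unfold_locales (use VV[of t] vv[of t] in \<open>auto simp: grassmannian_def\<close>)
  have "degree ?p \<le> k"
    by (intro degree_sum_le) (auto intro: order_trans[OF degree_monom_le])
  moreover have "?p \<noteq> 0" by (rule polysum_poly_nonzero[of j k "cc t", OF j])
  moreover have "\<mu> i (VV t) \<in> masses (VV t)" if "i \<in> {1..n}" for i
    using assms(5) that by (intro mass_assignment_masses[OF _ VV]) (simp add: n_def)
  moreover have "(\<integral>x. sgn (poly ?p (x \<bullet> vv t)) \<partial>\<mu> i (VV t)) = 0" if "i \<in> {1..n}" for i
    unfolding polysum_poly[symmetric] value_eq[symmetric] by (rule t[OF that])
  ultimately have "\<exists>\<H> W B. parallel_hyperplanes (VV t) \<H> \<and> card \<H> \<le> k \<and> chessboard_coloring (VV t) \<H> W B \<and>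
     (\<forall>i\<in>{1..n}. bisects W B (\<mu> i (VV t)))"
    by (intro bisection_of_polynomial)
  then show ?thesis using VV[of t] unfolding n_def by blast
qed

end
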